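(* Let $d\ge1$ and let $\lambda\in\mathbb{R}\setminus\{0\}$. Suppose $E$ and $\Omega$ are measurable subsets of $\mathbb{C}^d$ of positive and finite Lebesgue measure, and suppose $t\in(0,\infty)$ is such that $\lambda t\in\mathbb{R}\setminus\pi\mathbb{Z}$. Then there exists a positive constant $C(\lambda,t,E,\Omega)$ such that for every $u_0\in L^2(\mathbb{C}^d)$, the solution $u$ of $$i\partial_t u(z,t)=L_\lambda u(z,t)\ \ ((z,t)\in\mathbb{C}^d\times(0,\infty)),\qquad u(z,0)=u_0(z),$$ satisfies $$\int_{\mathbb{C}^d}|u_0(z)|^2\,dz\leq C(\lambda,t,E,\Omega)\left(\int_{\mathbb{C}^d\setminus E}|u_0(z)|^2\,dz+\int_{\mathbb{C}^d\setminus\Omega}|u(z,t)|^2\,dz\right).$$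
   Context: For $\lambda\in\mathbb{R}\setminus\{0\}$ the special Hermite operator on $\mathbb{C}^d$ is $$L_\lambda=-\Delta_{\mathbb{C}^d}+\frac14\lambda^2\|z\|^2-i\lambda\sum_{j=1}^d\left(x_j\frac{\partial}{\partial y_j}-y_j\frac{\partial}{\partial x_j}\right),$$ where $z=(x_1+iy_1,\dots,x_d+iy_d)\in\mathbb{C}^d$, $\|z\|$ is the Euclidean norm, and $\Delta_{\mathbb{C}^d}=\sum_j(\partial_{x_j}^2+\partial_{y_j}^2)$ is the Laplacian on $\mathbb{C}^d\cong\mathbb{R}^{2d}$. It is understood as a self-adjoint operator on $L^2(\mathbb{C}^d)$ (the closure of its restriction to $C_c^\infty(\mathbb{C}^d)$), and $dz$ is Lebesgue measure on $\mathbb{C}^d\cong\mathbb{R}^{2d}$. The solution of the initial value problem with data $u_0\in L^2(\mathbb{C}^d)$ is $u(\cdot,t)=e^{-itL_\lambda}u_0$, defined by the spectral theorem. *)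

theory Defs
  imports "HOL-Analysis.Analysis"
begin

section \<open>Square-integrable functions\<close>

text \<open>
  Elements of the Hilbert space of square-integrable functions are represented by functions;
  identities in that space are stated almost everywhere.
\<close>

definition L2 :: "('a::euclidean_space \<Rightarrow> complex) set" where
  "L2 = {f. f \<in> borel_measurable lebesgue \<and> integrable lebesgue (\<lambda>z. (cmod (f z))\<^sup>2)}"

definition L2_inner :: "('a::euclidean_space \<Rightarrow> complex) \<Rightarrow> ('a \<Rightarrow> complex) \<Rightarrow> complex" where
  "L2_inner f g = (LINT z|lebesgue. f z * cnj (g z))"

definition L2_norm :: "('a::euclidean_space \<Rightarrow> complex) \<Rightarrow> real" where
  "L2_norm f = sqrt (LINT z|lebesgue. (cmod (f z))\<^sup>2)"

definition L2_tendsto ::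
    "(nat \<Rightarrow> 'a::euclidean_space \<Rightarrow> complex) \<Rightarrow> ('a \<Rightarrow> complex) \<Rightarrow> bool" where
  "L2_tendsto F f \<longleftrightarrow> (\<forall>n. F n \<in> L2) \<and> f \<in> L2 \<and> (\<lambda>n. L2_norm (\<lambda>z. F n z - f z)) \<longlonglongrightarrow> 0"

definition L2_eq :: "('a::euclidean_space \<Rightarrow> complex) \<Rightarrow> ('a \<Rightarrow> complex) \<Rightarrow> bool" where
  "L2_eq f g \<longleftrightarrow> (AE z in lebesgue. f z = g z)"

section \<open>Test functions and the special Hermite operator\<close>

definition dir_deriv :: "'a::euclidean_space \<Rightarrow> ('a \<Rightarrow> complex) \<Rightarrow> 'a \<Rightarrow> complex" where
  "dir_deriv v f = (\<lambda>z. frechet_derivative f (at z) v)"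

text \<open>
  Differentiability of all iterated directional derivatives forces their continuity, so this is
  the class of infinitely differentiable functions (of the underlying real variables).
\<close>

definition smooth :: "('a::euclidean_space \<Rightarrow> complex) \<Rightarrow> bool" where
  "smooth f \<longleftrightarrow> (\<forall>vs z. foldr dir_deriv vs f differentiable (at z))"

definition test_functions :: "('a::euclidean_space \<Rightarrow> complex) set" where
  "test_functions = {f. smooth f \<and> compact (closure {z. f z \<noteq> 0})}"

abbreviation D_x :: "'d::finite \<Rightarrow> (complex^'d \<Rightarrow> complex) \<Rightarrow> complex^'d \<Rightarrow> complex" where
  "D_x j \<equiv> dir_deriv (axis j 1)"

abbreviation D_y :: "'d::finite \<Rightarrow> (complex^'d \<Rightarrow> complex) \<Rightarrow> complex^'d \<Rightarrow> complex" where
  "D_y j \<equiv> dir_deriv (axis j \<i>)"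

definition laplacian :: "(complex^'d::finite \<Rightarrow> complex) \<Rightarrow> complex^'d \<Rightarrow> complex" where
  "laplacian f z = (\<Sum>j\<in>UNIV. D_x j (D_x j f) z + D_y j (D_y j f) z)"

definition special_hermite ::
    "real \<Rightarrow> (complex^'d::finite \<Rightarrow> complex) \<Rightarrow> complex^'d \<Rightarrow> complex" where
  "special_hermite lam f z =
     - laplacian f z
     + complex_of_real (1 / 4 * lam\<^sup>2 * (norm z)\<^sup>2) * f z
     - \<i> * complex_of_real lam *
         (\<Sum>j\<in>UNIV. complex_of_real (Re (z $ j)) * D_y j f z
                  - complex_of_real (Im (z $ j)) * D_x j f z)"

text \<open>
  The graph of the closure, as an operator on the space of square-integrable functions, of the
  special Hermite operator restricted to the test functions.
\<close>

definition special_hermite_closure ::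
    "real \<Rightarrow> ((complex^'d::finite \<Rightarrow> complex) \<times> (complex^'d \<Rightarrow> complex)) set" where
  "special_hermite_closure lam =
     {(v, w). \<exists>\<phi>. (\<forall>n. \<phi> n \<in> test_functions) \<and> L2_tendsto \<phi> v \<and>
                  L2_tendsto (\<lambda>n. special_hermite lam (\<phi> n)) w}"

section \<open>Spectral measures and functional calculus\<close>

definition orthogonal_projection ::
    "(('a::euclidean_space \<Rightarrow> complex) \<Rightarrow> 'a \<Rightarrow> complex) \<Rightarrow> bool" where
  "orthogonal_projection Q \<longleftrightarrow>
     (\<forall>f\<in>L2. Q f \<in> L2) \<and>
     (\<forall>f\<in>L2. \<forall>g\<in>L2. \<forall>a b. L2_eq (Q (\<lambda>z. a * f z + b * g z)) (\<lambda>z. a * Q f z + b * Q g z)) \<and>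
     (\<forall>f\<in>L2. L2_eq (Q (Q f)) (Q f)) \<and>
     (\<forall>f\<in>L2. \<forall>g\<in>L2. L2_inner (Q f) g = L2_inner f (Q g))"

definition projection_valued_measure ::
    "(real set \<Rightarrow> ('a::euclidean_space \<Rightarrow> complex) \<Rightarrow> 'a \<Rightarrow> complex) \<Rightarrow> bool" where
  "projection_valued_measure P \<longleftrightarrow>
     (\<forall>B\<in>sets borel. orthogonal_projection (P B)) \<and>
     (\<forall>f\<in>L2. L2_eq (P {} f) (\<lambda>z. 0)) \<and>
     (\<forall>f\<in>L2. L2_eq (P UNIV f) f) \<and>
     (\<forall>A\<in>sets borel. \<forall>B\<in>sets borel. \<forall>f\<in>L2. L2_eq (P (A \<inter> B) f) (P A (P B f))) \<and>
     (\<forall>B. range B \<subseteq> sets borel \<longrightarrow> disjoint_family B \<longrightarrow>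
        (\<forall>f\<in>L2. L2_tendsto (\<lambda>n z. \<Sum>k<n. P (B k) f z) (P (\<Union>k. B k) f)))"

definition scalar_spectral_measure ::
    "(real set \<Rightarrow> ('a::euclidean_space \<Rightarrow> complex) \<Rightarrow> 'a \<Rightarrow> complex) \<Rightarrow> ('a \<Rightarrow> complex) \<Rightarrow> real measure"
  where
  "scalar_spectral_measure P v =
     measure_of UNIV (sets borel) (\<lambda>B. ennreal (Re (L2_inner (P B v) v)))"

definition simple_spectral_integral ::
    "(real set \<Rightarrow> ('a::euclidean_space \<Rightarrow> complex) \<Rightarrow> 'a \<Rightarrow> complex) \<Rightarrow> (real \<Rightarrow> complex) \<Rightarrow>
     ('a \<Rightarrow> complex) \<Rightarrow> 'a \<Rightarrow> complex" where
  "simple_spectral_integral P s v = (\<lambda>z. \<Sum>c\<in>range s. c * P (s -` {c}) v z)"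

text \<open>
  The graph of the operator \<open>\<integral> F dP\<close>: approximate \<open>F\<close> by simple functions in the space of functions
  square-integrable with respect to the scalar spectral measure of \<open>v\<close>. By the isometry property of
  the simple integral, such an approximation exists exactly when \<open>F\<close> itself is square-integrable with
  respect to that measure, so the usual domain of \<open>\<integral> F dP\<close> is obtained.
\<close>

definition spectral_integral ::
    "(real set \<Rightarrow> ('a::euclidean_space \<Rightarrow> complex) \<Rightarrow> 'a \<Rightarrow> complex) \<Rightarrow> (real \<Rightarrow> complex) \<Rightarrow>
     (('a \<Rightarrow> complex) \<times> ('a \<Rightarrow> complex)) set" where
  "spectral_integral P F =
     {(v, w). v \<in> L2 \<and> w \<in> L2 \<and>
        (\<exists>s. (\<forall>n. simple_function borel (s n)) \<and>
             (\<lambda>n. \<integral>\<^sup>+x. ennreal ((cmod (s n x - F x))\<^sup>2) \<partial>scalar_spectral_measure P v) \<longlonglongrightarrow> 0 \<and>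
             L2_tendsto (\<lambda>n. simple_spectral_integral P (s n) v) w)}"

definition spectral_resolution ::
    "(real set \<Rightarrow> ('a::euclidean_space \<Rightarrow> complex) \<Rightarrow> 'a \<Rightarrow> complex) \<Rightarrow>
     (('a \<Rightarrow> complex) \<times> ('a \<Rightarrow> complex)) set \<Rightarrow> bool" where
  "spectral_resolution P T \<longleftrightarrow>
     projection_valued_measure P \<and> T = spectral_integral P complex_of_real"

text \<open>
  \<open>u t = exp (- i t L) u\<^sub>0\<close> for all \<open>t \<ge> 0\<close>, where \<open>L\<close> is the closed special Hermite operator and the
  exponential is given by the functional calculus of its spectral resolution.
\<close>

definition schroedinger_solution ::
    "real \<Rightarrow> (complex^'d::finite \<Rightarrow> complex) \<Rightarrow> (real \<Rightarrow> complex^'d \<Rightarrow> complex) \<Rightarrow> bool" where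
  "schroedinger_solution lam u\<^sub>0 u \<longleftrightarrow>
     (\<exists>P. spectral_resolution P (special_hermite_closure lam) \<and>
          (\<forall>t\<ge>0. (u\<^sub>0, u t) \<in> spectral_integral P (\<lambda>x. exp (- \<i> * complex_of_real (t * x)))))"

end

theory Submission
  imports Defs "HOL-Real_Asymp.Real_Asymp" "HOL-Probability.Distributions" "HOL-Complex_Analysis.Great_Picard"
begin

text \<open>
  Let \<open>U = exp (- i t L)\<close>. When \<open>sin (\<lambda>t)\<close> does not vanish, \<open>U\<close> acts on integrable
  square-integrable functions as an integral operator (Mehler's formula) with kernel
  \<open>c * cis (q (w - z) + om w z)\<close>, where \<open>q\<close> is a quadratic form, \<open>om\<close> a multiple of the
  symplectic form and \<open>c\<close> a constant. The kernel has constant modulus, just like that of the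
  Fourier transform, and it turns twisted translations into translations, up to phases. These
  two facts and the unitarity of \<open>U\<close> are all that the argument of Amrein and Berthier needs: for
  sets \<open>E\<close>, \<open>\<Omega>\<close> of finite measure there is \<open>\<delta> > 0\<close> such that every \<open>g\<close> supported in \<open>E\<close>
  satisfies \<open>\<delta> * \<parallel>g\<parallel> \<le> \<parallel>U g\<parallel>\<close>, the right-hand norm being taken over the complement of \<open>\<Omega>\<close>
  (\<open>concentration_bound\<close>). Applied to \<open>g = 1\<^sub>E u\<^sub>0\<close>, and because \<open>U\<close> does not enlarge the
  remainder \<open>u\<^sub>0 - g\<close>, this bounds \<open>\<parallel>u\<^sub>0\<parallel>\<close> by \<open>1 + 1 / \<delta>\<close> times the sum of the two observed
  norms.

  \<^bold>\<open>The kernel.\<close> The solution is given only by the spectral theorem, so its kernel has to be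
  found by duality. The functions \<open>heat \<lambda> w \<tau>\<close>, Gaussians centred at \<open>w\<close>, are up to a constant
  the heat kernels \<open>exp (- \<tau> L) \<delta>\<^sub>w\<close> continued to complex time \<open>\<tau>\<close>. For fixed \<open>Re \<tau> > 0\<close> they
  solve the Schroedinger equation in the variable \<open>Im \<tau>\<close>. Pairing them with a solution gives
  \<open>\<langle>U u\<^sub>0, heat w \<epsilon>\<rangle> = \<langle>u\<^sub>0, heat w (\<epsilon> - i t)\<rangle>\<close> (\<open>heat_pairing\<close>). As \<open>\<epsilon> \<rightarrow> 0\<close> the left-hand side
  tends to a multiple of \<open>U u\<^sub>0\<close>, because \<open>heat w \<epsilon>\<close> is a twisted approximate identity, and the
  right-hand side tends to the integral of \<open>u\<^sub>0\<close> against a bounded kernel, because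
  \<open>\<bar>sinh (\<lambda> (\<epsilon> - i t))\<bar>\<close> stays above \<open>\<bar>sin (\<lambda>t)\<bar>\<close> (\<open>schroedinger_kernel\<close>).

  \<^bold>\<open>The pairing.\<close> A curve \<open>G\<close> which satisfies \<open>G' = - i L G\<close> when tested against the domain of
  \<open>L\<close> is carried by the unitary group (\<open>evolution_pairing\<close>). The proof uses nothing but
  \<open>L = \<integral> x dP\<close>: on the range of \<open>P B\<close> with \<open>B\<close> a short interval, \<open>L\<close> is nearly multiplication by
  a number, so each of the components of \<open>u\<^sub>0\<close> for a fine partition of the spectrum is
  transported almost exactly. That the heat kernels solve the equation in this weak sense is an
  integration by parts against test functions, which reaches the domain of the closure by
  passing to the limit.

  \<^bold>\<open>The uncertainty principle.\<close> If \<open>f \<noteq> 0\<close> had support in a set of finite measure, and its image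
  too, then so would its twisted translates; many tiny translates are linearly independent and
  have their supports, and those of their images, in sets of bounded measure. But an orthonormal
  system with this property cannot be large, since the kernel is square-integrable on a product
  of two sets of finite measure (\<open>no_concentration\<close>). The bound with \<open>\<delta>\<close> then follows by
  compactness.
\<close>

section \<open>The Hilbert space of square-integrable functions\<close>

lemma L2_measurable: "f \<in> L2 \<Longrightarrow> f \<in> borel_measurable lebesgue"
  by (simp add: L2_def)

lemma L2_integrable_square: "f \<in> L2 \<Longrightarrow> integrable lebesgue (\<lambda>z. (cmod (f z))\<^sup>2)"
  by (simp add: L2_def)

lemma L2_norm_nonneg [simp]: "0 \<le> L2_norm f"
  by (simp add: L2_norm_def)

lemma L2_norm_square: "(L2_norm f)\<^sup>2 = (LINT z|lebesgue. (cmod (f z))\<^sup>2)"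
  by (simp add: L2_norm_def)

lemma L2_nn_integral:
  assumes "f \<in> L2"
  shows "(\<integral>\<^sup>+z. ennreal ((cmod (f z))\<^sup>2) \<partial>lebesgue) = ennreal ((L2_norm f)\<^sup>2)"
  unfolding L2_norm_square by (intro nn_integral_eq_integral L2_integrable_square assms) auto

text \<open>
  The form in which Tonelli arguments and Fatou's lemma deliver membership in \<open>L2\<close>:
  integrability and the norm bound come out of one estimate of a nonnegative integral.
\<close>

lemma L2_nn_integral_leI:
  assumes "f \<in> borel_measurable lebesgue"
    and "(\<integral>\<^sup>+z. ennreal ((cmod (f z))\<^sup>2) \<partial>lebesgue) \<le> ennreal C" "0 \<le> C"
  shows "f \<in> L2" "(L2_norm f)\<^sup>2 \<le> C"
proof -
  have "(\<integral>\<^sup>+z. ennreal ((cmod (f z))\<^sup>2) \<partial>lebesgue) < \<infinity>"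
    using assms(2) by (simp add: less_top[symmetric] top_unique)
       (metis ennreal_less_top infinity_ennreal_def le_less_trans order_less_irrefl)
  then show f: "f \<in> L2"
    unfolding L2_def using assms(1) by (auto intro!: integrableI_bounded)
  show "(L2_norm f)\<^sup>2 \<le> C"
    using L2_nn_integral[OF f] assms by (simp add: ennreal_le_iff)
qed

lemma L2_dominated:
  assumes "g \<in> L2" "f \<in> borel_measurable lebesgue" "AE z in lebesgue. cmod (f z) \<le> C * cmod (g z)" "0 \<le> C"
  shows "f \<in> L2" "L2_norm f \<le> C * L2_norm g"
proof -
  have "(\<integral>\<^sup>+z. ennreal ((cmod (f z))\<^sup>2) \<partial>lebesgue) \<le> (\<integral>\<^sup>+z. ennreal (C\<^sup>2) * ennreal ((cmod (g z))\<^sup>2) \<partial>lebesgue)"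
    by (rule nn_integral_mono_AE, use assms(3) in eventually_elim)
       (simp add: ennreal_mult'[symmetric] power_mult_distrib[symmetric] power_mono ennreal_le_iff)
  also have "\<dots> = ennreal ((C * L2_norm g)\<^sup>2)"
  proof (subst nn_integral_cmult)
    show "(\<lambda>z. ennreal ((cmod (g z))\<^sup>2)) \<in> borel_measurable lebesgue"
      using L2_measurable[OF assms(1)] by measurable
  qed (simp add: L2_nn_integral assms(1) ennreal_mult'[symmetric] power_mult_distrib)
  finally have *: "(\<integral>\<^sup>+z. ennreal ((cmod (f z))\<^sup>2) \<partial>lebesgue) \<le> ennreal ((C * L2_norm g)\<^sup>2)" .
  show "f \<in> L2" by (rule L2_nn_integral_leI[OF assms(2) *]) simp
  have "(L2_norm f)\<^sup>2 \<le> (C * L2_norm g)\<^sup>2" by (rule L2_nn_integral_leI[OF assms(2) *]) simp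
  then show "L2_norm f \<le> C * L2_norm g"
    by (rule power2_le_imp_le) (simp add: assms)
qed

lemma L2_bounded_mult:
  assumes "g \<in> L2" "f \<in> borel_measurable lebesgue" "\<And>z. cmod (f z) \<le> C" "0 \<le> C"
  shows "(\<lambda>z. f z * g z) \<in> L2" "L2_norm (\<lambda>z. f z * g z) \<le> C * L2_norm g"
  by (rule L2_dominated[OF assms(1)];
      use assms L2_measurable[OF assms(1)] in \<open>auto simp: norm_mult intro!: mult_right_mono borel_measurable_times\<close>)+

lemma L2_scale [intro]: "f \<in> L2 \<Longrightarrow> (\<lambda>z. a * f z) \<in> L2"
  by (rule L2_bounded_mult[where C="cmod a"]) auto

lemma L2_zero [simp, intro]: "(\<lambda>z. 0) \<in> L2"
  by (simp add: L2_def)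

lemma L2_minus [intro]: "f \<in> L2 \<Longrightarrow> (\<lambda>z. - f z) \<in> L2"
  using L2_scale[of f "-1"] by simp

lemma L2_cnj [intro]: "f \<in> L2 \<Longrightarrow> (\<lambda>z. cnj (f z)) \<in> L2"
  by (rule L2_dominated[where C=1 and g=f])
     (auto dest: L2_measurable intro: borel_measurable_continuous_on[OF continuous_on_cnj[OF continuous_on_id]])

lemma L2_indicator [intro]: "f \<in> L2 \<Longrightarrow> A \<in> sets lebesgue \<Longrightarrow> (\<lambda>z. indicator A z * f z) \<in> L2"
  by (rule L2_bounded_mult[where C=1]) (auto simp: indicator_def)

lemma L2_add [intro]:
  assumes "f \<in> L2" "g \<in> L2" shows "(\<lambda>z. f z + g z) \<in> L2"
proof -
  have "integrable lebesgue (\<lambda>z. (cmod (f z + g z))\<^sup>2)"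
  proof (rule Bochner_Integration.integrable_bound)
    show "integrable lebesgue (\<lambda>z. 2 * (cmod (f z))\<^sup>2 + 2 * (cmod (g z))\<^sup>2)"
      using assms by (auto simp: L2_def)
    show "AE z in lebesgue. norm ((cmod (f z + g z))\<^sup>2) \<le> norm (2 * (cmod (f z))\<^sup>2 + 2 * (cmod (g z))\<^sup>2)"
    proof (rule AE_I2)
      fix z
      have "(cmod (f z + g z))\<^sup>2 \<le> (cmod (f z) + cmod (g z))\<^sup>2" by (intro power_mono norm_triangle_ineq) simp
      also have "\<dots> \<le> 2 * (cmod (f z))\<^sup>2 + 2 * (cmod (g z))\<^sup>2"
        using sum_squares_bound[of "cmod (f z)" "cmod (g z)"] by (simp add: power2_sum)
      finally show "norm ((cmod (f z + g z))\<^sup>2) \<le> norm (2 * (cmod (f z))\<^sup>2 + 2 * (cmod (g z))\<^sup>2)" by simp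
    qed
    have "(\<lambda>z. f z + g z) \<in> borel_measurable lebesgue"
      using assms by (intro borel_measurable_add) (auto dest: L2_measurable)
    then show "(\<lambda>z. (cmod (f z + g z))\<^sup>2) \<in> borel_measurable lebesgue" by measurable
  qed
  then show ?thesis using assms unfolding L2_def by (auto intro!: borel_measurable_add)
qed

lemma L2_diff [intro]: "f \<in> L2 \<Longrightarrow> g \<in> L2 \<Longrightarrow> (\<lambda>z. f z - g z) \<in> L2"
  using L2_add[of f "\<lambda>z. - g z"] L2_minus[of g] by simp

lemma L2_sum [intro]: "(\<And>i. i \<in> I \<Longrightarrow> f i \<in> L2) \<Longrightarrow> (\<lambda>z. \<Sum>i\<in>I. f i z) \<in> L2"
  by (induction I rule: infinite_finite_induct) auto

lemma L2_abs_mult_integrable: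
  assumes "f \<in> L2" "g \<in> L2"
  shows "integrable lebesgue (\<lambda>z. cmod (f z) * cmod (g z))"
proof (rule Bochner_Integration.integrable_bound)
  show "integrable lebesgue (\<lambda>z. (cmod (f z))\<^sup>2 + (cmod (g z))\<^sup>2)"
    using assms by (auto simp: L2_def)
  show "(\<lambda>z. cmod (f z) * cmod (g z)) \<in> borel_measurable lebesgue"
    using assms[THEN L2_measurable] by measurable
  have "cmod (f z) * cmod (g z) \<le> (cmod (f z))\<^sup>2 + (cmod (g z))\<^sup>2" for z
  proof -
    have "2 * (cmod (f z) * cmod (g z)) \<le> (cmod (f z))\<^sup>2 + (cmod (g z))\<^sup>2"
      using sum_squares_bound[of "cmod (f z)" "cmod (g z)"] by simp
    moreover have "0 \<le> cmod (f z) * cmod (g z)" by simp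
    ultimately show ?thesis by linarith
  qed
  then show "AE z in lebesgue. norm (cmod (f z) * cmod (g z)) \<le> norm ((cmod (f z))\<^sup>2 + (cmod (g z))\<^sup>2)"
    by (intro AE_I2) (simp add: abs_mult)
qed

lemma L2_mult_integrable:
  assumes "f \<in> L2" "g \<in> L2"
  shows "integrable lebesgue (\<lambda>z. f z * g z)"
  using L2_abs_mult_integrable[OF assms]
  by (rule Bochner_Integration.integrable_bound)
     (use assms[THEN L2_measurable] in \<open>auto simp: norm_mult\<close>)

lemma L2_inner_integrable:
  "f \<in> L2 \<Longrightarrow> g \<in> L2 \<Longrightarrow> integrable lebesgue (\<lambda>z. f z * cnj (g z))"
  by (rule L2_mult_integrable) auto

lemma L2_norm_zero_iff:
  assumes "f \<in> L2" shows "L2_norm f = 0 \<longleftrightarrow> (AE z in lebesgue. f z = 0)"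
proof -
  have "L2_norm f = 0 \<longleftrightarrow> (LINT z|lebesgue. (cmod (f z))\<^sup>2) = 0" by (simp add: L2_norm_def)
  also have "\<dots> \<longleftrightarrow> (AE z in lebesgue. (cmod (f z))\<^sup>2 = 0)"
    by (rule integral_nonneg_eq_0_iff_AE[OF L2_integrable_square[OF assms]]) simp
  finally show ?thesis by simp
qed

lemma L2_Holder:
  assumes f: "f \<in> L2" and g: "g \<in> L2"
  shows "(LINT z|lebesgue. cmod (f z) * cmod (g z)) \<le> L2_norm f * L2_norm g"
proof (cases "L2_norm f = 0 \<or> L2_norm g = 0")
  case True
  then have "AE z in lebesgue. cmod (f z) * cmod (g z) = 0"
    using L2_norm_zero_iff[OF f] L2_norm_zero_iff[OF g] by auto
  moreover have "(\<lambda>z. cmod (f z) * cmod (g z)) \<in> borel_measurable lebesgue"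
    using assms[THEN L2_measurable] by measurable
  ultimately have "(LINT z|lebesgue. cmod (f z) * cmod (g z)) = 0"
    by (intro integral_eq_zero_AE)
  then show ?thesis by simp
next
  case False
  define a b where "a = L2_norm f" and "b = L2_norm g"
  have ab: "a > 0" "b > 0" using False by (auto simp: a_def b_def less_le)
  have "(LINT z|lebesgue. cmod (f z) * cmod (g z))
      \<le> (LINT z|lebesgue. (b / (2 * a)) * (cmod (f z))\<^sup>2 + (a / (2 * b)) * (cmod (g z))\<^sup>2)"
  proof (rule integral_mono)
    show "integrable lebesgue (\<lambda>z. cmod (f z) * cmod (g z))" by (rule L2_abs_mult_integrable[OF assms])
    show "integrable lebesgue (\<lambda>z. (b / (2 * a)) * (cmod (f z))\<^sup>2 + (a / (2 * b)) * (cmod (g z))\<^sup>2)"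
      using L2_integrable_square[OF f] L2_integrable_square[OF g] by auto
    \<comment> \<open>The weights \<open>b / 2a\<close> and \<open>a / 2b\<close> in Young's inequality make the two integrated terms equal.\<close>
    fix z
    have "0 \<le> (b * cmod (f z) - a * cmod (g z))\<^sup>2 / (2 * a * b)" using ab by simp
    also have "\<dots> = (b / (2 * a)) * (cmod (f z))\<^sup>2 + (a / (2 * b)) * (cmod (g z))\<^sup>2 - cmod (f z) * cmod (g z)"
      using ab by (simp add: power2_eq_square field_simps)
    finally show "cmod (f z) * cmod (g z) \<le> (b / (2 * a)) * (cmod (f z))\<^sup>2 + (a / (2 * b)) * (cmod (g z))\<^sup>2" by simp
  qed
  also have "\<dots> = (b / (2 * a)) * a\<^sup>2 + (a / (2 * b)) * b\<^sup>2"
    using L2_integrable_square[OF f] L2_integrable_square[OF g]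
    by (simp add: a_def b_def L2_norm_square)
  also have "\<dots> = a * b" using ab by (simp add: power2_eq_square)
  finally show ?thesis by (simp add: a_def b_def)
qed

lemma L2_Cauchy_Schwarz:
  assumes f: "f \<in> L2" and g: "g \<in> L2"
  shows "cmod (L2_inner f g) \<le> L2_norm f * L2_norm g"
proof -
  have "cmod (L2_inner f g) \<le> (LINT z|lebesgue. cmod (f z) * cmod (g z))"
    unfolding L2_inner_def by (rule order_trans[OF integral_norm_bound]) (simp add: norm_mult)
  then show ?thesis using L2_Holder[OF assms] by linarith
qed

lemma L2_norm_triangle:
  assumes f: "f \<in> L2" and g: "g \<in> L2"
  shows "L2_norm (\<lambda>z. f z + g z) \<le> L2_norm f + L2_norm g"
proof (rule power2_le_imp_le)
  have "(L2_norm (\<lambda>z. f z + g z))\<^sup>2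
      \<le> (LINT z|lebesgue. (cmod (f z))\<^sup>2 + (cmod (g z))\<^sup>2 + 2 * (cmod (f z) * cmod (g z)))"
    unfolding L2_norm_square
  proof (rule integral_mono)
    show "integrable lebesgue (\<lambda>z. (cmod (f z + g z))\<^sup>2)"
      by (rule L2_integrable_square) (use assms in auto)
    show "integrable lebesgue (\<lambda>z. (cmod (f z))\<^sup>2 + (cmod (g z))\<^sup>2 + 2 * (cmod (f z) * cmod (g z)))"
      using assms[THEN L2_integrable_square] L2_abs_mult_integrable[OF assms] by auto
    fix z
    have "(cmod (f z + g z))\<^sup>2 \<le> (cmod (f z) + cmod (g z))\<^sup>2" by (intro power_mono norm_triangle_ineq) simp
    then show "(cmod (f z + g z))\<^sup>2 \<le> (cmod (f z))\<^sup>2 + (cmod (g z))\<^sup>2 + 2 * (cmod (f z) * cmod (g z))"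
      by (simp add: power2_sum)
  qed
  also have "\<dots> = (L2_norm f)\<^sup>2 + (L2_norm g)\<^sup>2 + 2 * (LINT z|lebesgue. cmod (f z) * cmod (g z))"
    using assms[THEN L2_integrable_square] L2_abs_mult_integrable[OF assms] by (simp add: L2_norm_square)
  also have "\<dots> \<le> (L2_norm f + L2_norm g)\<^sup>2"
    using L2_Holder[OF assms] by (simp add: power2_sum)
  finally show "(L2_norm (\<lambda>z. f z + g z))\<^sup>2 \<le> (L2_norm f + L2_norm g)\<^sup>2" .
qed simp

lemma L2_norm_scale: "L2_norm (\<lambda>z. a * f z) = cmod a * L2_norm f"
  by (simp add: L2_norm_def norm_mult power_mult_distrib real_sqrt_mult)

lemma L2_norm_minus_commute: "L2_norm (\<lambda>z. f z - g z) = L2_norm (\<lambda>z. g z - f z)"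
  by (simp add: L2_norm_def norm_minus_commute)

lemma L2_norm_diff_triangle:
  assumes "f \<in> L2" "g \<in> L2" "h \<in> L2"
  shows "L2_norm (\<lambda>z. f z - h z) \<le> L2_norm (\<lambda>z. f z - g z) + L2_norm (\<lambda>z. g z - h z)"
  using L2_norm_triangle[of "\<lambda>z. f z - g z" "\<lambda>z. g z - h z"] assms by auto

lemma L2_norm_abs_diff:
  assumes "f \<in> L2" "g \<in> L2"
  shows "\<bar>L2_norm f - L2_norm g\<bar> \<le> L2_norm (\<lambda>z. f z - g z)"
  using L2_norm_triangle[of "\<lambda>z. f z - g z" g, OF L2_diff[OF assms] assms(2)]
    L2_norm_triangle[of "\<lambda>z. g z - f z" f, OF L2_diff[OF assms(2,1)] assms(1)]
  by (simp add: L2_norm_minus_commute[of g f])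

lemma L2_inner_add_left:
  "f \<in> L2 \<Longrightarrow> g \<in> L2 \<Longrightarrow> h \<in> L2 \<Longrightarrow> L2_inner (\<lambda>z. f z + g z) h = L2_inner f h + L2_inner g h"
  unfolding L2_inner_def by (simp add: distrib_right L2_inner_integrable)

lemma L2_inner_diff_left:
  "f \<in> L2 \<Longrightarrow> g \<in> L2 \<Longrightarrow> h \<in> L2 \<Longrightarrow> L2_inner (\<lambda>z. f z - g z) h = L2_inner f h - L2_inner g h"
  unfolding L2_inner_def by (simp add: left_diff_distrib L2_inner_integrable)

lemma L2_inner_scale_left: "L2_inner (\<lambda>z. a * f z) h = a * L2_inner f h"
  unfolding L2_inner_def by (simp add: mult.assoc)

lemma L2_inner_sum_left:
  "(\<And>i. i \<in> I \<Longrightarrow> f i \<in> L2) \<Longrightarrow> h \<in> L2 \<Longrightarrow> L2_inner (\<lambda>z. \<Sum>i\<in>I. f i z) h = (\<Sum>i\<in>I. L2_inner (f i) h)"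
proof (induction I rule: infinite_finite_induct)
  case (insert x F)
  then show ?case by (simp add: L2_inner_add_left L2_sum)
qed (auto simp: L2_inner_def)

lemma L2_inner_commute: "L2_inner g f = cnj (L2_inner f g)"
  unfolding L2_inner_def
  by (subst Bochner_Integration.integral_cnj[symmetric]) (simp add: mult.commute)

lemma L2_inner_sum_right:
  "(\<And>i. i \<in> I \<Longrightarrow> f i \<in> L2) \<Longrightarrow> h \<in> L2 \<Longrightarrow> L2_inner h (\<lambda>z. \<Sum>i\<in>I. f i z) = (\<Sum>i\<in>I. L2_inner h (f i))"
  by (subst (1 2) L2_inner_commute) (simp add: L2_inner_sum_left)

lemma L2_inner_diff_right:
  "f \<in> L2 \<Longrightarrow> g \<in> L2 \<Longrightarrow> h \<in> L2 \<Longrightarrow> L2_inner h (\<lambda>z. f z - g z) = L2_inner h f - L2_inner h g"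
  by (subst (1 2 3) L2_inner_commute) (simp add: L2_inner_diff_left)

lemma L2_inner_scale_right: "L2_inner h (\<lambda>z. a * f z) = cnj a * L2_inner h f"
  by (subst (1 2) L2_inner_commute) (simp add: L2_inner_scale_left)

lemma L2_inner_self: "L2_inner f f = complex_of_real ((L2_norm f)\<^sup>2)"
  unfolding L2_inner_def L2_norm_square complex_norm_square[symmetric]
  by (rule integral_complex_of_real)

lemma L2_inner_cong:
  assumes "f \<in> L2" "f' \<in> L2" "g \<in> L2" "g' \<in> L2" "L2_eq f f'" "L2_eq g g'"
  shows "L2_inner f g = L2_inner f' g'"
  unfolding L2_inner_def
proof (rule integral_cong_AE)
  show "AE z in lebesgue. f z * cnj (g z) = f' z * cnj (g' z)"
    using assms(5,6) unfolding L2_eq_def by (rule eventually_elim2) simp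
qed (use assms in \<open>auto intro: borel_measurable_integrable L2_inner_integrable\<close>)

lemma L2_norm_cong:
  assumes "f \<in> L2" "f' \<in> L2" "L2_eq f f'"
  shows "L2_norm f = L2_norm f'"
proof -
  have "(LINT z|lebesgue. (cmod (f z))\<^sup>2) = (LINT z|lebesgue. (cmod (f' z))\<^sup>2)"
    by (rule integral_cong_AE) (use assms in \<open>auto simp: L2_eq_def dest: L2_measurable\<close>)
  then show ?thesis by (simp add: L2_norm_def)
qed

lemma L2_eq_iff_norm: "f \<in> L2 \<Longrightarrow> g \<in> L2 \<Longrightarrow> L2_eq f g \<longleftrightarrow> L2_norm (\<lambda>z. f z - g z) = 0"
  by (subst L2_norm_zero_iff) (auto simp: L2_eq_def)

lemma L2_eq_refl [simp, intro]: "L2_eq f f" by (simp add: L2_eq_def)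
lemma L2_eq_sym: "L2_eq f g \<Longrightarrow> L2_eq g f" by (auto simp: L2_eq_def)
lemma L2_eq_trans [trans]: "L2_eq f g \<Longrightarrow> L2_eq g h \<Longrightarrow> L2_eq f h"
  unfolding L2_eq_def by (elim AE_mp) auto
lemma L2_eq_sum: "(\<And>i. i \<in> I \<Longrightarrow> L2_eq (f i) (g i)) \<Longrightarrow> L2_eq (\<lambda>z. \<Sum>i\<in>I. f i z) (\<lambda>z. \<Sum>i\<in>I. g i z)"
proof (induction I rule: infinite_finite_induct)
  case (insert x F)
  then have "L2_eq (f x) (g x)" "L2_eq (\<lambda>z. \<Sum>i\<in>F. f i z) (\<lambda>z. \<Sum>i\<in>F. g i z)" by auto
  then have "AE z in lebesgue. f x z + (\<Sum>i\<in>F. f i z) = g x z + (\<Sum>i\<in>F. g i z)"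
    unfolding L2_eq_def by (rule eventually_elim2) simp
  then show ?case using insert unfolding L2_eq_def by simp
qed auto
lemma L2_eq_scale: "L2_eq f g \<Longrightarrow> L2_eq (\<lambda>z. a * f z) (\<lambda>z. a * g z)"
  by (auto simp: L2_eq_def)
lemma L2_eq_diff: "L2_eq f g \<Longrightarrow> L2_eq f' g' \<Longrightarrow> L2_eq (\<lambda>z. f z - f' z) (\<lambda>z. g z - g' z)"
  by (auto simp: L2_eq_def)

lemma L2_tendsto_inner:
  assumes "L2_tendsto F f" "g \<in> L2"
  shows "(\<lambda>n. L2_inner (F n) g) \<longlonglongrightarrow> L2_inner f g"
proof -
  have F: "F n \<in> L2" "f \<in> L2" for n using assms by (auto simp: L2_tendsto_def)
  have "(\<lambda>n. L2_inner (F n) g - L2_inner f g) \<longlonglongrightarrow> 0"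
  proof (rule Lim_null_comparison)
    show "\<forall>\<^sub>F n in sequentially. norm (L2_inner (F n) g - L2_inner f g) \<le> L2_norm (\<lambda>z. F n z - f z) * L2_norm g"
      using L2_Cauchy_Schwarz[of "\<lambda>z. F n z - f z" g for n] F assms(2)
      by (intro always_eventually) (auto simp: L2_inner_diff_left)
    have "(\<lambda>n. L2_norm (\<lambda>z. F n z - f z)) \<longlonglongrightarrow> 0" using assms by (simp add: L2_tendsto_def)
    then show "(\<lambda>n. L2_norm (\<lambda>z. F n z - f z) * L2_norm g) \<longlonglongrightarrow> 0"
      by (rule tendsto_mult_left_zero)
  qed
  then show ?thesis by (simp add: Lim_null[symmetric])
qed

lemma L2_tendsto_norm:
  assumes "L2_tendsto F f"
  shows "(\<lambda>n. L2_norm (F n)) \<longlonglongrightarrow> L2_norm f"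
proof -
  have F: "F n \<in> L2" "f \<in> L2" for n using assms by (auto simp: L2_tendsto_def)
  have "(\<lambda>n. L2_norm (F n) - L2_norm f) \<longlonglongrightarrow> 0"
  proof (rule Lim_null_comparison)
    show "\<forall>\<^sub>F n in sequentially. norm (L2_norm (F n) - L2_norm f) \<le> L2_norm (\<lambda>z. F n z - f z)"
      using F L2_norm_abs_diff by (intro always_eventually) auto
    show "(\<lambda>n. L2_norm (\<lambda>z. F n z - f z)) \<longlonglongrightarrow> 0" using assms by (simp add: L2_tendsto_def)
  qed
  then show ?thesis by (simp add: Lim_null[symmetric])
qed

lemma L2_tendsto_add_null:
  assumes F: "L2_tendsto F f" and G: "\<And>n. G n \<in> L2" and lim: "(\<lambda>n. L2_norm (\<lambda>z. G n z - F n z)) \<longlonglongrightarrow> 0"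
  shows "L2_tendsto G f"
proof -
  have F': "F n \<in> L2" "f \<in> L2" for n using assms by (auto simp: L2_tendsto_def)
  have "(\<lambda>n. L2_norm (\<lambda>z. G n z - f z)) \<longlonglongrightarrow> 0"
  proof (rule Lim_null_comparison)
    show "\<forall>\<^sub>F n in sequentially. norm (L2_norm (\<lambda>z. G n z - f z)) \<le> L2_norm (\<lambda>z. G n z - F n z) + L2_norm (\<lambda>z. F n z - f z)"
      using L2_norm_diff_triangle[OF G F'] by (intro always_eventually) auto
    show "(\<lambda>n. L2_norm (\<lambda>z. G n z - F n z) + L2_norm (\<lambda>z. F n z - f z)) \<longlonglongrightarrow> 0"
      using tendsto_add[OF lim] F by (force simp: L2_tendsto_def)
  qed
  then show ?thesis using F' G by (simp add: L2_tendsto_def)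
qed

lemma L2_tendsto_diff:
  assumes F: "L2_tendsto F f" and G: "L2_tendsto G g"
  shows "L2_tendsto (\<lambda>n z. F n z - G n z) (\<lambda>z. f z - g z)"
proof -
  have F': "F n \<in> L2" "f \<in> L2" "G n \<in> L2" "g \<in> L2" for n using assms by (auto simp: L2_tendsto_def)
  have "(\<lambda>n. L2_norm (\<lambda>z. (F n z - G n z) - (f z - g z))) \<longlonglongrightarrow> 0"
  proof (rule Lim_null_comparison)
    have "L2_norm (\<lambda>z. (F n z - G n z) - (f z - g z)) \<le> L2_norm (\<lambda>z. F n z - f z) + L2_norm (\<lambda>z. G n z - g z)" for n
      using L2_norm_triangle[of "\<lambda>z. F n z - f z" "\<lambda>z. g z - G n z"] F'
      by (auto simp: L2_norm_minus_commute[of "G n" g] algebra_simps)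
    then show "\<forall>\<^sub>F n in sequentially. norm (L2_norm (\<lambda>z. (F n z - G n z) - (f z - g z))) \<le> L2_norm (\<lambda>z. F n z - f z) + L2_norm (\<lambda>z. G n z - g z)"
      by (intro always_eventually) auto
    show "(\<lambda>n. L2_norm (\<lambda>z. F n z - f z) + L2_norm (\<lambda>z. G n z - g z)) \<longlonglongrightarrow> 0"
      using tendsto_add[of _ 0 _ _ 0] F G by (force simp: L2_tendsto_def)
  qed
  then show ?thesis using F' by (auto simp: L2_tendsto_def)
qed

text \<open>
  Riesz and Fischer: along a subsequence whose increments have norm at most \<open>(1/4)\<^sup>k\<close>, the
  weighted series \<open>\<Sum>k. 4\<^sup>k * \<bar>D k z\<bar>\<^sup>2\<close> has a finite integral. It is therefore finite
  almost everywhere, so that the increments are pointwise \<open>O ((1/2)\<^sup>k)\<close> and the subsequence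
  converges almost everywhere. Fatou's lemma turns the pointwise limit into a limit in norm of
  the full sequence.
\<close>

lemma L2_complete:
  assumes F: "\<And>n. F n \<in> L2"
    and Cauchy: "\<And>e. 0 < e \<Longrightarrow> \<exists>N. \<forall>m\<ge>N. \<forall>n\<ge>N. L2_norm (\<lambda>z. F m z - F n z) \<le> e"
  shows "\<exists>f. L2_tendsto F f"
proof -
  define d where "d k = (1/4::real) ^ k" for k :: nat
  have dpos: "d k > 0" for k by (simp add: d_def)
  have "\<exists>r. strict_mono r \<and> (\<forall>k. \<forall>m\<ge>r k. \<forall>n\<ge>r k. L2_norm (\<lambda>z. F m z - F n z) \<le> d k)"
  proof -
    obtain N where N: "\<And>k m n. m \<ge> N k \<Longrightarrow> n \<ge> N k \<Longrightarrow> L2_norm (\<lambda>z. F m z - F n z) \<le> d k"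
      using Cauchy[OF dpos] by metis
    \<comment> \<open>Summing the thresholds gives a strictly increasing sequence that stays above each of them.\<close>
    define r where "r k = (\<Sum>j\<le>k. Suc (N j))" for k
    have "strict_mono r" by (rule strict_mono_Suc_iff[THEN iffD2]) (simp add: r_def)
    moreover have "N k \<le> r k" for k
    proof -
      have "Suc (N k) \<le> r k" unfolding r_def by (rule member_le_sum) auto
      then show ?thesis by simp
    qed
    ultimately show ?thesis using N by (meson order_trans)
  qed
  then obtain r where r: "strict_mono r"
    and rC: "\<And>k m n. m \<ge> r k \<Longrightarrow> n \<ge> r k \<Longrightarrow> L2_norm (\<lambda>z. F m z - F n z) \<le> d k" by blast
  define D where "D k z = F (r (Suc k)) z - F (r k) z" for k z
  have D: "D k \<in> L2" for k unfolding D_def using F by auto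
  have Dn: "L2_norm (D k) \<le> d k" for k
    unfolding D_def by (rule rC) (auto simp: strict_mono_less_eq[OF r])
  have Fm [measurable]: "F n \<in> borel_measurable lebesgue" for n using F by (rule L2_measurable)
  have Dm [measurable]: "D n \<in> borel_measurable lebesgue" for n using D by (rule L2_measurable)
  have "(\<integral>\<^sup>+z. (\<Sum>k. ennreal (4 ^ k) * ennreal ((cmod (D k z))\<^sup>2)) \<partial>lebesgue)
      = (\<Sum>k. \<integral>\<^sup>+z. ennreal (4 ^ k) * ennreal ((cmod (D k z))\<^sup>2) \<partial>lebesgue)"
    by (rule nn_integral_suminf) measurable
  also have "\<dots> = (\<Sum>k. ennreal (4 ^ k * (L2_norm (D k))\<^sup>2))"
    by (simp add: nn_integral_cmult L2_nn_integral[OF D] ennreal_mult)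
  also have "\<dots> \<le> (\<Sum>k. ennreal ((1/4) ^ k))"
  proof (rule suminf_le)
    fix k
    have "4 ^ k * (L2_norm (D k))\<^sup>2 \<le> 4 ^ k * (d k)\<^sup>2"
      using Dn by (intro mult_left_mono power_mono) auto
    also have "\<dots> = (1/4) ^ k"
      by (simp add: d_def power2_eq_square power_divide)
    finally show "ennreal (4 ^ k * (L2_norm (D k))\<^sup>2) \<le> ennreal ((1/4) ^ k)" by (rule ennreal_leI)
  qed auto
  also have "\<dots> = ennreal (\<Sum>k. (1/4) ^ k)" by (rule suminf_ennreal2) (auto simp: summable_geometric)
  also have "\<dots> < \<infinity>" by simp
  finally have "AE z in lebesgue. (\<Sum>k. ennreal (4 ^ k) * ennreal ((cmod (D k z))\<^sup>2)) \<noteq> \<infinity>"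
    by (intro nn_integral_noteq_infinite) auto
  \<comment> \<open>Boundedness of the terms of the weighted series already gives geometric decay of the
      increments.\<close>
  then have conv: "AE z in lebesgue. convergent (\<lambda>k. F (r k) z)"
  proof eventually_elim
    case (elim z)
    then have "(\<Sum>k. ennreal (4 ^ k * (cmod (D k z))\<^sup>2)) \<noteq> top" by (simp add: ennreal_mult)
    then have "summable (\<lambda>k. 4 ^ k * (cmod (D k z))\<^sup>2)"
      by (rule summable_suminf_not_top[rotated]) simp
    then have "Bseq (\<lambda>k. 4 ^ k * (cmod (D k z))\<^sup>2)"
      by (metis convergent_def convergent_imp_Bseq summable_LIMSEQ_zero)
    then obtain M where M: "M > 0" "\<And>k. norm (4 ^ k * (cmod (D k z))\<^sup>2) \<le> M" by (auto elim: BseqE)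
    have "cmod (D k z) \<le> sqrt M * (1/2) ^ k" for k
    proof (rule power2_le_imp_le)
      have "4 ^ k * (cmod (D k z))\<^sup>2 \<le> M" using M(2)[of k] by simp
      then have "4 ^ k * (cmod (D k z))\<^sup>2 * (1/4) ^ k \<le> M * (1/4) ^ k"
        by (rule mult_right_mono) simp
      moreover have "4 ^ k * (1/4::real) ^ k = 1"
        unfolding power_mult_distrib[symmetric] by simp
      ultimately have "(cmod (D k z))\<^sup>2 \<le> M * (1/4) ^ k"
        by (metis mult.assoc mult.commute mult.left_neutral)
      also have "\<dots> = (sqrt M * (1/2) ^ k)\<^sup>2"
      proof -
        have *: "((1/2::real) ^ k)\<^sup>2 = (1/4) ^ k"
          unfolding power2_eq_square power_mult_distrib[symmetric] by simp
        show ?thesis unfolding power_mult_distrib * using M(1) by simp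
      qed
      finally show "(cmod (D k z))\<^sup>2 \<le> (sqrt M * (1/2) ^ k)\<^sup>2" .
    qed (use M in auto)
    moreover have "summable (\<lambda>k. sqrt M * (1/2) ^ k)"
      by (rule summable_mult) (rule summable_geometric, simp)
    ultimately have "summable (\<lambda>k. D k z)"
      using summable_comparison_test'[of "\<lambda>k. sqrt M * (1/2) ^ k" 0 "\<lambda>k. D k z"] by blast
    then have "convergent (\<lambda>n. \<Sum>k<n. D k z)" by (simp add: summable_iff_convergent)
    moreover have "(\<Sum>k<n. D k z) = F (r n) z - F (r 0) z" for n
      unfolding D_def by (rule sum_lessThan_telescope)
    ultimately have "convergent (\<lambda>n. F (r n) z - F (r 0) z)" by simp
    from convergent_add[OF this convergent_const[of "F (r 0) z"]] show ?case by simp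
  qed
  define f where "f z = lim (\<lambda>k. F (r k) z)" for z
  have fm [measurable]: "f \<in> borel_measurable lebesgue"
    unfolding f_def[abs_def] by (rule borel_measurable_lim_metric) measurable
  have lim: "AE z in lebesgue. (\<lambda>k. F (r k) z) \<longlonglongrightarrow> f z"
    using conv by eventually_elim (simp add: f_def convergent_LIMSEQ_iff)
  \<comment> \<open>Fatou's lemma along the subsequence. It is applied with \<open>e = 1\<close> to see that \<open>f\<close> is in \<open>L2\<close>,
      and with small \<open>e\<close> for the convergence.\<close>
  have bound: "(\<integral>\<^sup>+z. ennreal ((cmod (F n z - f z))\<^sup>2) \<partial>lebesgue) \<le> ennreal (e\<^sup>2)"
    if "e > 0" and N: "\<And>m n. m \<ge> N \<Longrightarrow> n \<ge> N \<Longrightarrow> L2_norm (\<lambda>z. F m z - F n z) \<le> e" "n \<ge> N" for e N n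
  proof -
    have "(\<integral>\<^sup>+z. ennreal ((cmod (F n z - f z))\<^sup>2) \<partial>lebesgue)
        = (\<integral>\<^sup>+z. liminf (\<lambda>k. ennreal ((cmod (F n z - F (r k) z))\<^sup>2)) \<partial>lebesgue)"
    proof (rule nn_integral_cong_AE, use lim in eventually_elim)
      case (elim z)
      then have "(\<lambda>k. ennreal ((cmod (F n z - F (r k) z))\<^sup>2)) \<longlonglongrightarrow> ennreal ((cmod (F n z - f z))\<^sup>2)"
        by (intro tendsto_intros)
      from lim_imp_Liminf[OF sequentially_bot this] show ?case by simp
    qed
    also have "\<dots> \<le> liminf (\<lambda>k. \<integral>\<^sup>+z. ennreal ((cmod (F n z - F (r k) z))\<^sup>2) \<partial>lebesgue)"
      by (rule nn_integral_liminf) measurable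
    also have "\<dots> = liminf (\<lambda>k. ennreal ((L2_norm (\<lambda>z. F n z - F (r k) z))\<^sup>2))"
      by (subst L2_nn_integral) (use F in auto)
    also have "\<dots> \<le> liminf (\<lambda>k. ennreal (e\<^sup>2))"
    proof (rule Liminf_mono, rule eventually_sequentiallyI[of N])
      fix k assume "N \<le> k"
      then have "N \<le> r k" using seq_suble[OF r, of k] by linarith
      then show "ennreal ((L2_norm (\<lambda>z. F n z - F (r k) z))\<^sup>2) \<le> ennreal (e\<^sup>2)"
        using N by (intro ennreal_leI power_mono) auto
    qed
    also have "\<dots> = ennreal (e\<^sup>2)" by (simp add: Liminf_const)
    finally show ?thesis .
  qed
  obtain N1 where "\<forall>m\<ge>N1. \<forall>n\<ge>N1. L2_norm (\<lambda>z. F m z - F n z) \<le> 1" using Cauchy[of 1] by auto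
  then have "(\<integral>\<^sup>+z. ennreal ((cmod (F N1 z - f z))\<^sup>2) \<partial>lebesgue) \<le> ennreal (1\<^sup>2)"
    by (intro bound[of 1 N1]) auto
  then have "(\<lambda>z. F N1 z - f z) \<in> L2" by (rule L2_nn_integral_leI(1)[OF _ _ zero_le_power2, rotated]) auto
  from L2_diff[OF F[of N1] this] have f: "f \<in> L2" by simp
  have "(\<lambda>n. L2_norm (\<lambda>z. F n z - f z)) \<longlonglongrightarrow> 0"
  proof (rule LIMSEQ_I)
    fix e :: real assume e: "e > 0"
    obtain N where N: "\<forall>m\<ge>N. \<forall>n\<ge>N. L2_norm (\<lambda>z. F m z - F n z) \<le> e/2" using Cauchy[of "e/2"] e by auto
    have "L2_norm (\<lambda>z. F n z - f z) \<le> e/2" if "n \<ge> N" for n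
    proof (rule power2_le_imp_le)
      show "(L2_norm (\<lambda>z. F n z - f z))\<^sup>2 \<le> (e/2)\<^sup>2"
        by (rule L2_nn_integral_leI[OF _ bound[of "e/2" N]]) (use e N that in auto)
    qed (use e in auto)
    then show "\<exists>no. \<forall>n\<ge>no. norm (L2_norm (\<lambda>z. F n z - f z) - 0) < e"
      using e by (intro exI[of _ N]) force
  qed
  with f F show ?thesis unfolding L2_tendsto_def by auto
qed

section \<open>Functional calculus of a projection-valued measure\<close>

lemma L2_tendsto_const_unique:
  assumes "L2_tendsto F f" "\<And>n. n \<ge> N \<Longrightarrow> L2_eq (F n) g" "g \<in> L2"
  shows "L2_eq g f"
proof -
  have F: "F n \<in> L2" "f \<in> L2" for n using assms by (auto simp: L2_tendsto_def)
  have "L2_norm (\<lambda>z. F n z - f z) = L2_norm (\<lambda>z. g z - f z)" if "n \<ge> N" for n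
    by (rule L2_norm_cong) (use F assms(2)[OF that] assms(3) in \<open>auto intro: L2_eq_diff\<close>)
  then have "(\<lambda>n. L2_norm (\<lambda>z. F n z - f z)) \<longlonglongrightarrow> L2_norm (\<lambda>z. g z - f z)"
    by (intro tendsto_eventually eventually_sequentiallyI[of N]) auto
  moreover have "(\<lambda>n. L2_norm (\<lambda>z. F n z - f z)) \<longlonglongrightarrow> 0" using assms(1) by (simp add: L2_tendsto_def)
  ultimately have "L2_norm (\<lambda>z. g z - f z) = 0" by (rule LIMSEQ_unique)
  then show ?thesis using L2_eq_iff_norm[OF assms(3) F(2)] by simp
qed

locale pvm =
  fixes P :: "real set \<Rightarrow> ('a::euclidean_space \<Rightarrow> complex) \<Rightarrow> 'a \<Rightarrow> complex"
  assumes pvm: "projection_valued_measure P"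
begin

lemma P_L2 [simp, intro]: "B \<in> sets borel \<Longrightarrow> f \<in> L2 \<Longrightarrow> P B f \<in> L2"
  using pvm by (auto simp: projection_valued_measure_def orthogonal_projection_def)

lemma P_linear:
  "B \<in> sets borel \<Longrightarrow> f \<in> L2 \<Longrightarrow> g \<in> L2 \<Longrightarrow> L2_eq (P B (\<lambda>z. a * f z + b * g z)) (\<lambda>z. a * P B f z + b * P B g z)"
  using pvm by (auto simp: projection_valued_measure_def orthogonal_projection_def)

lemma P_diff:
  "B \<in> sets borel \<Longrightarrow> f \<in> L2 \<Longrightarrow> g \<in> L2 \<Longrightarrow> L2_eq (P B (\<lambda>z. f z - g z)) (\<lambda>z. P B f z - P B g z)"
  using P_linear[of B f g 1 "-1"] by simp

lemma P_self_adjoint: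
  "B \<in> sets borel \<Longrightarrow> f \<in> L2 \<Longrightarrow> g \<in> L2 \<Longrightarrow> L2_inner (P B f) g = L2_inner f (P B g)"
  using pvm by (auto simp: projection_valued_measure_def orthogonal_projection_def)

lemma P_Int: "A \<in> sets borel \<Longrightarrow> B \<in> sets borel \<Longrightarrow> f \<in> L2 \<Longrightarrow> L2_eq (P (A \<inter> B) f) (P A (P B f))"
  using pvm unfolding projection_valued_measure_def by blast

lemma P_empty: "f \<in> L2 \<Longrightarrow> L2_eq (P {} f) (\<lambda>z. 0)"
  using pvm unfolding projection_valued_measure_def by blast

lemma P_UNIV: "f \<in> L2 \<Longrightarrow> L2_eq (P UNIV f) f"
  using pvm unfolding projection_valued_measure_def by blast

lemma P_UN:
  "range B \<subseteq> sets borel \<Longrightarrow> disjoint_family B \<Longrightarrow> f \<in> L2 \<Longrightarrow>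
    L2_tendsto (\<lambda>n z. \<Sum>k<n. P (B k) f z) (P (\<Union>k. B k) f)"
  using pvm unfolding projection_valued_measure_def by blast

lemma P_inner:
  assumes "A \<in> sets borel" "B \<in> sets borel" "f \<in> L2" "g \<in> L2"
  shows "L2_inner (P A f) (P B g) = L2_inner (P (A \<inter> B) f) g"
proof -
  have "L2_inner (P A f) (P B g) = L2_inner f (P A (P B g))" using assms by (simp add: P_self_adjoint)
  also have "\<dots> = L2_inner f (P (A \<inter> B) g)"
    by (rule L2_inner_cong) (use assms P_Int in \<open>auto intro: L2_eq_sym\<close>)
  also have "\<dots> = L2_inner (P (A \<inter> B) f) g" using assms by (simp add: P_self_adjoint)
  finally show ?thesis .
qed

lemma P_inner_self:
  assumes "B \<in> sets borel" "f \<in> L2"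
  shows "L2_inner (P B f) f = complex_of_real ((L2_norm (P B f))\<^sup>2)"
  using P_inner[OF assms(1,1,2,2)] by (simp add: L2_inner_self)

lemma P_orthogonal:
  assumes "A \<in> sets borel" "B \<in> sets borel" "f \<in> L2" "g \<in> L2" "A \<inter> B = {}"
  shows "L2_inner (P A f) (P B g) = 0"
proof -
  have "L2_inner (P A f) (P B g) = L2_inner (P {} f) g" using P_inner assms by simp
  also have "\<dots> = L2_inner (\<lambda>z. 0) g" by (rule L2_inner_cong) (use assms P_empty in auto)
  finally show ?thesis by (simp add: L2_inner_def)
qed

lemma P_norm_disjoint:
  assumes "A \<in> sets borel" "B \<in> sets borel" "f \<in> L2" "A \<inter> B = {}"
  shows "L2_norm (P A (P B f)) = 0"
  using P_inner_self[of A "P B f"] P_orthogonal[of A B "P B f" f] assms by auto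

text \<open>
  The axioms speak of countable unions only; \<open>binaryset\<close> pads the two sets with empty ones,
  whose projections vanish, so the partial sums are constant from the second on.
\<close>

lemma P_Un:
  assumes "A \<in> sets borel" "B \<in> sets borel" "f \<in> L2" "A \<inter> B = {}"
  shows "L2_eq (\<lambda>z. P A f z + P B f z) (P (A \<union> B) f)"
proof -
  have "L2_tendsto (\<lambda>n z. \<Sum>k<n. P (binaryset A B k) f z) (P (\<Union>k. binaryset A B k) f)"
    by (rule P_UN) (use assms in \<open>auto simp: binaryset_def disjoint_family_on_def\<close>)
  then have *: "L2_tendsto (\<lambda>n z. \<Sum>k<n. P (binaryset A B k) f z) (P (A \<union> B) f)"
    by (simp add: UN_binaryset_eq)
  show ?thesis
  proof (rule L2_tendsto_const_unique[OF *, of 2])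
    fix n :: nat assume "n \<ge> 2"
    then have eq: "{..<n} = insert 0 (insert 1 {2..<n})" by auto
    have "L2_eq (\<lambda>z. \<Sum>k\<in>{2..<n}. P (binaryset A B k) f z) (\<lambda>z. \<Sum>k\<in>{2..<n}. 0)"
      by (rule L2_eq_sum) (use P_empty assms in \<open>auto simp: binaryset_def\<close>)
    then show "L2_eq (\<lambda>z. \<Sum>k<n. P (binaryset A B k) f z) (\<lambda>z. P A f z + P B f z)"
      unfolding eq by (auto simp: L2_eq_def binaryset_def)
  qed (use assms in auto)
qed

lemma P_finite_UN:
  assumes "finite I" "\<And>i. i \<in> I \<Longrightarrow> B i \<in> sets borel" "disjoint_family_on B I" "f \<in> L2"
  shows "L2_eq (P (\<Union>i\<in>I. B i) f) (\<lambda>z. \<Sum>i\<in>I. P (B i) f z)"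
  using assms(1-3)
proof (induction I rule: finite_induct)
  case empty
  then show ?case using P_empty[OF assms(4)] by simp
next
  case (insert x F)
  have "L2_eq (P (\<Union>i\<in>F. B i) f) (\<lambda>z. \<Sum>i\<in>F. P (B i) f z)"
    using insert by (intro insert.IH) (auto simp: disjoint_family_on_def)
  moreover have "L2_eq (\<lambda>z. P (B x) f z + P (\<Union>i\<in>F. B i) f z) (P (B x \<union> (\<Union>i\<in>F. B i)) f)"
    using insert assms(4) by (intro P_Un sets.finite_UN) (auto simp: disjoint_family_on_def)
  ultimately have "AE z in lebesgue. P (B x \<union> (\<Union>i\<in>F. B i)) f z = P (B x) f z + (\<Sum>i\<in>F. P (B i) f z)"
    unfolding L2_eq_def by (rule eventually_elim2) simp
  then show ?case using insert by (simp add: L2_eq_def)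
qed

abbreviation mu :: "('a \<Rightarrow> complex) \<Rightarrow> real measure" where "mu \<equiv> scalar_spectral_measure P"

lemma sets_mu [simp, measurable_cong]: "sets (mu f) = sets borel"
  unfolding scalar_spectral_measure_def
  using sets.sigma_sets_eq[of "borel :: real measure"] by (simp add: sets_measure_of_conv)

lemma space_mu [simp]: "space (mu f) = UNIV"
  by (simp add: scalar_spectral_measure_def space_measure_of_conv)

text \<open>
  \<open>measure_of\<close> returns the zero measure unless the set function is countably additive. Strong
  additivity of \<open>P\<close> supplies this, and afterwards every spectral integral can be computed with
  ordinary measure theory.
\<close>

lemma emeasure_mu:
  assumes f: "f \<in> L2" and B: "B \<in> sets borel"
  shows "emeasure (mu f) B = ennreal ((L2_norm (P B f))\<^sup>2)"
proof -
  have "emeasure (mu f) B = ennreal (Re (L2_inner (P B f) f))"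
  proof (rule emeasure_measure_of[OF scalar_spectral_measure_def])
    show "positive (sets (mu f)) (\<lambda>B. ennreal (Re (L2_inner (P B f) f)))"
      using P_inner_self[of "{}" f] f L2_norm_cong[of "P {} f" "\<lambda>z. 0"] P_empty[OF f]
      by (auto simp: positive_def L2_norm_def)
    show "countably_additive (sets (mu f)) (\<lambda>B. ennreal (Re (L2_inner (P B f) f)))"
      unfolding countably_additive_def
    proof (intro allI impI)
      fix A :: "nat \<Rightarrow> real set" assume A: "range A \<subseteq> sets (mu f)" "disjoint_family A" "(\<Union>i. A i) \<in> sets (mu f)"
      then have A': "A i \<in> sets borel" for i by auto
      have "(\<lambda>n. L2_inner (\<lambda>z. \<Sum>k<n. P (A k) f z) f) \<longlonglongrightarrow> L2_inner (P (\<Union>k. A k) f) f"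
        using A by (intro L2_tendsto_inner P_UN f) auto
      then have "(\<lambda>n. Re (L2_inner (\<lambda>z. \<Sum>k<n. P (A k) f z) f)) \<longlonglongrightarrow> Re (L2_inner (P (\<Union>k. A k) f) f)"
        by (rule tendsto_Re)
      moreover have "Re (L2_inner (\<lambda>z. \<Sum>k<n. P (A k) f z) f) = (\<Sum>k<n. Re (L2_inner (P (A k) f) f))" for n
        using A' f by (subst L2_inner_sum_left) auto
      ultimately have "(\<lambda>k. Re (L2_inner (P (A k) f) f)) sums Re (L2_inner (P (\<Union>k. A k) f) f)"
        by (simp add: sums_def)
      then show "(\<Sum>i. ennreal (Re (L2_inner (P (A i) f) f))) = ennreal (Re (L2_inner (P (\<Union> (range A)) f) f))"
        by (intro suminf_ennreal_eq) (auto simp: P_inner_self A' f)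
    qed
  qed (use B in \<open>auto simp: sets.sets_into_space\<close>)
  then show ?thesis using P_inner_self[OF B f] by simp
qed

lemma emeasure_mu_UNIV: "f \<in> L2 \<Longrightarrow> emeasure (mu f) UNIV = ennreal ((L2_norm f)\<^sup>2)"
  using emeasure_mu[of f UNIV] L2_norm_cong[OF _ _ P_UNIV, of f] by simp

text \<open>
  Pythagoras: projections onto disjoint sets have orthogonal ranges.
\<close>

lemma orthogonal_sum_norm:
  assumes I: "finite I" "\<And>i. i \<in> I \<Longrightarrow> B i \<in> sets borel" "disjoint_family_on B I" and f: "f \<in> L2"
  shows "(L2_norm (\<lambda>z. \<Sum>i\<in>I. c i * P (B i) f z))\<^sup>2 = (\<Sum>i\<in>I. (cmod (c i))\<^sup>2 * (L2_norm (P (B i) f))\<^sup>2)"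
proof -
  have L: "(\<lambda>z. c i * P (B i) f z) \<in> L2" if "i \<in> I" for i using that I f by auto
  have "complex_of_real ((L2_norm (\<lambda>z. \<Sum>i\<in>I. c i * P (B i) f z))\<^sup>2)
      = L2_inner (\<lambda>z. \<Sum>i\<in>I. c i * P (B i) f z) (\<lambda>z. \<Sum>i\<in>I. c i * P (B i) f z)"
    by (rule L2_inner_self[symmetric])
  also have "\<dots> = (\<Sum>i\<in>I. \<Sum>j\<in>I. L2_inner (\<lambda>z. c i * P (B i) f z) (\<lambda>z. c j * P (B j) f z))"
    using L by (subst L2_inner_sum_left) (auto simp: L2_inner_sum_right)
  also have "\<dots> = (\<Sum>i\<in>I. \<Sum>j\<in>I. if j = i then complex_of_real ((cmod (c i))\<^sup>2 * (L2_norm (P (B i) f))\<^sup>2) else 0)"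
  proof (intro sum.cong refl)
    fix i j assume ij: "i \<in> I" "j \<in> I"
    show "L2_inner (\<lambda>z. c i * P (B i) f z) (\<lambda>z. c j * P (B j) f z)
        = (if j = i then complex_of_real ((cmod (c i))\<^sup>2 * (L2_norm (P (B i) f))\<^sup>2) else 0)"
    proof (cases "j = i")
      case True
      then show ?thesis using complex_norm_square[of "c i"]
        by (simp add: L2_inner_scale_left L2_inner_scale_right L2_inner_self mult.assoc[symmetric])
    next
      case False
      then have "B i \<inter> B j = {}" using I(3) ij by (auto simp: disjoint_family_on_def)
      then show ?thesis using False ij I f
        by (simp add: L2_inner_scale_left L2_inner_scale_right P_orthogonal)
    qed
  qed
  also have "\<dots> = (\<Sum>i\<in>I. complex_of_real ((cmod (c i))\<^sup>2 * (L2_norm (P (B i) f))\<^sup>2))"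
    using I(1) by simp
  finally have "complex_of_real ((L2_norm (\<lambda>z. \<Sum>i\<in>I. c i * P (B i) f z))\<^sup>2)
      = complex_of_real (\<Sum>i\<in>I. (cmod (c i))\<^sup>2 * (L2_norm (P (B i) f))\<^sup>2)" by simp
  then show ?thesis by (simp only: of_real_eq_iff)
qed

abbreviation SI :: "(real \<Rightarrow> complex) \<Rightarrow> ('a \<Rightarrow> complex) \<Rightarrow> 'a \<Rightarrow> complex" where
  "SI \<equiv> simple_spectral_integral P"

text \<open>
  A simple integral is a sum over the level sets of its integrand. It may be evaluated on any
  finer partition, since the projection of a level set is the sum of the projections of its
  pieces. This is what makes integrals of different simple functions comparable, and it allows
  the pieces to be indexed by something other than values.
\<close>

lemma SI_partition:
  fixes q :: "real \<Rightarrow> 'i"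
  assumes fin: "finite (range q)" and q: "\<And>i. q -` {i} \<in> sets borel" and f: "f \<in> L2"
  shows "L2_eq (SI (\<lambda>x. \<phi> (q x)) f) (\<lambda>z. \<Sum>i\<in>range q. \<phi> i * P (q -` {i}) f z)"
proof -
  have "L2_eq (SI (\<lambda>x. \<phi> (q x)) f) (\<lambda>z. \<Sum>c\<in>\<phi> ` range q. c * (\<Sum>i\<in>{i\<in>range q. \<phi> i = c}. P (q -` {i}) f z))"
    unfolding simple_spectral_integral_def image_image[symmetric, of \<phi> q]
  proof (intro L2_eq_sum L2_eq_scale)
    fix c
    have "(\<lambda>x. \<phi> (q x)) -` {c} = (\<Union>i\<in>{i\<in>range q. \<phi> i = c}. q -` {i})" by auto
    then show "L2_eq (P ((\<lambda>x. \<phi> (q x)) -` {c}) f) (\<lambda>z. \<Sum>i\<in>{i\<in>range q. \<phi> i = c}. P (q -` {i}) f z)"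
      using P_finite_UN[of "{i\<in>range q. \<phi> i = c}" "\<lambda>i. q -` {i}" f] fin q f
      by (auto simp: disjoint_family_on_def)
  qed
  also have "(\<lambda>z. \<Sum>c\<in>\<phi> ` range q. c * (\<Sum>i\<in>{i\<in>range q. \<phi> i = c}. P (q -` {i}) f z))
      = (\<lambda>z. \<Sum>i\<in>range q. \<phi> i * P (q -` {i}) f z)"
  proof
    fix z
    have "(\<Sum>i\<in>range q. \<phi> i * P (q -` {i}) f z) = (\<Sum>c\<in>\<phi> ` range q. \<Sum>i\<in>{i\<in>range q. \<phi> i = c}. \<phi> i * P (q -` {i}) f z)"
      by (rule sum.image_gen[OF fin])
    then show "(\<Sum>c\<in>\<phi> ` range q. c * (\<Sum>i\<in>{i\<in>range q. \<phi> i = c}. P (q -` {i}) f z)) = (\<Sum>i\<in>range q. \<phi> i * P (q -` {i}) f z)"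
      by (simp add: sum_distrib_left)
  qed
  finally show ?thesis .
qed

lemma partition_norm:
  fixes q :: "real \<Rightarrow> 'i"
  assumes fin: "finite (range q)" and q: "\<And>i. q -` {i} \<in> sets borel" and f: "f \<in> L2"
  shows "ennreal ((L2_norm (\<lambda>z. \<Sum>i\<in>range q. \<phi> i * P (q -` {i}) f z))\<^sup>2)
     = (\<integral>\<^sup>+x. ennreal ((cmod (\<phi> (q x)))\<^sup>2) \<partial>mu f)"
proof -
  have "(\<integral>\<^sup>+x. ennreal ((cmod (\<phi> (q x)))\<^sup>2) \<partial>mu f)
      = (\<integral>\<^sup>+x. (\<Sum>i\<in>range q. ennreal ((cmod (\<phi> i))\<^sup>2) * indicator (q -` {i}) x) \<partial>mu f)"
  proof (intro nn_integral_cong)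
    fix x
    have "(\<Sum>i\<in>range q. ennreal ((cmod (\<phi> i))\<^sup>2) * indicator (q -` {i}) x)
        = (\<Sum>i\<in>range q. if i = q x then ennreal ((cmod (\<phi> i))\<^sup>2) else 0)"
      by (intro sum.cong) (auto simp: indicator_def)
    then show "ennreal ((cmod (\<phi> (q x)))\<^sup>2) = (\<Sum>i\<in>range q. ennreal ((cmod (\<phi> i))\<^sup>2) * indicator (q -` {i}) x)"
      using fin by simp
  qed
  also have "\<dots> = (\<Sum>i\<in>range q. ennreal ((cmod (\<phi> i))\<^sup>2 * (L2_norm (P (q -` {i}) f))\<^sup>2))"
    using q f by (subst nn_integral_sum) (auto simp: nn_integral_cmult_indicator emeasure_mu ennreal_mult)
  also have "\<dots> = ennreal (\<Sum>i\<in>range q. (cmod (\<phi> i))\<^sup>2 * (L2_norm (P (q -` {i}) f))\<^sup>2)"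
    by (intro sum_ennreal) auto
  also have "\<dots> = ennreal ((L2_norm (\<lambda>z. \<Sum>i\<in>range q. \<phi> i * P (q -` {i}) f z))\<^sup>2)"
    using fin q f by (subst orthogonal_sum_norm) (auto simp: disjoint_family_on_def)
  finally show ?thesis by simp
qed

lemma SI_L2 [simp, intro]:
  assumes "simple_function borel s" "f \<in> L2"
  shows "SI s f \<in> L2"
  using assms unfolding simple_spectral_integral_def
  by (intro L2_sum L2_scale P_L2) (auto simp: simple_function_def)

lemma simple_vimage: "simple_function borel s \<Longrightarrow> s -` {c} \<in> sets borel" for s :: "real \<Rightarrow> complex"
  using borel_measurable_simple_function[of borel s] by (metis Int_UNIV_right borel_singleton measurable_sets sets.empty_sets space_borel)

text \<open>
  The isometry behind the functional calculus. Linearity in the integrand is not visible from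
  the level-set definition; it appears on the common refinement given by the pairs of values
  \<open>(s x, s' x)\<close>.
\<close>

lemma SI_dist:
  assumes s: "simple_function borel s" and s': "simple_function borel s'" and f: "f \<in> L2"
  shows "ennreal ((L2_norm (\<lambda>z. SI s f z - SI s' f z))\<^sup>2) = (\<integral>\<^sup>+x. ennreal ((cmod (s x - s' x))\<^sup>2) \<partial>mu f)"
proof -
  define q where "q x = (s x, s' x)" for x
  have "range q \<subseteq> range s \<times> range s'" by (auto simp: q_def)
  then have fin: "finite (range q)"
    by (rule finite_subset) (use s s' in \<open>auto simp: simple_function_def\<close>)
  have q: "q -` {i} \<in> sets borel" for i
  proof -
    have "q -` {i} = s -` {fst i} \<inter> s' -` {snd i}" by (cases i) (auto simp: q_def)
    then show ?thesis using simple_vimage s s' by auto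
  qed
  let ?S = "\<lambda>\<phi> z. \<Sum>i\<in>range q. \<phi> i * P (q -` {i}) f z"
  have "L2_eq (SI s f) (?S fst)" "L2_eq (SI s' f) (?S snd)"
    using SI_partition[OF fin q f, of fst] SI_partition[OF fin q f, of snd] by (auto simp: q_def)
  then have "L2_eq (\<lambda>z. SI s f z - SI s' f z) (\<lambda>z. ?S fst z - ?S snd z)" by (rule L2_eq_diff)
  also have "(\<lambda>z. ?S fst z - ?S snd z) = ?S (\<lambda>i. fst i - snd i)"
    by (simp add: sum_subtractf left_diff_distrib)
  finally have "L2_norm (\<lambda>z. SI s f z - SI s' f z) = L2_norm (?S (\<lambda>i. fst i - snd i))"
  proof (rule L2_norm_cong[rotated 2])
    show "?S (\<lambda>i. fst i - snd i) \<in> L2" by (rule L2_sum, rule L2_scale, rule P_L2, rule q, rule f)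
  qed (use f s s' in auto)
  then show ?thesis using partition_norm[OF fin q f, of "\<lambda>i. fst i - snd i"] by (simp add: q_def)
qed

lemma SI_const: "f \<in> L2 \<Longrightarrow> L2_eq (SI (\<lambda>x. a) f) (\<lambda>z. a * f z)"
  unfolding simple_spectral_integral_def using L2_eq_scale[OF P_UNIV] by auto

lemma SI_norm:
  assumes s: "simple_function borel s" and f: "f \<in> L2"
  shows "ennreal ((L2_norm (SI s f))\<^sup>2) = (\<integral>\<^sup>+x. ennreal ((cmod (s x))\<^sup>2) \<partial>mu f)"
proof -
  have "L2_eq (SI (\<lambda>x. 0) f) (\<lambda>z. 0)" using SI_const[OF f, of 0] by simp
  then have "L2_norm (\<lambda>z. SI s f z - SI (\<lambda>x. 0) f z) = L2_norm (SI s f)"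
    using s f by (intro L2_norm_cong) (auto simp: L2_eq_def)
  then show ?thesis using SI_dist[OF s _ f, of "\<lambda>x. 0"] by simp
qed

lemma SI_diff:
  assumes s: "simple_function borel s" and f: "f \<in> L2" "g \<in> L2"
  shows "L2_eq (SI s (\<lambda>z. f z - g z)) (\<lambda>z. SI s f z - SI s g z)"
proof -
  have "L2_eq (\<lambda>z. \<Sum>c\<in>range s. c * P (s -` {c}) (\<lambda>z. f z - g z) z) (\<lambda>z. \<Sum>c\<in>range s. c * (P (s -` {c}) f z - P (s -` {c}) g z))"
    by (intro L2_eq_sum L2_eq_scale P_diff f simple_vimage s)
  then show ?thesis unfolding simple_spectral_integral_def
    by (simp add: right_diff_distrib sum_subtractf)
qed

lemma ennreal_double_add: "0 \<le> x \<Longrightarrow> 0 \<le> y \<Longrightarrow> 2 * ennreal x + 2 * ennreal y = ennreal (2 * x + 2 * y)"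
  by (simp add: ennreal_mult)

lemma nn_dist_triangle:
  assumes [measurable]: "a \<in> borel_measurable borel" "b \<in> borel_measurable borel" "c \<in> borel_measurable borel"
  shows "(\<integral>\<^sup>+x. ennreal ((cmod (a x - b x :: complex))\<^sup>2) \<partial>mu f)
     \<le> 2 * (\<integral>\<^sup>+x. ennreal ((cmod (a x - c x))\<^sup>2) \<partial>mu f) + 2 * (\<integral>\<^sup>+x. ennreal ((cmod (b x - c x))\<^sup>2) \<partial>mu f)"
proof -
  have "(\<integral>\<^sup>+x. ennreal ((cmod (a x - b x))\<^sup>2) \<partial>mu f)
      \<le> (\<integral>\<^sup>+x. 2 * ennreal ((cmod (a x - c x))\<^sup>2) + 2 * ennreal ((cmod (b x - c x))\<^sup>2) \<partial>mu f)"
  proof (rule nn_integral_mono)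
    fix x
    have "(cmod (a x - b x))\<^sup>2 \<le> (cmod (a x - c x) + cmod (b x - c x))\<^sup>2"
      using norm_triangle_ineq4[of "a x - c x" "b x - c x"] by (intro power_mono) auto
    also have "\<dots> \<le> 2 * (cmod (a x - c x))\<^sup>2 + 2 * (cmod (b x - c x))\<^sup>2"
      using sum_squares_bound[of "cmod (a x - c x)" "cmod (b x - c x)"] by (simp add: power2_sum)
    finally have "ennreal ((cmod (a x - b x))\<^sup>2) \<le> ennreal (2 * (cmod (a x - c x))\<^sup>2 + 2 * (cmod (b x - c x))\<^sup>2)"
      by (rule ennreal_leI)
    then show "ennreal ((cmod (a x - b x))\<^sup>2) \<le> 2 * ennreal ((cmod (a x - c x))\<^sup>2) + 2 * ennreal ((cmod (b x - c x))\<^sup>2)"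
      by (simp add: ennreal_double_add del: ennreal_plus)
  qed
  also have "\<dots> = 2 * (\<integral>\<^sup>+x. ennreal ((cmod (a x - c x))\<^sup>2) \<partial>mu f) + 2 * (\<integral>\<^sup>+x. ennreal ((cmod (b x - c x))\<^sup>2) \<partial>mu f)"
    by (simp add: nn_integral_add nn_integral_cmult)
  finally show ?thesis .
qed

text \<open>
  By the isometry, simple functions which converge in the space of the spectral measure have a
  Cauchy sequence of integrals.
\<close>

lemma spectral_integral_ex:
  assumes s: "\<And>n. simple_function borel (s n)" and f: "f \<in> L2" and F: "F \<in> borel_measurable borel"
    and lim: "(\<lambda>n. \<integral>\<^sup>+x. ennreal ((cmod (s n x - F x))\<^sup>2) \<partial>mu f) \<longlonglongrightarrow> 0"
  shows "\<exists>w. (f, w) \<in> spectral_integral P F \<and> L2_tendsto (\<lambda>n. SI (s n) f) w"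
proof -
  have sm: "s n \<in> borel_measurable borel" for n using s by (rule borel_measurable_simple_function)
  have "\<exists>w. L2_tendsto (\<lambda>n. SI (s n) f) w"
  proof (rule L2_complete)
    fix e :: real assume e: "e > 0"
    have "eventually (\<lambda>n. (\<integral>\<^sup>+x. ennreal ((cmod (s n x - F x))\<^sup>2) \<partial>mu f) < ennreal (e\<^sup>2 / 4)) sequentially"
      using e by (intro order_tendstoD(2)[OF lim]) auto
    then obtain N where N: "\<And>n. n \<ge> N \<Longrightarrow> (\<integral>\<^sup>+x. ennreal ((cmod (s n x - F x))\<^sup>2) \<partial>mu f) < ennreal (e\<^sup>2 / 4)"
      by (auto simp: eventually_sequentially)
    have "L2_norm (\<lambda>z. SI (s m) f z - SI (s n) f z) \<le> e" if "m \<ge> N" "n \<ge> N" for m n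
    proof -
      have "ennreal ((L2_norm (\<lambda>z. SI (s m) f z - SI (s n) f z))\<^sup>2) \<le> 2 * ennreal (e\<^sup>2 / 4) + 2 * ennreal (e\<^sup>2 / 4)"
        unfolding SI_dist[OF s s f]
        by (rule order_trans[OF nn_dist_triangle[OF sm sm F]])
           (intro add_mono mult_left_mono less_imp_le N that zero_le)
      also have "\<dots> = ennreal (2 * (e\<^sup>2 / 4) + 2 * (e\<^sup>2 / 4))"
        by (rule ennreal_double_add) auto
      also have "2 * (e\<^sup>2 / 4) + 2 * (e\<^sup>2 / 4) = e\<^sup>2" by simp
      finally show ?thesis using e by (auto simp: ennreal_le_iff intro: power2_le_imp_le)
    qed
    then show "\<exists>N. \<forall>m\<ge>N. \<forall>n\<ge>N. L2_norm (\<lambda>z. SI (s m) f z - SI (s n) f z) \<le> e" by blast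
  qed (use s f in auto)
  then obtain w where w: "L2_tendsto (\<lambda>n. SI (s n) f) w" by blast
  then have "w \<in> L2" by (simp add: L2_tendsto_def)
  then show ?thesis using w s lim f unfolding spectral_integral_def by blast
qed

text \<open>
  The sequence hidden in the definition of the graph can be exchanged for any other
  approximating sequence, by the isometry again. One explicit sequence can therefore serve all
  vectors.
\<close>

lemma spectral_integral_tendsto:
  assumes fw: "(f, w) \<in> spectral_integral P F" and s: "\<And>n. simple_function borel (s n)"
    and F: "F \<in> borel_measurable borel"
    and lim: "(\<lambda>n. \<integral>\<^sup>+x. ennreal ((cmod (s n x - F x))\<^sup>2) \<partial>mu f) \<longlonglongrightarrow> 0"
  shows "L2_tendsto (\<lambda>n. SI (s n) f) w"
proof -
  from fw obtain r where f: "f \<in> L2" and r: "\<And>n. simple_function borel (r n)"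
    and rlim: "(\<lambda>n. \<integral>\<^sup>+x. ennreal ((cmod (r n x - F x))\<^sup>2) \<partial>mu f) \<longlonglongrightarrow> 0"
    and rw: "L2_tendsto (\<lambda>n. SI (r n) f) w"
    unfolding spectral_integral_def by blast
  have m: "s n \<in> borel_measurable borel" "r n \<in> borel_measurable borel" for n
    using s r by (auto intro: borel_measurable_simple_function)
  show ?thesis
  proof (rule L2_tendsto_add_null[OF rw])
    have "(\<lambda>n. ennreal ((L2_norm (\<lambda>z. SI (s n) f z - SI (r n) f z))\<^sup>2)) \<longlonglongrightarrow> 0"
    proof (rule tendsto_sandwich[OF _ _ tendsto_const])
      show "\<forall>\<^sub>F n in sequentially. ennreal ((L2_norm (\<lambda>z. SI (s n) f z - SI (r n) f z))\<^sup>2)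
          \<le> 2 * (\<integral>\<^sup>+x. ennreal ((cmod (s n x - F x))\<^sup>2) \<partial>mu f) + 2 * (\<integral>\<^sup>+x. ennreal ((cmod (r n x - F x))\<^sup>2) \<partial>mu f)"
        unfolding SI_dist[OF s r f] by (intro always_eventually allI nn_dist_triangle m F)
      have "(\<lambda>n. 2 * (\<integral>\<^sup>+x. ennreal ((cmod (s n x - F x))\<^sup>2) \<partial>mu f) + 2 * (\<integral>\<^sup>+x. ennreal ((cmod (r n x - F x))\<^sup>2) \<partial>mu f)) \<longlonglongrightarrow> 2 * 0 + 2 * 0"
        by (intro tendsto_add ennreal_tendsto_cmult lim rlim) auto
      then show "(\<lambda>n. 2 * (\<integral>\<^sup>+x. ennreal ((cmod (s n x - F x))\<^sup>2) \<partial>mu f) + 2 * (\<integral>\<^sup>+x. ennreal ((cmod (r n x - F x))\<^sup>2) \<partial>mu f)) \<longlonglongrightarrow> 0"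
        by simp
    qed auto
    then have "(\<lambda>n. (L2_norm (\<lambda>z. SI (s n) f z - SI (r n) f z))\<^sup>2) \<longlonglongrightarrow> 0"
      by (simp only: ennreal_tendsto_0_iff[OF zero_le_power2])
    from tendsto_real_sqrt[OF this]
    show "(\<lambda>n. L2_norm (\<lambda>z. SI (s n) f z - SI (r n) f z)) \<longlonglongrightarrow> 0"
      by (simp only: real_sqrt_abs abs_of_nonneg[OF L2_norm_nonneg] real_sqrt_zero)
  qed (rule SI_L2[OF s f])
qed

end

section \<open>The unitary group by discretisation of the spectrum\<close>

text \<open>
  With \<open>K = k + 1\<close>, the interval \<open>[-K, K)\<close> is cut into pieces of length \<open>1 / K\<^sup>2\<close>, numbered by
  \<open>\<lfloor>K\<^sup>2 x\<rfloor>\<close>; the index \<open>K\<^sup>3\<close>, one above the largest that occurs inside, collects the rest of the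
  line. The width is chosen against the number of cells: an error of order \<open>1 / K\<^sup>2\<close> per cell,
  summed by Cauchy and Schwarz over \<open>O (K\<^sup>3)\<close> cells, is \<open>O (1 / \<surd>K)\<close>.
\<close>

definition cell :: "nat \<Rightarrow> real \<Rightarrow> int" where
  "cell k x = (if - real (Suc k) \<le> x \<and> x < real (Suc k) then \<lfloor>(real (Suc k))\<^sup>2 * x\<rfloor> else int (Suc k) ^ 3)"

definition node :: "nat \<Rightarrow> int \<Rightarrow> real" where
  "node k i = real_of_int i / (real (Suc k))\<^sup>2"

lemma cell_range: "cell k x \<in> {- (int (Suc k) ^ 3) .. int (Suc k) ^ 3}"
proof (cases "- real (Suc k) \<le> x \<and> x < real (Suc k)")
  case True
  have K: "(real (Suc k))\<^sup>2 > 0" by simp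
  have "(real (Suc k))\<^sup>2 * x \<le> (real (Suc k))\<^sup>2 * real (Suc k)" using True K by (intro mult_left_mono) auto
  moreover have "(real (Suc k))\<^sup>2 * (- real (Suc k)) \<le> (real (Suc k))\<^sup>2 * x" using True K by (intro mult_left_mono) auto
  moreover have "(real (Suc k))\<^sup>2 * real (Suc k) = real_of_int (int (Suc k) ^ 3)"
    by (simp add: power2_eq_square power3_eq_cube)
  ultimately have "- real_of_int (int (Suc k) ^ 3) \<le> (real (Suc k))\<^sup>2 * x" "(real (Suc k))\<^sup>2 * x \<le> real_of_int (int (Suc k) ^ 3)"
    by (simp_all only: mult_minus_right)
  then have "- (int (Suc k) ^ 3) \<le> \<lfloor>(real (Suc k))\<^sup>2 * x\<rfloor>" "\<lfloor>(real (Suc k))\<^sup>2 * x\<rfloor> \<le> int (Suc k) ^ 3"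
    by (auto simp only: le_floor_iff of_int_minus floor_le_iff intro: le_less_trans)+ (linarith?)
  then show ?thesis using True by (simp add: cell_def)
next
  case False
  then have "cell k x = int (Suc k) ^ 3" unfolding cell_def by (rule if_not_P)
  then show ?thesis by simp
qed

lemma finite_range_cell: "finite (range (cell k))"
  by (rule finite_subset[OF _ finite_atLeastAtMost_int[of "- (int (Suc k) ^ 3)" "int (Suc k) ^ 3"]])
     (use cell_range in blast)

lemma card_range_cell: "real (card (range (cell k))) \<le> 3 * real (Suc k) ^ 3"
proof -
  have "card (range (cell k)) \<le> card {- (int (Suc k) ^ 3) .. int (Suc k) ^ 3}"
    by (rule card_mono) (use cell_range in blast)+
  also have "\<dots> = nat (2 * int (Suc k) ^ 3 + 1)" by simp
  also have "\<dots> \<le> nat (3 * int (Suc k) ^ 3)" by (intro nat_mono) (simp add: one_le_power)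
  also have "\<dots> = 3 * Suc k ^ 3" by (metis nat_int of_nat_mult of_nat_numeral of_nat_power)
  finally have "real (card (range (cell k))) \<le> real (3 * Suc k ^ 3)" by (rule of_nat_mono)
  then show ?thesis by simp
qed

lemma cell_vimage [simp]: "cell k -` {i} \<in> sets borel"
proof -
  have "cell k \<in> borel \<rightarrow>\<^sub>M count_space UNIV" unfolding cell_def[abs_def] by measurable
  then show ?thesis using measurable_sets[of "cell k" borel "count_space UNIV" "{i}"] by simp
qed

lemma cell_outside: "cell k -` {int (Suc k) ^ 3} = - {- real (Suc k) ..< real (Suc k)}"
proof -
  have "cell k x \<noteq> int (Suc k) ^ 3" if "- real (Suc k) \<le> x" "x < real (Suc k)" for x
  proof -
    have "(real (Suc k))\<^sup>2 * x < (real (Suc k))\<^sup>2 * real (Suc k)" using that by (intro mult_strict_left_mono) auto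
    then have "(real (Suc k))\<^sup>2 * x < real_of_int (int (Suc k) ^ 3)" by (simp add: power2_eq_square power3_eq_cube)
    then have "\<lfloor>(real (Suc k))\<^sup>2 * x\<rfloor> < int (Suc k) ^ 3" by (simp only: floor_less_iff)
    then show ?thesis using that by (simp add: cell_def)
  qed
  then show ?thesis by (auto simp: cell_def)
qed

lemma cell_subset: "i \<noteq> int (Suc k) ^ 3 \<Longrightarrow> cell k -` {i} \<subseteq> {node k i .. node k i + 1 / (real (Suc k))\<^sup>2}"
proof
  fix x assume i: "i \<noteq> int (Suc k) ^ 3" and "x \<in> cell k -` {i}"
  then have "cell k x = i" by simp
  with i have "\<lfloor>(real (Suc k))\<^sup>2 * x\<rfloor> = i" by (auto simp: cell_def split: if_splits)
  then have "real_of_int i \<le> (real (Suc k))\<^sup>2 * x" "(real (Suc k))\<^sup>2 * x \<le> real_of_int i + 1" by linarith+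
  moreover have "(real (Suc k))\<^sup>2 > 0" by simp
  ultimately show "x \<in> {node k i .. node k i + 1 / (real (Suc k))\<^sup>2}"
    unfolding node_def by (simp add: pos_divide_le_eq pos_le_divide_eq add_divide_distrib[symmetric] mult.commute del: of_nat_Suc)
qed

lemma node_cell_tendsto: "(\<lambda>k. node k (cell k x)) \<longlonglongrightarrow> x"
proof -
  obtain N where N: "\<bar>x\<bar> < real N" using reals_Archimedean2 by blast
  have *: "norm (node k (cell k x) - x) \<le> 1 / real (Suc k)" if "k \<ge> N" for k
  proof -
    have "x \<in> {- real (Suc k) ..< real (Suc k)}" using N that by auto
    then have "cell k x \<noteq> int (Suc k) ^ 3" using cell_outside[of k] by blast
    then have "x \<in> {node k (cell k x) .. node k (cell k x) + 1 / (real (Suc k))\<^sup>2}" using cell_subset[of "cell k x" k] by blast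
    moreover have "1 / (real (Suc k))\<^sup>2 \<le> 1 / real (Suc k)"
      by (intro divide_left_mono) (auto simp: power2_eq_square simp del: of_nat_Suc)
    ultimately show ?thesis by auto
  qed
  have "(\<lambda>k. node k (cell k x) - x) \<longlonglongrightarrow> 0"
    by (rule Lim_null_comparison[OF eventually_sequentiallyI[of N, OF *] lim_inverse_n'[THEN LIMSEQ_Suc]])
  then show ?thesis by (simp add: Lim_null[symmetric])
qed

text \<open>
  The exponential \<open>exp (- i t x)\<close> sampled at the left endpoints of the cells. It has finitely
  many values and modulus one everywhere, also on the outer cell, so its integral is an exact
  isometry, not just a bounded operator.
\<close>

definition phase :: "real \<Rightarrow> nat \<Rightarrow> real \<Rightarrow> complex" where
  "phase t k x = exp (- \<i> * complex_of_real (t * node k (cell k x)))"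

lemma cmod_phase [simp]: "cmod (exp (- \<i> * complex_of_real a)) = 1"
  using norm_exp_i_times[of "- a"] by simp

lemma cmod_phase_eq [simp]: "cmod (phase t k x) = 1"
  unfolding phase_def by (rule cmod_phase)

lemma simple_phase [simp]: "simple_function borel (phase t k)"
  unfolding simple_function_def
proof (intro conjI ballI)
  show "finite (phase t k ` space borel)"
    using finite_imageI[OF finite_range_cell[of k], of "\<lambda>i. exp (- \<i> * complex_of_real (t * node k i))"]
    by (simp add: image_image phase_def[abs_def])
  fix c
  have "phase t k -` {c} = (\<Union>i\<in>{i\<in>range (cell k). exp (- \<i> * complex_of_real (t * node k i)) = c}. cell k -` {i})" by (auto simp: phase_def)
  also have "\<dots> \<in> sets borel" by (rule sets.finite_UN) (use finite_range_cell in auto)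
  finally show "phase t k -` {c} \<inter> space borel \<in> sets borel" by simp
qed

context pvm begin

lemma phase_limit:
  assumes f: "f \<in> L2"
  shows "(\<lambda>k. \<integral>\<^sup>+x. ennreal ((cmod (phase t k x - exp (- \<i> * complex_of_real (t * x))))\<^sup>2) \<partial>mu f) \<longlonglongrightarrow> 0"
proof -
  have m: "phase t k \<in> borel_measurable borel" for k by (rule borel_measurable_simple_function) simp
  have "(\<lambda>k. \<integral>\<^sup>+x. ennreal ((cmod (phase t k x - exp (- \<i> * complex_of_real (t * x))))\<^sup>2) \<partial>mu f) \<longlonglongrightarrow> (\<integral>\<^sup>+x. 0 \<partial>mu f)"
  \<comment> \<open>The difference of two numbers of modulus one has square at most \<open>4\<close>, which is integrable
      because the spectral measure is finite.\<close>
  proof (rule nn_integral_dominated_convergence[where w="\<lambda>x. 4"])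
    show "(\<lambda>x. ennreal ((cmod (phase t k x - exp (- \<i> * complex_of_real (t * x))))\<^sup>2)) \<in> borel_measurable (mu f)" for k
    proof -
      have "(\<lambda>x. phase t k x - exp (- \<i> * complex_of_real (t * x))) \<in> borel_measurable borel"
        by (intro borel_measurable_diff[OF m] borel_measurable_continuous_onI continuous_intros)
      then show ?thesis by measurable
    qed
    show "AE x in mu f. ennreal ((cmod (phase t k x - exp (- \<i> * complex_of_real (t * x))))\<^sup>2) \<le> 4" for k
    proof (rule AE_I2)
      fix x
      have "cmod (phase t k x - exp (- \<i> * complex_of_real (t * x))) \<le> 1 + 1"
        by (rule order_trans[OF norm_triangle_ineq4]) (simp only: cmod_phase cmod_phase_eq order_refl)
      then have "(cmod (phase t k x - exp (- \<i> * complex_of_real (t * x))))\<^sup>2 \<le> 2\<^sup>2" by (intro power_mono) auto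
      then show "ennreal ((cmod (phase t k x - exp (- \<i> * complex_of_real (t * x))))\<^sup>2) \<le> 4"
        using ennreal_leI[of "(cmod (phase t k x - exp (- \<i> * complex_of_real (t * x))))\<^sup>2" 4] by simp
    qed
    show "(\<integral>\<^sup>+x. 4 \<partial>mu f) < \<infinity>" using emeasure_mu_UNIV[OF f] by (simp add: ennreal_mult_less_top)
    show "AE x in mu f. (\<lambda>k. ennreal ((cmod (phase t k x - exp (- \<i> * complex_of_real (t * x))))\<^sup>2)) \<longlonglongrightarrow> 0"
    proof (rule AE_I2)
      fix x
      have "(\<lambda>k. (cmod (phase t k x - exp (- \<i> * complex_of_real (t * x))))\<^sup>2)
          \<longlonglongrightarrow> (cmod (exp (- \<i> * complex_of_real (t * x)) - exp (- \<i> * complex_of_real (t * x))))\<^sup>2"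
        unfolding phase_def by (intro tendsto_intros node_cell_tendsto)
      then show "(\<lambda>k. ennreal ((cmod (phase t k x - exp (- \<i> * complex_of_real (t * x))))\<^sup>2)) \<longlonglongrightarrow> 0"
        by (subst ennreal_tendsto_0_iff) auto
    qed
  qed auto
  then show ?thesis by simp
qed

lemma exp_measurable: "(\<lambda>x. exp (- \<i> * complex_of_real (t * x))) \<in> borel_measurable borel"
  by (intro borel_measurable_continuous_onI continuous_intros)

lemma norm_SI_phase:
  assumes f: "f \<in> L2" shows "L2_norm (SI (phase t k) f) = L2_norm f"
proof -
  have "ennreal ((L2_norm (SI (phase t k) f))\<^sup>2) = (\<integral>\<^sup>+x. ennreal ((cmod (phase t k x))\<^sup>2) \<partial>mu f)"
    by (rule SI_norm[OF simple_phase f])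
  also have "\<dots> = ennreal ((L2_norm f)\<^sup>2)" by (simp add: emeasure_mu_UNIV f)
  finally show ?thesis by (simp add: power2_eq_iff_nonneg)
qed

lemma unitary_group_ex:
  "f \<in> L2 \<Longrightarrow> \<exists>w. (f, w) \<in> spectral_integral P (\<lambda>x. exp (- \<i> * complex_of_real (t * x)))"
  using spectral_integral_ex[OF simple_phase _ exp_measurable phase_limit] by blast

lemma unitary_group_tendsto:
  "f \<in> L2 \<Longrightarrow> (f, w) \<in> spectral_integral P (\<lambda>x. exp (- \<i> * complex_of_real (t * x))) \<Longrightarrow>
    L2_tendsto (\<lambda>k. SI (phase t k) f) w"
  by (rule spectral_integral_tendsto[OF _ simple_phase exp_measurable phase_limit])

text \<open>
  The graph of the functional calculus is only a relation, so additivity is not available as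
  such. It holds for the simple approximants, and since the approximating sequence \<open>phase\<close> is
  the same for \<open>f\<close> and \<open>g\<close>, it survives the limit.
\<close>

lemma unitary_group_norm_diff:
  assumes f: "f \<in> L2" "(f, w) \<in> spectral_integral P (\<lambda>x. exp (- \<i> * complex_of_real (t * x)))"
    and g: "g \<in> L2" "(g, v) \<in> spectral_integral P (\<lambda>x. exp (- \<i> * complex_of_real (t * x)))"
  shows "L2_norm (\<lambda>z. w z - v z) = L2_norm (\<lambda>z. f z - g z)"
proof -
  have "L2_tendsto (\<lambda>k z. SI (phase t k) f z - SI (phase t k) g z) (\<lambda>z. w z - v z)"
    by (intro L2_tendsto_diff unitary_group_tendsto f g)
  from L2_tendsto_norm[OF this]
  have lim: "(\<lambda>k. L2_norm (\<lambda>z. SI (phase t k) f z - SI (phase t k) g z)) \<longlonglongrightarrow> L2_norm (\<lambda>z. w z - v z)" .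
  have "L2_norm (\<lambda>z. SI (phase t k) f z - SI (phase t k) g z) = L2_norm (\<lambda>z. f z - g z)" for k
  proof -
    have "L2_norm (\<lambda>z. SI (phase t k) f z - SI (phase t k) g z) = L2_norm (SI (phase t k) (\<lambda>z. f z - g z))"
      using SI_diff[OF simple_phase f(1) g(1), of t k] SI_L2[OF simple_phase] f(1) g(1)
      by (intro L2_norm_cong L2_diff L2_eq_sym[OF SI_diff]) auto
    then show ?thesis using norm_SI_phase[of "\<lambda>z. f z - g z" t k] f(1) g(1) by auto
  qed
  with lim have "(\<lambda>k::nat. L2_norm (\<lambda>z. f z - g z)) \<longlonglongrightarrow> L2_norm (\<lambda>z. w z - v z)" by simp
  from LIMSEQ_unique[OF this tendsto_const] show ?thesis .
qed

lemma unitary_group_norm: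
  assumes f: "f \<in> L2" "(f, w) \<in> spectral_integral P (\<lambda>x. exp (- \<i> * complex_of_real (t * x)))"
  shows "L2_norm w = L2_norm f"
  using LIMSEQ_unique[OF L2_tendsto_norm[OF unitary_group_tendsto[OF f]]] norm_SI_phase[OF f(1)] by simp

text \<open>
  The spectral measure of \<open>P B f\<close> is carried by \<open>B\<close>, where the functions \<open>x\<close> and \<open>a\<close> differ by
  at most \<open>\<delta>\<close>; by the isometry, so do their integrals on this vector.
\<close>

lemma approximate_eigenvector:
  assumes f: "f \<in> L2" and B: "B \<in> sets borel" "B \<subseteq> {a..a + \<delta>}" and \<delta>: "0 \<le> \<delta>"
  shows "\<exists>w. (P B f, w) \<in> spectral_integral P complex_of_real \<and>
    L2_norm (\<lambda>z. w z - complex_of_real a * P B f z) \<le> \<delta> * L2_norm (P B f)"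
proof -
  define v where "v = P B f"
  have v: "v \<in> L2" using B f by (simp add: v_def)
  have "emeasure (mu v) (- B) = 0"
    using emeasure_mu[of v "- B"] v P_norm_disjoint[of "- B" B f] B f
    by (auto simp: v_def borel_comp)
  then have AEB: "AE x in mu v. x \<in> B" by (intro AE_I[of _ _ "- B"]) (use B in \<open>auto simp: borel_comp\<close>)
  \<comment> \<open>Rounding \<open>x\<close> down to a multiple of \<open>1 / (n + 1)\<close> gives simple functions, since \<open>B\<close> is
      bounded. The complement of \<open>B\<close> is null for the spectral measure of \<open>v\<close>; the value \<open>0\<close> there
      keeps the range finite.\<close>
  define s where "s n x = (if x \<in> B then complex_of_real (real_of_int \<lfloor>real (Suc n) * x\<rfloor> / real (Suc n)) else 0)" for n :: nat and x
  have near: "cmod (s n x - complex_of_real x) \<le> 1 / real (Suc n)" if "x \<in> B" for n x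
  proof -
    have n: "real (Suc n) > 0" by simp
    have "s n x - complex_of_real x = complex_of_real ((real_of_int \<lfloor>real (Suc n) * x\<rfloor> - real (Suc n) * x) / real (Suc n))"
      using that n by (simp add: s_def diff_divide_distrib del: of_nat_Suc)
    then have "cmod (s n x - complex_of_real x) = \<bar>real_of_int \<lfloor>real (Suc n) * x\<rfloor> - real (Suc n) * x\<bar> / real (Suc n)"
      by (simp only: norm_of_real abs_divide abs_of_nat)
    also have "\<dots> \<le> 1 / real (Suc n)" by (intro divide_right_mono) linarith+
    finally show ?thesis .
  qed
  have simp_s: "simple_function borel (s n)" for n
  proof (rule simple_function_borel_measurable)
    have "(\<lambda>x. if x \<in> B then complex_of_real (real_of_int \<lfloor>real (Suc n) * x\<rfloor> / real (Suc n)) else 0) \<in> borel_measurable borel"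
      using B(1) by measurable
    then show "s n \<in> borel_measurable borel" by (simp add: s_def[abs_def])
    have "s n ` space borel \<subseteq> insert 0 ((\<lambda>i. complex_of_real (real_of_int i / real (Suc n))) ` {\<lfloor>real (Suc n) * a\<rfloor>..\<lfloor>real (Suc n) * (a + \<delta>)\<rfloor>})"
    proof
      fix c assume "c \<in> s n ` space borel"
      then obtain x where x: "c = s n x" by auto
      show "c \<in> insert 0 ((\<lambda>i. complex_of_real (real_of_int i / real (Suc n))) ` {\<lfloor>real (Suc n) * a\<rfloor>..\<lfloor>real (Suc n) * (a + \<delta>)\<rfloor>})"
      proof (cases "x \<in> B")
        case True
        then have "a \<le> x" "x \<le> a + \<delta>" using B by auto
        then have "\<lfloor>real (Suc n) * x\<rfloor> \<in> {\<lfloor>real (Suc n) * a\<rfloor>..\<lfloor>real (Suc n) * (a + \<delta>)\<rfloor>}"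
          by (auto intro!: floor_mono mult_left_mono simp del: of_nat_Suc)
        then show ?thesis using True by (auto simp: x s_def)
      qed (auto simp: x s_def)
    qed
    then show "finite (s n ` space borel)" by (rule finite_subset) auto
  qed
  have Lm: "emeasure (mu v) UNIV = ennreal ((L2_norm v)\<^sup>2)" by (rule emeasure_mu_UNIV[OF v])
  have bnd: "(\<integral>\<^sup>+x. ennreal ((cmod (F x))\<^sup>2) \<partial>mu v) \<le> ennreal ((b * L2_norm v)\<^sup>2)"
    if "\<And>x. x \<in> B \<Longrightarrow> cmod (F x) \<le> b" "b \<ge> 0" for F :: "real \<Rightarrow> complex" and b
  proof -
    have "(\<integral>\<^sup>+x. ennreal ((cmod (F x))\<^sup>2) \<partial>mu v) \<le> (\<integral>\<^sup>+x. ennreal (b\<^sup>2) \<partial>mu v)"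
      by (rule nn_integral_mono_AE, use AEB in eventually_elim) (auto intro!: ennreal_leI power_mono that)
    also have "\<dots> = ennreal ((b * L2_norm v)\<^sup>2)" by (simp add: Lm ennreal_mult[symmetric] power_mult_distrib)
    finally show ?thesis .
  qed
  have lim: "(\<lambda>n. \<integral>\<^sup>+x. ennreal ((cmod (s n x - complex_of_real x))\<^sup>2) \<partial>mu v) \<longlonglongrightarrow> 0"
  proof (rule tendsto_sandwich[OF _ _ tendsto_const])
    show "\<forall>\<^sub>F n in sequentially. (\<integral>\<^sup>+x. ennreal ((cmod (s n x - complex_of_real x))\<^sup>2) \<partial>mu v) \<le> ennreal ((1 / real (Suc n) * L2_norm v)\<^sup>2)"
      by (intro always_eventually allI bnd near) auto
    have "(\<lambda>n. (1 / real (Suc n) * L2_norm v)\<^sup>2) \<longlonglongrightarrow> (0 * L2_norm v)\<^sup>2"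
      by (intro tendsto_power tendsto_mult tendsto_const lim_inverse_n'[THEN LIMSEQ_Suc])
    then show "(\<lambda>n. ennreal ((1 / real (Suc n) * L2_norm v)\<^sup>2)) \<longlonglongrightarrow> 0"
      by (subst ennreal_tendsto_0_iff) auto
  qed auto
  obtain w where w: "(v, w) \<in> spectral_integral P complex_of_real" "L2_tendsto (\<lambda>n. SI (s n) v) w"
    using spectral_integral_ex[OF simp_s v _ lim] by auto
  have wL: "w \<in> L2" using w by (simp add: L2_tendsto_def)
  have le: "L2_norm (\<lambda>z. SI (s n) v z - complex_of_real a * v z) \<le> (\<delta> + 1 / real (Suc n)) * L2_norm v" for n
  proof (rule power2_le_imp_le)
    have "L2_norm (\<lambda>z. SI (s n) v z - complex_of_real a * v z) = L2_norm (\<lambda>z. SI (s n) v z - SI (\<lambda>x. complex_of_real a) v z)"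
      using SI_const[OF v, of "complex_of_real a"] simp_s v
      by (intro L2_norm_cong L2_eq_diff L2_diff) (auto intro: L2_eq_sym)
    then have "ennreal ((L2_norm (\<lambda>z. SI (s n) v z - complex_of_real a * v z))\<^sup>2)
        = (\<integral>\<^sup>+x. ennreal ((cmod (s n x - complex_of_real a))\<^sup>2) \<partial>mu v)"
      using SI_dist[OF simp_s _ v, of "\<lambda>x. complex_of_real a" n] by simp
    also have "\<dots> \<le> ennreal (((\<delta> + 1 / real (Suc n)) * L2_norm v)\<^sup>2)"
    proof (rule bnd)
      fix x assume x: "x \<in> B"
      have "cmod (s n x - complex_of_real a) \<le> cmod (s n x - complex_of_real x) + cmod (complex_of_real x - complex_of_real a)"
        using norm_triangle_ineq[of "s n x - complex_of_real x" "complex_of_real x - complex_of_real a"] by simp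
      moreover have "cmod (complex_of_real x - complex_of_real a) \<le> \<delta>"
        using x B by (auto simp: of_real_diff[symmetric] simp del: of_real_diff)
      ultimately show "cmod (s n x - complex_of_real a) \<le> \<delta> + 1 / real (Suc n)" using near[OF x, of n] by linarith
    qed (use \<delta> in auto)
    finally show "(L2_norm (\<lambda>z. SI (s n) v z - complex_of_real a * v z))\<^sup>2 \<le> ((\<delta> + 1 / real (Suc n)) * L2_norm v)\<^sup>2"
      by (simp add: ennreal_le_iff)
  qed (use \<delta> in auto)
  have "L2_tendsto (\<lambda>n z. SI (s n) v z - complex_of_real a * v z) (\<lambda>z. w z - complex_of_real a * v z)"
    by (rule L2_tendsto_diff[OF w(2)]) (use v in \<open>auto simp: L2_tendsto_def L2_norm_def\<close>)
  from L2_tendsto_norm[OF this]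
  have "L2_norm (\<lambda>z. w z - complex_of_real a * v z) \<le> (\<delta> + 0) * L2_norm v"
    by (rule LIMSEQ_le[OF _ tendsto_mult[OF tendsto_add[OF tendsto_const lim_inverse_n'[THEN LIMSEQ_Suc]] tendsto_const]])
       (use le in auto)
  then show ?thesis using w(1) unfolding v_def by auto
qed

text \<open>
  The hypothesis on the derivative says \<open>G' = - i T G\<close> in the weak sense, tested against the
  domain of \<open>T\<close>. Expand \<open>u\<^sub>0\<close> into its components \<open>h k i\<close> for the cells of the spectrum. For a
  true eigenvector \<open>h\<close> with eigenvalue \<open>x\<close>, the function \<open>exp (- i s x) * \<langle>h, G s\<rangle>\<close> is constant
  in \<open>s\<close>. The components are approximate eigenvectors, with errors proportional to the width of
  the cells, and the outer cell contributes little because the spectral measure of \<open>u\<^sub>0\<close> is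
  finite.
\<close>

lemma evolution_pairing:
  assumes T: "T = spectral_integral P complex_of_real"
    and u: "u\<^sub>0 \<in> L2" "(u\<^sub>0, u) \<in> spectral_integral P (\<lambda>x. exp (- \<i> * complex_of_real (t * x)))" and t: "0 \<le> t"
    and G: "\<And>s. s \<in> {0..t} \<Longrightarrow> G s \<in> L2" "\<And>s. s \<in> {0..t} \<Longrightarrow> L2_norm (G s) \<le> M"
    and dG: "\<And>h w s. (h, w) \<in> T \<Longrightarrow> s \<in> {0..t} \<Longrightarrow>
        ((\<lambda>s. L2_inner h (G s)) has_vector_derivative \<i> * L2_inner w (G s)) (at s within {0..t})"
  shows "L2_inner u (G t) = L2_inner u\<^sub>0 (G 0)"
proof -
  have M: "M \<ge> 0" using order_trans[OF L2_norm_nonneg G(2)[of 0]] t by simp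
  have GL: "G 0 \<in> L2" "G t \<in> L2" using G(1) t by auto
  define h where "h k i = P (cell k -` {i}) u\<^sub>0" for k i
  have h: "h k i \<in> L2" for k i using u(1) by (simp add: h_def)
  define c where "c k i = exp (- \<i> * complex_of_real (t * node k i))" for k i
  have cc: "cmod (c k i) = 1" for k i unfolding c_def by (rule cmod_phase)
  define out where "out k = int (Suc k) ^ 3" for k
  \<comment> \<open>The mean value theorem for \<open>F s = exp (- i s x) * \<langle>h, G s\<rangle>\<close>, whose derivative pairs
      \<open>T h - x h\<close> with \<open>G s\<close>.\<close>
  have inside: "cmod (c k i * L2_inner (h k i) (G t) - L2_inner (h k i) (G 0)) \<le> t * M / (real (Suc k))\<^sup>2 * L2_norm (h k i)"
    if i: "i \<noteq> out k" for k i
  proof -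
    obtain w where w: "(h k i, w) \<in> T"
      and wn: "L2_norm (\<lambda>z. w z - complex_of_real (node k i) * h k i z) \<le> 1 / (real (Suc k))\<^sup>2 * L2_norm (h k i)"
    proof -
      have "0 \<le> 1 / (real (Suc k))\<^sup>2" by simp
      from approximate_eigenvector[OF u(1) cell_vimage cell_subset[OF i[unfolded out_def]] this]
      show ?thesis using that unfolding h_def T by blast
    qed
    have wL: "w \<in> L2" using w by (simp add: T spectral_integral_def)
    define F where "F s = exp (- \<i> * complex_of_real (s * node k i)) * L2_inner (h k i) (G s)" for s
    define F' where "F' s = \<i> * exp (- \<i> * complex_of_real (s * node k i)) * L2_inner (\<lambda>z. w z - complex_of_real (node k i) * h k i z) (G s)" for s
    have der: "(F has_vector_derivative F' s) (at s within {0..t})" if s: "s \<in> {0..t}" for s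
    proof -
      have "((\<lambda>s. exp (- \<i> * complex_of_real (s * node k i))) has_vector_derivative
          (- \<i> * complex_of_real (node k i)) * exp (- \<i> * complex_of_real (s * node k i))) (at s within {0..t})"
      proof -
        have "((\<lambda>\<zeta>. exp (- \<i> * complex_of_real (node k i) * \<zeta>)) has_field_derivative
            (- \<i> * complex_of_real (node k i)) * exp (- \<i> * complex_of_real (node k i) * complex_of_real s)) (at (complex_of_real s))"
          by (auto intro!: derivative_eq_intros)
        from has_vector_derivative_real_field[OF this, of "{0..t}"]
        show ?thesis by (simp only: of_real_mult mult.assoc mult.commute[of "complex_of_real (node k i)" "complex_of_real _"])
      qed
      from has_vector_derivative_mult[OF this dG[OF w s]]
      have "(F has_vector_derivative exp (- \<i> * complex_of_real (s * node k i)) * (\<i> * L2_inner w (G s))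
          + (- \<i> * complex_of_real (node k i)) * exp (- \<i> * complex_of_real (s * node k i)) * L2_inner (h k i) (G s)) (at s within {0..t})"
        unfolding F_def .
      moreover have "L2_inner (\<lambda>z. w z - complex_of_real (node k i) * h k i z) (G s) = L2_inner w (G s) - complex_of_real (node k i) * L2_inner (h k i) (G s)"
        using wL h G(1)[OF s] by (subst L2_inner_diff_left) (auto simp: L2_inner_scale_left)
      moreover have "\<i> * E * (A - x * B) = E * (\<i> * A) + (- \<i> * x) * E * B" for E A B x :: complex
        by (simp add: algebra_simps)
      ultimately show ?thesis unfolding F'_def by (simp only:)
    qed
    have bound: "cmod (F' s) \<le> 1 / (real (Suc k))\<^sup>2 * L2_norm (h k i) * M" if s: "s \<in> {0..t}" for s
    proof -
      have "cmod (F' s) = cmod (L2_inner (\<lambda>z. w z - complex_of_real (node k i) * h k i z) (G s))"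
        unfolding F'_def norm_mult cmod_phase by simp
      also have "\<dots> \<le> L2_norm (\<lambda>z. w z - complex_of_real (node k i) * h k i z) * L2_norm (G s)"
        by (intro L2_Cauchy_Schwarz L2_diff wL L2_scale h G(1) s)
      also have "\<dots> \<le> 1 / (real (Suc k))\<^sup>2 * L2_norm (h k i) * M"
        by (intro mult_mono wn G(2) s) auto
      finally show ?thesis .
    qed
    have "norm (F t - F 0) \<le> 1 / (real (Suc k))\<^sup>2 * L2_norm (h k i) * M * norm (t - 0)"
    proof (rule differentiable_bound[where S="{0..t}" and f'="\<lambda>s x. x *\<^sub>R F' s"])
      show "(F has_derivative (\<lambda>x. x *\<^sub>R F' s)) (at s within {0..t})" if "s \<in> {0..t}" for s
        using der[OF that] by (simp add: has_vector_derivative_def)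
      show "onorm (\<lambda>x. x *\<^sub>R F' s) \<le> 1 / (real (Suc k))\<^sup>2 * L2_norm (h k i) * M" if "s \<in> {0..t}" for s
      proof (rule onorm_bound)
        show "0 \<le> 1 / (real (Suc k))\<^sup>2 * L2_norm (h k i) * M" using M by simp
        show "norm (x *\<^sub>R F' s) \<le> 1 / (real (Suc k))\<^sup>2 * L2_norm (h k i) * M * norm x" for x
          using mult_left_mono[OF bound[OF that] norm_ge_zero[of x]]
          by (simp only: norm_scaleR real_norm_def mult.commute[of _ "\<bar>x\<bar>"])
      qed
    qed (use t in auto)
    then show ?thesis using t by (simp add: F_def c_def mult_ac)
  qed
  \<comment> \<open>A bound without any smallness, to be used for the outer cell only.\<close>
  have outside: "cmod (c k i * L2_inner (h k i) (G t) - L2_inner (h k i) (G 0)) \<le> 2 * M * L2_norm (h k i)" for k i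
  proof -
    have "cmod (L2_inner (h k i) (G s)) \<le> L2_norm (h k i) * M" if "s \<in> {0..t}" for s
      by (rule order_trans[OF L2_Cauchy_Schwarz[OF h G(1)[OF that]]]) (intro mult_left_mono G(2) that L2_norm_nonneg)
    from this[of 0] this[of t] t
    have "cmod (L2_inner (h k i) (G 0)) \<le> L2_norm (h k i) * M" "cmod (L2_inner (h k i) (G t)) \<le> L2_norm (h k i) * M" by auto
    moreover have "cmod (c k i * L2_inner (h k i) (G t) - L2_inner (h k i) (G 0))
        \<le> cmod (c k i * L2_inner (h k i) (G t)) + cmod (L2_inner (h k i) (G 0))"
      by (rule norm_triangle_ineq4)
    ultimately show ?thesis by (simp add: norm_mult cc mult_ac)
  qed
  have part: "L2_inner (SI (phase t k) u\<^sub>0) (G t) = (\<Sum>i\<in>range (cell k). c k i * L2_inner (h k i) (G t))" for k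
  proof -
    have "L2_eq (SI (phase t k) u\<^sub>0) (\<lambda>z. \<Sum>i\<in>range (cell k). c k i * h k i z)"
      using SI_partition[where q="cell k" and \<phi>="c k" and f="u\<^sub>0", OF finite_range_cell cell_vimage u(1)] unfolding phase_def[abs_def] c_def h_def .
    then have "L2_inner (SI (phase t k) u\<^sub>0) (G t) = L2_inner (\<lambda>z. \<Sum>i\<in>range (cell k). c k i * h k i z) (G t)"
      by (rule L2_inner_cong[rotated 4]) (auto intro!: L2_sum L2_scale h GL SI_L2 u(1))
    then show ?thesis using h GL by (subst (asm) L2_inner_sum_left) (auto simp: L2_inner_scale_left)
  qed
  have part0: "L2_inner u\<^sub>0 (G 0) = (\<Sum>i\<in>range (cell k). L2_inner (h k i) (G 0))" for k
  proof -
    have "L2_eq (P (\<Union>i\<in>range (cell k). cell k -` {i}) u\<^sub>0) (\<lambda>z. \<Sum>i\<in>range (cell k). h k i z)"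
      unfolding h_def by (rule P_finite_UN[OF finite_range_cell _ _ u(1)]) (auto simp: disjoint_family_on_def)
    moreover have "(\<Union>i\<in>range (cell k). cell k -` {i}) = UNIV" by auto
    ultimately have "L2_eq u\<^sub>0 (\<lambda>z. \<Sum>i\<in>range (cell k). h k i z)"
      using L2_eq_trans[OF L2_eq_sym[OF P_UNIV[OF u(1)]]] by simp
    then have "L2_inner u\<^sub>0 (G 0) = L2_inner (\<lambda>z. \<Sum>i\<in>range (cell k). h k i z) (G 0)"
      by (rule L2_inner_cong[rotated 4]) (auto intro!: L2_sum h GL u(1))
    then show ?thesis using h GL by (subst (asm) L2_inner_sum_left) auto
  qed
  have total: "(\<Sum>i\<in>range (cell k). (L2_norm (h k i))\<^sup>2) = (L2_norm u\<^sub>0)\<^sup>2" for k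
  proof -
    have "ennreal ((L2_norm (\<lambda>z. \<Sum>i\<in>range (cell k). 1 * h k i z))\<^sup>2) = ennreal ((L2_norm u\<^sub>0)\<^sup>2)"
      using partition_norm[where q="cell k" and \<phi>="\<lambda>i. 1" and f="u\<^sub>0", OF finite_range_cell cell_vimage u(1)] emeasure_mu_UNIV[OF u(1)] by (simp add: h_def)
    moreover have "(L2_norm (\<lambda>z. \<Sum>i\<in>range (cell k). 1 * h k i z))\<^sup>2 = (\<Sum>i\<in>range (cell k). (cmod 1)\<^sup>2 * (L2_norm (h k i))\<^sup>2)"
      unfolding h_def by (rule orthogonal_sum_norm[OF finite_range_cell _ _ u(1)]) (auto simp: disjoint_family_on_def)
    ultimately show ?thesis by simp
  qed
  \<comment> \<open>Cauchy and Schwarz over the at most \<open>3 K\<^sup>3\<close> cells: the components are orthogonal, so it is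
      their squared norms that sum to a bounded quantity.\<close>
  have sumh: "(\<Sum>i\<in>range (cell k). L2_norm (h k i)) \<le> sqrt (3 * real (Suc k) ^ 3) * L2_norm u\<^sub>0" for k
  proof (rule power2_le_imp_le)
    have "(\<Sum>i\<in>range (cell k). L2_norm (h k i))\<^sup>2 \<le> (\<Sum>i\<in>range (cell k). (L2_norm (h k i))\<^sup>2) * real (card (range (cell k)))"
      by (rule sum_squared_le_sum_of_squares)
    also have "\<dots> \<le> (L2_norm u\<^sub>0)\<^sup>2 * (3 * real (Suc k) ^ 3)"
      unfolding total by (intro mult_left_mono card_range_cell) auto
    also have "\<dots> = (sqrt (3 * real (Suc k) ^ 3) * L2_norm u\<^sub>0)\<^sup>2"
      by (simp add: power_mult_distrib del: of_nat_Suc)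
    finally show "(\<Sum>i\<in>range (cell k). L2_norm (h k i))\<^sup>2 \<le> (sqrt (3 * real (Suc k) ^ 3) * L2_norm u\<^sub>0)\<^sup>2" .
  qed (simp del: of_nat_Suc)
  have err: "cmod (L2_inner (SI (phase t k) u\<^sub>0) (G t) - L2_inner u\<^sub>0 (G 0))
      \<le> t * M / (real (Suc k))\<^sup>2 * (sqrt (3 * real (Suc k) ^ 3) * L2_norm u\<^sub>0) + 2 * M * L2_norm (h k (out k))" for k
  proof -
    have "cmod (L2_inner (SI (phase t k) u\<^sub>0) (G t) - L2_inner u\<^sub>0 (G 0))
        = cmod (\<Sum>i\<in>range (cell k). c k i * L2_inner (h k i) (G t) - L2_inner (h k i) (G 0))"
      unfolding part part0[of k] by (simp add: sum_subtractf)
    also have "\<dots> \<le> (\<Sum>i\<in>range (cell k). t * M / (real (Suc k))\<^sup>2 * L2_norm (h k i) + (if i = out k then 2 * M * L2_norm (h k (out k)) else 0))"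
    proof (rule order_trans[OF norm_sum sum_mono])
      fix i
      have "0 \<le> t * M / (real (Suc k))\<^sup>2 * L2_norm (h k i)" using t M by simp
      then show "cmod (c k i * L2_inner (h k i) (G t) - L2_inner (h k i) (G 0))
          \<le> t * M / (real (Suc k))\<^sup>2 * L2_norm (h k i) + (if i = out k then 2 * M * L2_norm (h k (out k)) else 0)"
        using inside[of i k] outside[of k i] by (cases "i = out k") auto
    qed
    also have "\<dots> = t * M / (real (Suc k))\<^sup>2 * (\<Sum>i\<in>range (cell k). L2_norm (h k i))
        + (if out k \<in> range (cell k) then 2 * M * L2_norm (h k (out k)) else 0)"
      using finite_range_cell by (simp add: sum.distrib sum_distrib_left)
    also have "\<dots> \<le> t * M / (real (Suc k))\<^sup>2 * (sqrt (3 * real (Suc k) ^ 3) * L2_norm u\<^sub>0) + 2 * M * L2_norm (h k (out k))"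
      using t M by (intro add_mono mult_left_mono sumh) (auto simp del: of_nat_Suc)
    finally show ?thesis .
  qed
  \<comment> \<open>The outer cells decrease to the empty set.\<close>
  have tail: "(\<lambda>k. L2_norm (h k (out k))) \<longlonglongrightarrow> 0"
  proof -
    define A where "A k = - {- real (Suc k) ..< real (Suc k)}" for k
    have A: "A k \<in> sets borel" for k by (simp add: A_def)
    have "(\<lambda>k. emeasure (mu u\<^sub>0) (A k)) \<longlonglongrightarrow> emeasure (mu u\<^sub>0) (\<Inter>k. A k)"
      by (rule Lim_emeasure_decseq)
         (use A emeasure_mu[OF u(1) A] in \<open>auto simp: A_def decseq_def\<close>)
    moreover have "(\<Inter>k. A k) = {}"
    proof -
      have "x \<notin> A (nat \<lceil>\<bar>x\<bar>\<rceil>)" for x unfolding A_def by (simp, linarith)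
      then show ?thesis by blast
    qed
    ultimately have "(\<lambda>k. ennreal ((L2_norm (h k (out k)))\<^sup>2)) \<longlonglongrightarrow> 0"
      unfolding h_def out_def cell_outside using emeasure_mu[OF u(1) A] by (simp add: A_def)
    then have "(\<lambda>k. (L2_norm (h k (out k)))\<^sup>2) \<longlonglongrightarrow> 0"
      by (simp only: ennreal_tendsto_0_iff[OF zero_le_power2])
    from tendsto_real_sqrt[OF this] show ?thesis
      by (simp only: real_sqrt_abs abs_of_nonneg[OF L2_norm_nonneg] real_sqrt_zero)
  qed
  have "(\<lambda>k. t * M / (real (Suc k))\<^sup>2 * (sqrt (3 * real (Suc k) ^ 3) * L2_norm u\<^sub>0) + 2 * M * L2_norm (h k (out k))) \<longlonglongrightarrow> 0 + 2 * M * 0"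
  proof (intro tendsto_add tendsto_mult[OF tendsto_const tail])
    show "(\<lambda>k. t * M / (real (Suc k))\<^sup>2 * (sqrt (3 * real (Suc k) ^ 3) * L2_norm u\<^sub>0)) \<longlonglongrightarrow> 0"
    proof -
      have "(\<lambda>k. sqrt (3 * real (Suc k) ^ 3) / (real (Suc k))\<^sup>2) \<longlonglongrightarrow> 0" by real_asymp
      from tendsto_mult_right_zero[OF this, of "t * M * L2_norm u\<^sub>0"]
      show ?thesis by (simp add: mult_ac del: of_nat_Suc)
    qed
  qed
  then have "(\<lambda>k. t * M / (real (Suc k))\<^sup>2 * (sqrt (3 * real (Suc k) ^ 3) * L2_norm u\<^sub>0) + 2 * M * L2_norm (h k (out k))) \<longlonglongrightarrow> 0"
    by (simp only: mult_zero_right add_0)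
  from Lim_null_comparison[OF always_eventually[OF allI[OF err]] this]
  have lim0: "(\<lambda>k. L2_inner (SI (phase t k) u\<^sub>0) (G t) - L2_inner u\<^sub>0 (G 0)) \<longlonglongrightarrow> 0" .
  have "(\<lambda>k. L2_inner (SI (phase t k) u\<^sub>0) (G t)) \<longlonglongrightarrow> L2_inner u (G t)"
    by (intro L2_tendsto_inner unitary_group_tendsto u GL)
  moreover have "(\<lambda>k. L2_inner (SI (phase t k) u\<^sub>0) (G t)) \<longlonglongrightarrow> L2_inner u\<^sub>0 (G 0)"
    by (rule Lim_null[THEN iffD2, OF lim0])
  ultimately show ?thesis by (rule LIMSEQ_unique)
qed

end

section \<open>Translation invariance and integration by parts\<close>

lemma lebesgue_translation:
  fixes a :: "'a::euclidean_space"
  shows "distr lebesgue lebesgue (\<lambda>x. x + a) = lebesgue" "(\<lambda>x. x + a) \<in> lebesgue \<rightarrow>\<^sub>M lebesgue"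
proof -
  have eq: "(\<lambda>x. a + (\<Sum>j\<in>Basis. (1 * (x \<bullet> j)) *\<^sub>R j)) = (\<lambda>x. x + a)"
    by (simp add: euclidean_representation add.commute)
  show "(\<lambda>x. x + a) \<in> lebesgue \<rightarrow>\<^sub>M lebesgue"
    using lebesgue_affine_measurable[of "\<lambda>_. 1" a] unfolding eq by simp
  show "distr lebesgue lebesgue (\<lambda>x. x + a) = lebesgue"
    using lebesgue_affine_euclidean[of "\<lambda>_. 1" a, symmetric] unfolding eq by (simp add: density_1)
qed

lemma integral_translation:
  fixes f :: "'a::euclidean_space \<Rightarrow> 'b::{banach, second_countable_topology}"
  assumes "f \<in> borel_measurable lebesgue"
  shows "(LINT x|lebesgue. f (x + a)) = (LINT x|lebesgue. f x)"
  using integral_distr[OF lebesgue_translation(2) assms, of a] by (simp add: lebesgue_translation)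

lemma integrable_translation:
  fixes f :: "'a::euclidean_space \<Rightarrow> 'b::{banach, second_countable_topology}"
  assumes "integrable lebesgue f"
  shows "integrable lebesgue (\<lambda>x. f (x + a))"
  using integrable_distr_eq[OF lebesgue_translation(2) borel_measurable_integrable[OF assms], of a] assms
  by (simp add: lebesgue_translation)

lemma measurable_translate:
  "f \<in> borel_measurable lebesgue \<Longrightarrow> (\<lambda>x. f (x + a)) \<in> borel_measurable lebesgue"
  by (rule measurable_compose[OF lebesgue_translation(2)])

lemma continuous_measurable_lebesgue:
  fixes f :: "'a::euclidean_space \<Rightarrow> 'b::topological_space"
  shows "continuous_on UNIV f \<Longrightarrow> f \<in> borel_measurable lebesgue"
  using measurable_completion[of f lborel borel] borel_measurable_continuous_onI[of f] by simp

lemma integrable_compact_support: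
  fixes F :: "'a::euclidean_space \<Rightarrow> complex"
  assumes c: "continuous_on UNIV F" and R: "\<And>z. norm z > R \<Longrightarrow> F z = 0"
  shows "integrable lebesgue F"
proof -
  have "integrable lborel (\<lambda>x. indicator (cball 0 R) x *\<^sub>R F x)"
    by (rule borel_integrable_compact) (auto intro: continuous_on_subset[OF c])
  also have "(\<lambda>x. indicator (cball 0 R) x *\<^sub>R F x) = F"
    using R by (auto simp: indicator_def fun_eq_iff not_le)
  finally show ?thesis
    using borel_measurable_continuous_onI[OF c] by (simp add: integrable_completion)
qed

lemma bounded_compact_support:
  fixes F :: "'a::euclidean_space \<Rightarrow> complex"
  assumes c: "continuous_on UNIV F" and R: "\<And>z. norm z > R \<Longrightarrow> F z = 0"
  obtains B where "\<And>z. cmod (F z) \<le> B" "0 \<le> B"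
proof -
  have "compact (F ` cball 0 R)" by (intro compact_continuous_image continuous_on_subset[OF c]) auto
  then obtain B where B: "\<And>y. y \<in> F ` cball 0 R \<Longrightarrow> cmod y \<le> B"
    using compact_imp_bounded bounded_iff by metis
  have "cmod (F z) \<le> max B 0" for z
    using B[of "F z"] R[of z] by (cases "norm z \<le> R") auto
  then show ?thesis using that[of "max B 0"] by auto
qed

lemma has_vector_derivative_iff_quotient:
  fixes f :: "real \<Rightarrow> 'a::real_normed_vector"
  shows "(f has_vector_derivative d) (at x within S) \<longleftrightarrow> ((\<lambda>y. (f y - f x) /\<^sub>R (y - x)) \<longlongrightarrow> d) (at x within S)"
proof -
  have "((\<lambda>y. norm (f y - f x - (y - x) *\<^sub>R d) / norm (y - x)) \<longlongrightarrow> 0) (at x within S)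
      \<longleftrightarrow> ((\<lambda>y. norm ((f y - f x) /\<^sub>R (y - x) - d)) \<longlongrightarrow> 0) (at x within S)"
  proof (rule Lim_cong_within)
    fix y assume "y \<noteq> x"
    then have "(f y - f x) /\<^sub>R (y - x) - d = (f y - f x - (y - x) *\<^sub>R d) /\<^sub>R (y - x)"
      by (simp add: scaleR_right_diff_distrib)
    then show "norm (f y - f x - (y - x) *\<^sub>R d) / norm (y - x) = norm ((f y - f x) /\<^sub>R (y - x) - d)"
      by (simp add: divide_inverse_commute)
  qed auto
  also have "\<dots> \<longleftrightarrow> ((\<lambda>y. (f y - f x) /\<^sub>R (y - x)) \<longlongrightarrow> d) (at x within S)"
    by (simp add: tendsto_norm_zero_iff LIM_zero_iff)
  finally show ?thesis
    by (simp add: has_vector_derivative_def has_derivative_iff_norm bounded_linear_scaleR_left)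
qed

lemma norm_difference_quotient_le:
  fixes f :: "real \<Rightarrow> complex"
  assumes der: "\<And>s. s \<in> S \<Longrightarrow> (f has_vector_derivative f' s) (at s within S)" and "convex S"
    and B: "\<And>s. s \<in> S \<Longrightarrow> cmod (f' s) \<le> B" and xy: "x \<in> S" "y \<in> S"
  shows "cmod ((f y - f x) /\<^sub>R (y - x)) \<le> B"
proof -
  have B0: "0 \<le> B" using order_trans[OF norm_ge_zero B[OF xy(1)]] .
  have "norm (f y - f x) \<le> B * norm (y - x)"
  proof (rule differentiable_bound[OF \<open>convex S\<close>, where f'="\<lambda>s r. r *\<^sub>R f' s"])
    show "(f has_derivative (\<lambda>r. r *\<^sub>R f' s)) (at s within S)" if "s \<in> S" for s
      using der[OF that] by (simp add: has_vector_derivative_def)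
    show "onorm (\<lambda>r. r *\<^sub>R f' s) \<le> B" if "s \<in> S" for s
    proof (rule onorm_bound)
      show "norm (r *\<^sub>R f' s) \<le> B * norm r" for r
        using mult_left_mono[OF B[OF that] norm_ge_zero[of r]] by (simp add: mult.commute)
    qed (rule B0)
  qed (use xy in auto)
  then show ?thesis using B0 by (cases "y = x") (auto simp: divide_simps mult.commute)
qed

text \<open>
  By translation invariance, the difference quotients of \<open>F\<close> in direction \<open>v\<close> have integral
  zero; they converge boundedly, on a fixed ball, to the derivative. This avoids iterated
  integrals over coordinates.
\<close>

lemma integral_derivative_zero:
  fixes F :: "'a::euclidean_space \<Rightarrow> complex"
  assumes der: "\<And>z. (F has_derivative F' z) (at z)"
    and c: "continuous_on UNIV (\<lambda>z. F' z v)"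
    and R: "\<And>z. norm z > R \<Longrightarrow> F z = 0" "\<And>z. norm z > R \<Longrightarrow> F' z v = 0"
  shows "integrable lebesgue (\<lambda>z. F' z v)" "(LINT z|lebesgue. F' z v) = 0"
proof -
  have cF: "continuous_on UNIV F"
    using has_derivative_continuous[OF der] by (auto simp: continuous_on_eq_continuous_at)
  obtain B where B: "\<And>z. cmod (F' z v) \<le> B" "0 \<le> B" using bounded_compact_support[OF c R(2)] by blast
  have int: "integrable lebesgue F" by (rule integrable_compact_support[OF cF R(1)])
  show "integrable lebesgue (\<lambda>z. F' z v)" by (rule integrable_compact_support[OF c R(2)])
  define q where "q n z = (F (z + (1 / real (Suc n)) *\<^sub>R v) - F z) /\<^sub>R (1 / real (Suc n))" for n z
  have line: "((\<lambda>s. F (z + s *\<^sub>R v)) has_vector_derivative F' (z + s *\<^sub>R v) v) (at s within S)" for z s S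
  proof -
    have "((\<lambda>s. z + s *\<^sub>R v) has_derivative (\<lambda>s. s *\<^sub>R v)) (at s within S)"
      by (auto intro!: derivative_eq_intros)
    from has_derivative_compose[OF this der]
    have "((\<lambda>s. F (z + s *\<^sub>R v)) has_derivative (\<lambda>r. F' (z + s *\<^sub>R v) (r *\<^sub>R v))) (at s within S)" .
    moreover have "(\<lambda>r. F' (z + s *\<^sub>R v) (r *\<^sub>R v)) = (\<lambda>r. r *\<^sub>R F' (z + s *\<^sub>R v) v)"
      using has_derivative_linear[OF der] by (simp add: linear_cmul)
    ultimately show ?thesis by (simp add: has_vector_derivative_def)
  qed
  have bound: "cmod (q n z) \<le> B" for n z
    using norm_difference_quotient_le[where f="\<lambda>s. F (z + s *\<^sub>R v)" and S=UNIV and x=0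
      and y="1 / real (Suc n)", OF line convex_UNIV B(1)]
    by (simp add: q_def del: of_nat_Suc)
  have q_support: "q n z = 0" if "norm z > \<bar>R\<bar> + norm v" for n z
  proof -
    have "norm ((1 / real (Suc n)) *\<^sub>R v) \<le> norm v"
      using mult_right_mono[of "1 / real (Suc n)" 1 "norm v"] by simp
    then have "norm (z + (1 / real (Suc n)) *\<^sub>R v) > R"
      using norm_diff_ineq[of z "(1 / real (Suc n)) *\<^sub>R v"] that by linarith
    moreover have "norm z > R" using that norm_ge_zero[of v] by linarith
    ultimately show ?thesis by (simp add: q_def R)
  qed
  define S where "S = cball (0::'a) (\<bar>R\<bar> + norm v)"
  have "(\<lambda>n. LINT z|lebesgue. q n z) \<longlonglongrightarrow> (LINT z|lebesgue. F' z v)"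
  proof (rule integral_dominated_convergence[where w="\<lambda>z. B * indicator S z"])
    show "(\<lambda>z. F' z v) \<in> borel_measurable lebesgue" by (rule continuous_measurable_lebesgue[OF c])
    show "q n \<in> borel_measurable lebesgue" for n
      unfolding q_def[abs_def]
      by (intro continuous_measurable_lebesgue continuous_intros continuous_on_compose2[OF cF]) auto
    have "integrable lebesgue (indicator S :: 'a \<Rightarrow> real)"
      using emeasure_lborel_cball_finite[of "0::'a" "\<bar>R\<bar> + norm v"] by (simp add: integrable_indicator_iff S_def)
    then show "integrable lebesgue (\<lambda>z. B * indicator S z)" by (intro integrable_mult_right)
    show "AE z in lebesgue. (\<lambda>n. q n z) \<longlonglongrightarrow> F' z v"
    proof (rule AE_I2)
      fix z
      have "((\<lambda>s. F (z + s *\<^sub>R v)) has_vector_derivative F' z v) (at 0)" using line[of z 0 UNIV] by simp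
      then have *: "((\<lambda>y. (F (z + y *\<^sub>R v) - F z) /\<^sub>R y) \<longlongrightarrow> F' z v) (at 0)"
        by (simp add: has_vector_derivative_iff_quotient)
      show "(\<lambda>n. q n z) \<longlonglongrightarrow> F' z v"
        unfolding q_def
        by (rule filterlim_compose[OF *]) (auto simp: filterlim_at intro: lim_inverse_n'[THEN LIMSEQ_Suc] simp del: of_nat_Suc)
    qed
    show "AE z in lebesgue. norm (q n z) \<le> B * indicator S z" for n
      using bound q_support by (intro AE_I2) (auto simp: indicator_def not_le S_def)
  qed
  moreover have "(LINT z|lebesgue. q n z) = 0" for n
    unfolding q_def using int integrable_translation[OF int]
    by (simp add: integral_translation[OF borel_measurable_integrable[OF int]] del: of_real_divide)
  ultimately show "(LINT z|lebesgue. F' z v) = 0" by (simp add: LIMSEQ_const_iff)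
qed

lemma dir_deriv_eq: "(f has_derivative f') (at z) \<Longrightarrow> dir_deriv v f z = f' v"
  unfolding dir_deriv_def using frechet_derivative_at by metis

lemma test_function_derivatives:
  assumes "\<phi> \<in> test_functions"
  shows "\<phi> differentiable (at z)" "dir_deriv v \<phi> differentiable (at z)"
    "dir_deriv v (dir_deriv v' \<phi>) differentiable (at z)"
proof -
  have "foldr dir_deriv vs \<phi> differentiable (at z)" for vs
    using assms by (auto simp: test_functions_def smooth_def)
  from this[of "[]"] this[of "[v]"] this[of "[v, v']"]
  show "\<phi> differentiable (at z)" "dir_deriv v \<phi> differentiable (at z)"
    "dir_deriv v (dir_deriv v' \<phi>) differentiable (at z)" by auto
qed

lemma differentiable_dir_deriv:
  "f differentiable (at z) \<Longrightarrow> (f has_derivative (\<lambda>v. dir_deriv v f z)) (at z)"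
  unfolding dir_deriv_def by (simp add: frechet_derivative_works)

lemma differentiable_continuous_UNIV:
  "(\<And>z. f differentiable (at z)) \<Longrightarrow> continuous_on UNIV f"
  by (auto simp: continuous_on_eq_continuous_at differentiable_imp_continuous_within)

lemma test_function_support:
  assumes "\<phi> \<in> test_functions"
  obtains R where "\<And>z. norm z > R \<Longrightarrow> \<phi> z = 0"
proof -
  have "bounded (closure {z. \<phi> z \<noteq> 0})"
    using assms by (auto simp: test_functions_def compact_imp_bounded)
  then obtain R where "\<And>z. z \<in> closure {z. \<phi> z \<noteq> 0} \<Longrightarrow> norm z \<le> R" by (auto simp: bounded_iff)
  then have "\<phi> z = 0" if "norm z > R" for z using that closure_subset[of "{z. \<phi> z \<noteq> 0}"] by force
  then show thesis using that by blast
qed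

lemma dir_deriv_support:
  assumes f: "\<And>z. norm z > R \<Longrightarrow> f z = 0" and z: "norm (z::'a::euclidean_space) > R"
  shows "dir_deriv v f z = 0"
proof -
  have "open {z::'a. norm z > R}" by (intro open_Collect_less continuous_intros)
  have "((\<lambda>z. 0) has_derivative (\<lambda>v. 0)) (at z)" by (rule has_derivative_const)
  then have "(f has_derivative (\<lambda>v. 0)) (at z)"
    by (rule has_derivative_transform_within_open[OF _ \<open>open {z. norm z > R}\<close>]) (use f z in auto)
  then show ?thesis by (simp add: dir_deriv_eq)
qed

lemma has_derivative_cexp:
  fixes f :: "'a::real_normed_vector \<Rightarrow> complex"
  assumes "(f has_derivative f') (at x within S)"
  shows "((\<lambda>x. exp (f x)) has_derivative (\<lambda>h. exp (f x) * f' h)) (at x within S)"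
  using has_derivative_compose[OF assms, of exp "\<lambda>h. exp (f x) * h"] DERIV_exp[of "f x"]
  by (simp add: has_field_derivative_def)

section \<open>Gaussians and the special Hermite operator\<close>

text \<open>
  The standard symplectic form: the imaginary part of the Hermitian product of \<open>z\<close> and \<open>w\<close>.
\<close>

definition symplectic :: "complex^'d::finite \<Rightarrow> complex^'d \<Rightarrow> real" where
  "symplectic z w = (\<Sum>j\<in>UNIV. Im (z $ j) * Re (w $ j) - Re (z $ j) * Im (w $ j))"

lemma bounded_linear_symplectic: "bounded_linear (\<lambda>z. symplectic z w)"
  unfolding symplectic_def
  by (intro bounded_linear_sum bounded_linear_sub bounded_linear_mult_const
      bounded_linear_compose[OF bounded_linear_Im] bounded_linear_compose[OF bounded_linear_Re] bounded_linear_vec_nth)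

lemma symplectic_antisym: "symplectic w z = - symplectic z w"
  unfolding symplectic_def by (simp add: sum_negf[symmetric] mult.commute)

lemma symplectic_axis_1 [simp]: "symplectic (axis j 1) w = - Im (w $ j)"
  by (simp add: symplectic_def axis_def if_distrib[of Im] if_distrib[of Re] sum_subtractf sum_negf
      if_distrib[of "\<lambda>x. x * _"] cong: if_cong)

lemma symplectic_axis_i [simp]: "symplectic (axis j \<i>) w = Re (w $ j)"
  by (simp add: symplectic_def axis_def if_distrib[of Im] if_distrib[of Re] sum_subtractf sum_negf
      if_distrib[of "\<lambda>x. x * _"] cong: if_cong)

text \<open>
  A Gaussian of complex width centred at \<open>w\<close> and twisted by a symplectic phase. With \<open>k = \<lambda> / 2\<close>
  this is the twisted translate by \<open>w\<close> of a centred Gaussian. The special Hermite operator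
  commutes with such translates, and on centred radial functions its first-order part vanishes.
\<close>

definition gaussian :: "complex \<Rightarrow> real \<Rightarrow> complex^'d::finite \<Rightarrow> complex^'d \<Rightarrow> complex" where
  "gaussian b k w z = exp (- (b * complex_of_real ((z - w) \<bullet> (z - w))) - \<i> * complex_of_real (k * symplectic z w))"

definition gaussian_log_deriv :: "complex \<Rightarrow> real \<Rightarrow> complex^'d::finite \<Rightarrow> complex^'d \<Rightarrow> complex^'d \<Rightarrow> complex" where
  "gaussian_log_deriv b k w z v = - (2 * b * complex_of_real ((z - w) \<bullet> v)) - \<i> * complex_of_real (k * symplectic v w)"

lemma gaussian_has_derivative:
  "(gaussian b k w has_derivative (\<lambda>v. gaussian_log_deriv b k w z v * gaussian b k w z)) (at z)"
proof -
  have h1: "((\<lambda>z. (z - w) \<bullet> (z - w)) has_derivative (\<lambda>v. (z - w) \<bullet> v + v \<bullet> (z - w))) (at z)"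
    by (rule has_derivative_inner) (auto intro!: derivative_eq_intros)
  have h2: "((\<lambda>z. k * symplectic z w) has_derivative (\<lambda>v. k * symplectic v w)) (at z)"
    by (rule has_derivative_mult_right[OF bounded_linear.has_derivative[OF bounded_linear_symplectic has_derivative_ident]])
  have "((\<lambda>z. - (b * complex_of_real ((z - w) \<bullet> (z - w))) - \<i> * complex_of_real (k * symplectic z w)) has_derivative
      (\<lambda>v. - (b * complex_of_real ((z - w) \<bullet> v + v \<bullet> (z - w))) - \<i> * complex_of_real (k * symplectic v w))) (at z)"
    by (rule has_derivative_diff[OF has_derivative_minus[OF has_derivative_mult_right[OF has_derivative_of_real[OF h1], of b]]
        has_derivative_mult_right[OF has_derivative_of_real[OF h2], of \<i>]])
  from has_derivative_cexp[OF this] show ?thesis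
    unfolding gaussian_def[abs_def] gaussian_log_deriv_def
    by (rule has_derivative_eq_rhs) (simp add: inner_commute fun_eq_iff)
qed

lemma gaussian_log_deriv_has_derivative:
  "((\<lambda>z. gaussian_log_deriv b k w z v) has_derivative (\<lambda>u. - (2 * b * complex_of_real (u \<bullet> v)))) (at z)"
proof -
  have "((\<lambda>z. (z - w) \<bullet> v) has_derivative (\<lambda>u. u \<bullet> v)) (at z)"
    by (rule bounded_linear.has_derivative[OF bounded_linear_inner_left]) (auto intro!: derivative_eq_intros)
  then have "((\<lambda>z. - (2 * b * complex_of_real ((z - w) \<bullet> v)) - \<i> * complex_of_real (k * symplectic v w)) has_derivative
      (\<lambda>u. - (2 * b * complex_of_real (u \<bullet> v)) - 0)) (at z)"
    by (intro has_derivative_diff has_derivative_minus has_derivative_mult_right has_derivative_of_real has_derivative_const)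
  then show ?thesis unfolding gaussian_log_deriv_def by simp
qed

text \<open>
  The product is compactly supported through \<open>\<phi>\<close> alone, so \<open>g\<close> may be a Gaussian or a Gaussian
  times a polynomial. The two terms stay under one integral, which spares separate integrability
  proofs.
\<close>

lemma integration_by_parts:
  fixes \<phi> g :: "'a::euclidean_space \<Rightarrow> complex"
  assumes \<phi>: "\<And>z. \<phi> differentiable (at z)" "continuous_on UNIV (dir_deriv v \<phi>)"
    and g: "\<And>z. (g has_derivative g' z) (at z)" "continuous_on UNIV (\<lambda>z. g' z v)"
    and R: "\<And>z. norm z > R \<Longrightarrow> \<phi> z = 0"
  shows "integrable lebesgue (\<lambda>z. dir_deriv v \<phi> z * g z + \<phi> z * g' z v)"
    "(LINT z|lebesgue. dir_deriv v \<phi> z * g z + \<phi> z * g' z v) = 0"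
proof -
  have der: "((\<lambda>z. \<phi> z * g z) has_derivative (\<lambda>v. dir_deriv v \<phi> z * g z + \<phi> z * g' z v)) (at z)" for z
    using has_derivative_mult[OF differentiable_dir_deriv[OF \<phi>(1)] g(1)] by (simp add: add.commute)
  have "continuous_on UNIV g" using has_derivative_continuous[OF g(1)] by (auto simp: continuous_on_eq_continuous_at)
  then have c: "continuous_on UNIV (\<lambda>z. dir_deriv v \<phi> z * g z + \<phi> z * g' z v)"
    by (intro continuous_intros \<phi> g differentiable_continuous_UNIV[of \<phi>])
  show "integrable lebesgue (\<lambda>z. dir_deriv v \<phi> z * g z + \<phi> z * g' z v)"
    "(LINT z|lebesgue. dir_deriv v \<phi> z * g z + \<phi> z * g' z v) = 0"
    using integral_derivative_zero[OF der c, of R] R dir_deriv_support[of R \<phi>, OF R] by simp_all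
qed

lemma has_derivative_continuous_UNIV:
  "(\<And>z. (f has_derivative f' z) (at z)) \<Longrightarrow> continuous_on UNIV f"
  unfolding continuous_on_eq_continuous_at[OF open_UNIV] by (metis has_derivative_continuous)

lemma gaussian_log_deriv_continuous: "continuous_on UNIV (\<lambda>z. gaussian_log_deriv b k w z v)"
  by (rule has_derivative_continuous_UNIV[OF gaussian_log_deriv_has_derivative])

lemma gaussian_continuous: "continuous_on UNIV (gaussian b k w)"
  by (rule has_derivative_continuous_UNIV[OF gaussian_has_derivative])

lemma test_function_continuous:
  assumes "\<phi> \<in> test_functions"
  shows "continuous_on UNIV \<phi>" "continuous_on UNIV (dir_deriv v \<phi>)" "continuous_on UNIV (dir_deriv v (dir_deriv v' \<phi>))"
  using test_function_derivatives[OF assms] by (auto intro!: differentiable_continuous_UNIV)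

text \<open>
  The special Hermite operator multiplies a Gaussian by a quadratic function of \<open>z - w\<close>. This is
  that computation in one complex coordinate, for \<open>- \<lambda>\<close> in place of \<open>\<lambda>\<close> as integration by parts
  requires: \<open>x, y\<close> are the components of \<open>z\<close>, \<open>u, v\<close> those of \<open>w\<close>, and the parenthesised
  expressions are the logarithmic derivatives of the Gaussian. The terms linear in \<open>z - w\<close>
  cancel because the twist is matched to the operator by \<open>\<kappa> = \<lambda> / 2\<close>.
\<close>

lemma hermite_gaussian_identity:
  fixes I b \<kappa> x y u v :: complex
  assumes "I * I = - 1"
  shows "\<kappa>\<^sup>2 * (x\<^sup>2 + y\<^sup>2) - ((- (2 * b * (x - u)) - I * (\<kappa> * v))\<^sup>2 + (- (2 * b * (y - v)) + I * (\<kappa> * u))\<^sup>2 - 4 * b)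
      + 2 * I * \<kappa> * (x * (- (2 * b * (y - v)) + I * (\<kappa> * u)) - y * (- (2 * b * (x - u)) - I * (\<kappa> * v)))
    = (\<kappa>\<^sup>2 - 4 * b\<^sup>2) * ((x - u)\<^sup>2 + (y - v)\<^sup>2) + 4 * b"
  using assms by algebra

lemma norm_square_components:
  fixes z :: "complex^'d::finite"
  shows "z \<bullet> z = (\<Sum>j\<in>UNIV. (Re (z $ j))\<^sup>2 + (Im (z $ j))\<^sup>2)"
  by (simp add: inner_vec_def inner_complex_def power2_eq_square)

text \<open>
  The multiplier by which the special Hermite operator acts on \<open>gaussian b (lam / 2) w\<close>.
\<close>

definition hermite_factor :: "real \<Rightarrow> complex \<Rightarrow> complex^'d::finite \<Rightarrow> complex^'d \<Rightarrow> complex" where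
  "hermite_factor lam b w z = (complex_of_real (lam\<^sup>2 / 4) - 4 * b\<^sup>2) * complex_of_real ((z - w) \<bullet> (z - w)) + 4 * b * of_nat CARD('d)"

text \<open>
  All derivatives are moved from the test function to the Gaussian. In this bilinear pairing the
  first-order term changes sign, which amounts to replacing \<open>\<lambda>\<close> by \<open>-\<lambda>\<close>; hence the phase
  \<open>- \<lambda> / 2\<close>.
\<close>

lemma special_hermite_parts:
  fixes \<phi> :: "complex^'d::finite \<Rightarrow> complex"
  assumes \<phi>: "\<phi> \<in> test_functions"
  shows "(LINT z|lebesgue. special_hermite lam \<phi> z * gaussian b (- (lam / 2)) w z)
       = (LINT z|lebesgue. \<phi> z * (hermite_factor lam b w z * gaussian b (- (lam / 2)) w z))"
proof -
  define g where "g = gaussian b (- (lam / 2)) w"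
  define l where "l = (\<lambda>v z. gaussian_log_deriv b (- (lam / 2)) w z v)"
  obtain R where R: "\<And>z. norm z > R \<Longrightarrow> \<phi> z = 0" using test_function_support[OF \<phi>] by blast
  note dphi = test_function_derivatives[OF \<phi>] and cphi = test_function_continuous[OF \<phi>]
  have R1: "dir_deriv v \<phi> z = 0" if "norm z > R" for v z by (rule dir_deriv_support[OF R that])
  have g: "(g has_derivative (\<lambda>v. l v z * g z)) (at z)" for z
    unfolding g_def l_def by (rule gaussian_has_derivative)
  have l: "(l v has_derivative (\<lambda>u. - (2 * b * complex_of_real (u \<bullet> v)))) (at z)" for v z
    unfolding l_def by (rule gaussian_log_deriv_has_derivative)
  have cg: "continuous_on UNIV g" unfolding g_def by (rule gaussian_continuous)
  have cl: "continuous_on UNIV (l v)" for v unfolding l_def by (rule gaussian_log_deriv_continuous)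
  \<comment> \<open>The difference of the two sides is a combination \<open>S\<close> of exact derivatives: \<open>I1\<close> and \<open>I2\<close>
      move the two derivatives of the Laplacian one after the other, \<open>I3\<close> moves the derivative of
      the angular term.\<close>
  define I1 where "I1 = (\<lambda>v z. dir_deriv v (dir_deriv v \<phi>) z * g z + dir_deriv v \<phi> z * (l v z * g z))"
  define I2 where "I2 = (\<lambda>v z. dir_deriv v \<phi> z * (l v z * g z) + \<phi> z * (l v z * (l v z * g z) + - (2 * b * complex_of_real (v \<bullet> v)) * g z))"
  have I1: "integrable lebesgue (I1 v)" "(LINT z|lebesgue. I1 v z) = 0" for v
    unfolding I1_def
    using integration_by_parts[OF dphi(2) cphi(3) g continuous_on_mult[OF cl cg] R1] by auto
  have I2: "integrable lebesgue (I2 v)" "(LINT z|lebesgue. I2 v z) = 0" for v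
  proof -
    have d: "((\<lambda>z. l v z * g z) has_derivative (\<lambda>u. l v z * (l u z * g z) + - (2 * b * complex_of_real (u \<bullet> v)) * g z)) (at z)" for z
      by (rule has_derivative_mult[OF l g])
    have c: "continuous_on UNIV (\<lambda>z. l v z * (l v z * g z) + - (2 * b * complex_of_real (v \<bullet> v)) * g z)"
      by (intro continuous_intros cl cg)
    show "integrable lebesgue (I2 v)" "(LINT z|lebesgue. I2 v z) = 0"
      unfolding I2_def using integration_by_parts[OF dphi(1) cphi(2) d c R] by auto
  qed
  define I3 where "I3 = (\<lambda>r v z. dir_deriv v \<phi> z * (complex_of_real (r z) * g z) + \<phi> z * (complex_of_real (r z) * (l v z * g z) + complex_of_real (r v) * g z))"
  have I3: "integrable lebesgue (I3 r v)" "(LINT z|lebesgue. I3 r v z) = 0" if r: "bounded_linear r" for r v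
  proof -
    have d: "((\<lambda>z. complex_of_real (r z) * g z) has_derivative (\<lambda>u. complex_of_real (r z) * (l u z * g z) + complex_of_real (r u) * g z)) (at z)" for z
      by (rule has_derivative_mult[OF has_derivative_of_real[OF bounded_linear.has_derivative[OF r has_derivative_ident]] g])
    have c: "continuous_on UNIV (\<lambda>z. complex_of_real (r z) * (l v z * g z) + complex_of_real (r v) * g z)"
      by (intro continuous_intros cl cg linear_continuous_on r)
    show "integrable lebesgue (I3 r v)" "(LINT z|lebesgue. I3 r v z) = 0"
      unfolding I3_def using integration_by_parts[OF dphi(1) cphi(2) d c R] by auto
  qed
  define X Y where "X = (\<lambda>j (z::complex^'d). Re (z $ j))" and "Y = (\<lambda>j (z::complex^'d). Im (z $ j))"
  have XY: "bounded_linear (X j)" "bounded_linear (Y j)" for j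
    unfolding X_def Y_def
    by (intro bounded_linear_compose[OF bounded_linear_Re] bounded_linear_compose[OF bounded_linear_Im] bounded_linear_vec_nth)+
  define S where "S = (\<lambda>j z. - (I1 (axis j 1) z - I2 (axis j 1) z) - (I1 (axis j \<i>) z - I2 (axis j \<i>) z)
      - \<i> * complex_of_real lam * (I3 (X j) (axis j \<i>) z - I3 (Y j) (axis j 1) z))"
  have S: "integrable lebesgue (S j)" "(LINT z|lebesgue. S j z) = 0" for j
    unfolding S_def using I1 I2 I3[OF XY(1)] I3[OF XY(2)] by auto
  have pt: "special_hermite lam \<phi> z * g z - \<phi> z * (hermite_factor lam b w z * g z) = (\<Sum>j\<in>UNIV. S j z)" for z
  proof -
    have "special_hermite lam \<phi> z * g z - \<phi> z * (hermite_factor lam b w z * g z)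
      = (\<Sum>j\<in>UNIV. (- (D_x j (D_x j \<phi>) z + D_y j (D_y j \<phi>) z) + complex_of_real (lam\<^sup>2 / 4 * ((Re (z $ j))\<^sup>2 + (Im (z $ j))\<^sup>2)) * \<phi> z
          - \<i> * complex_of_real lam * (complex_of_real (Re (z $ j)) * D_y j \<phi> z - complex_of_real (Im (z $ j)) * D_x j \<phi> z)) * g z
          - \<phi> z * (((complex_of_real (lam\<^sup>2 / 4) - 4 * b\<^sup>2) * complex_of_real ((Re ((z - w) $ j))\<^sup>2 + (Im ((z - w) $ j))\<^sup>2) + 4 * b) * g z))"
      unfolding special_hermite_def laplacian_def hermite_factor_def norm_square_components power2_norm_eq_inner
      by (simp add: sum.distrib sum_subtractf sum_distrib_left sum_distrib_right sum_negf algebra_simps)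
    also have "\<dots> = (\<Sum>j\<in>UNIV. S j z)"
    proof (rule sum.cong[OF refl])
      fix j :: 'd
      define x y u v \<kappa> where "x = complex_of_real (Re (z $ j))" and "y = complex_of_real (Im (z $ j))"
        and "u = complex_of_real (Re (w $ j))" and "v = complex_of_real (Im (w $ j))" and "\<kappa> = complex_of_real (lam / 2)"
      have lx: "l (axis j 1) z = - (2 * b * (x - u)) - \<i> * (\<kappa> * v)"
        by (simp add: l_def gaussian_log_deriv_def x_def u_def v_def \<kappa>_def inner_axis inner_complex_def)
      have ly: "l (axis j \<i>) z = - (2 * b * (y - v)) + \<i> * (\<kappa> * u)"
        by (simp add: l_def gaussian_log_deriv_def y_def u_def v_def \<kappa>_def inner_axis inner_complex_def)
      have ax: "axis j (1::complex) \<bullet> axis j 1 = 1" "axis j \<i> \<bullet> axis j \<i> = 1"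
        by (simp_all add: inner_axis_axis inner_complex_def)
      have XYa: "X j (axis j \<i>) = 0" "Y j (axis j 1) = 0" "X j z = Re (z $ j)" "Y j z = Im (z $ j)" by (simp_all add: X_def Y_def axis_def)
      define p q where "p = - (2 * b * (x - u)) - \<i> * (\<kappa> * v)" and "q = - (2 * b * (y - v)) + \<i> * (\<kappa> * u)"
      have id: "\<kappa>\<^sup>2 * (x\<^sup>2 + y\<^sup>2) - (p\<^sup>2 + q\<^sup>2 - 4 * b) + 2 * \<i> * \<kappa> * (x * q - y * p) = (\<kappa>\<^sup>2 - 4 * b\<^sup>2) * ((x - u)\<^sup>2 + (y - v)\<^sup>2) + 4 * b"
        unfolding p_def q_def by (rule hermite_gaussian_identity) simp
      have lk: "complex_of_real (lam\<^sup>2 / 4) = \<kappa>\<^sup>2" "complex_of_real lam = 2 * \<kappa>" by (simp_all add: \<kappa>_def power2_eq_square)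
      have "(- (a1 + a2) + \<kappa>\<^sup>2 * (x\<^sup>2 + y\<^sup>2) * f - \<i> * (2 * \<kappa>) * (x * dy - y * dx)) * G
            - f * (((\<kappa>\<^sup>2 - 4 * b\<^sup>2) * ((x - u)\<^sup>2 + (y - v)\<^sup>2) + 4 * b) * G)
          = - ((a1 * G + dx * (p * G)) - (dx * (p * G) + f * (p * (p * G) + - (2 * b * 1) * G)))
            - ((a2 * G + dy * (q * G)) - (dy * (q * G) + f * (q * (q * G) + - (2 * b * 1) * G)))
            - \<i> * (2 * \<kappa>) * ((dy * (x * G) + f * (x * (q * G) + 0 * G)) - (dx * (y * G) + f * (y * (p * G) + 0 * G)))"
        for a1 a2 f dx dy G
        unfolding id[symmetric] by (simp add: algebra_simps power2_eq_square)
      from this[of "D_x j (D_x j \<phi>) z" "D_y j (D_y j \<phi>) z" "\<phi> z" "D_y j \<phi> z" "D_x j \<phi> z" "g z"]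
      show "(- (D_x j (D_x j \<phi>) z + D_y j (D_y j \<phi>) z) + complex_of_real (lam\<^sup>2 / 4 * ((Re (z $ j))\<^sup>2 + (Im (z $ j))\<^sup>2)) * \<phi> z
          - \<i> * complex_of_real lam * (complex_of_real (Re (z $ j)) * D_y j \<phi> z - complex_of_real (Im (z $ j)) * D_x j \<phi> z)) * g z
          - \<phi> z * (((complex_of_real (lam\<^sup>2 / 4) - 4 * b\<^sup>2) * complex_of_real ((Re ((z - w) $ j))\<^sup>2 + (Im ((z - w) $ j))\<^sup>2) + 4 * b) * g z) = S j z"
        unfolding S_def I1_def I2_def I3_def lx ly ax XYa p_def[symmetric] q_def[symmetric] of_real_mult lk
        by (simp add: x_def y_def u_def v_def)
    qed
    finally show ?thesis .
  qed
  have zero: "(LINT z|lebesgue. special_hermite lam \<phi> z * g z - \<phi> z * (hermite_factor lam b w z * g z)) = 0"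
    unfolding pt using S by simp
  have c1: "continuous_on UNIV (\<lambda>z. special_hermite lam \<phi> z * g z)"
    unfolding special_hermite_def laplacian_def
    by (intro continuous_intros cphi cg linear_continuous_on XY[unfolded X_def] XY[unfolded Y_def])
  have c2: "continuous_on UNIV (\<lambda>z. \<phi> z * (hermite_factor lam b w z * g z))"
    unfolding hermite_factor_def by (intro continuous_intros cphi cg)
  have "special_hermite lam \<phi> z * g z = 0" if "norm z > R" for z
    using R[OF that] R1[OF that] dir_deriv_support[OF R1 that]
    by (simp add: special_hermite_def laplacian_def)
  then have "integrable lebesgue (\<lambda>z. special_hermite lam \<phi> z * g z)" by (rule integrable_compact_support[OF c1])
  moreover have "integrable lebesgue (\<lambda>z. \<phi> z * (hermite_factor lam b w z * g z))"
    by (rule integrable_compact_support[OF c2, of R]) (simp add: R)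
  ultimately show ?thesis using zero by (simp add: g_def)
qed

lemma cnj_gaussian: "cnj (gaussian b k w z) = gaussian (cnj b) (- k) w z"
  by (simp add: gaussian_def exp_cnj)

lemma cnj_hermite_factor: "cnj (hermite_factor lam b w z) = hermite_factor lam (cnj b) w z"
  by (simp add: hermite_factor_def)

text \<open>
  The closure is approached through test functions, so the integrations by parts carry over by
  continuity of the inner product in each slot.
\<close>

lemma closure_pairing:
  assumes hw: "(h, v) \<in> special_hermite_closure lam"
    and G: "(\<lambda>z. a * gaussian b (lam / 2) w z) \<in> L2" "(\<lambda>z. hermite_factor lam b w z * (a * gaussian b (lam / 2) w z)) \<in> L2"
  shows "L2_inner v (\<lambda>z. a * gaussian b (lam / 2) w z)
       = L2_inner h (\<lambda>z. hermite_factor lam b w z * (a * gaussian b (lam / 2) w z))"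
proof -
  obtain \<phi> where \<phi>: "\<And>n. \<phi> n \<in> test_functions" "L2_tendsto \<phi> h" "L2_tendsto (\<lambda>n. special_hermite lam (\<phi> n)) v"
    using hw unfolding special_hermite_closure_def by auto
  have "L2_inner (special_hermite lam (\<phi> n)) (\<lambda>z. a * gaussian b (lam / 2) w z)
      = L2_inner (\<phi> n) (\<lambda>z. hermite_factor lam b w z * (a * gaussian b (lam / 2) w z))" for n
  proof -
    have "L2_inner (special_hermite lam (\<phi> n)) (\<lambda>z. a * gaussian b (lam / 2) w z)
        = cnj a * (LINT z|lebesgue. special_hermite lam (\<phi> n) z * gaussian (cnj b) (- (lam / 2)) w z)"
      unfolding L2_inner_def by (subst integral_mult_right_zero[symmetric]) (simp add: cnj_gaussian mult_ac)
    also have "\<dots> = cnj a * (LINT z|lebesgue. \<phi> n z * (hermite_factor lam (cnj b) w z * gaussian (cnj b) (- (lam / 2)) w z))"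
      unfolding special_hermite_parts[OF \<phi>(1)] ..
    also have "\<dots> = L2_inner (\<phi> n) (\<lambda>z. hermite_factor lam b w z * (a * gaussian b (lam / 2) w z))"
      unfolding L2_inner_def by (subst integral_mult_right_zero[symmetric]) (simp add: cnj_gaussian cnj_hermite_factor mult_ac)
    finally show ?thesis .
  qed
  then show ?thesis
    using LIMSEQ_unique[OF L2_tendsto_inner[OF \<phi>(3) G(1)]] L2_tendsto_inner[OF \<phi>(2) G(2)] by simp
qed

section \<open>Heat kernels at complex time\<close>

text \<open>
  The normal density, up to normalisation.
\<close>

lemma integrable_gaussian_1d:
  assumes "0 < m" shows "integrable lborel (\<lambda>x::real. exp (- (m * (x - c)\<^sup>2)))"
proof -
  define s where "s = 1 / sqrt (2 * m)"
  have s: "s > 0" "2 * s\<^sup>2 = 1 / m" using assms by (simp_all add: s_def power_divide)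
  have "integrable lborel (\<lambda>x. sqrt (2 * pi * s\<^sup>2) * normal_density c s x)"
    using integrable_normal_density[OF s(1)] by (rule integrable_mult_right)
  also have "(\<lambda>x. sqrt (2 * pi * s\<^sup>2) * normal_density c s x) = (\<lambda>x. exp (- (m * (x - c)\<^sup>2)))"
    using s assms by (simp add: normal_density_def fun_eq_iff field_simps)
  finally show ?thesis .
qed

lemma integrable_gaussian:
  fixes w :: "'a::euclidean_space"
  assumes m: "0 < m" shows "integrable lebesgue (\<lambda>z. exp (- (m * ((z - w) \<bullet> (z - w)))))"
proof -
  have meas: "(\<lambda>z::'a. exp (- (m * ((z - w) \<bullet> (z - w))))) \<in> borel_measurable borel"
    by (intro borel_measurable_continuous_onI continuous_intros)
  interpret product_sigma_finite "\<lambda>b::'a. lborel :: real measure" by standard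
  have "integrable (\<Pi>\<^sub>M b\<in>Basis. (lborel :: real measure)) (\<lambda>f. \<Prod>b\<in>(Basis::'a set). exp (- (m * (f b - w \<bullet> b)\<^sup>2)))"
    by (rule product_integrable_prod) (auto intro: integrable_gaussian_1d m)
  moreover have "(\<Prod>b\<in>(Basis::'a set). exp (- (m * (f b - w \<bullet> b)\<^sup>2)))
      = exp (- (m * (((\<Sum>b\<in>Basis. f b *\<^sub>R b) - w) \<bullet> ((\<Sum>b\<in>Basis. f b *\<^sub>R b) - w))))" for f
  proof -
    have "((\<Sum>b\<in>Basis. f b *\<^sub>R b) - w) \<bullet> ((\<Sum>b\<in>Basis. f b *\<^sub>R b) - w) = (\<Sum>b\<in>(Basis::'a set). (f b - w \<bullet> b)\<^sup>2)"
      by (subst euclidean_inner) (simp add: inner_diff_left inner_sum_left inner_Basis power2_eq_square if_distrib cong: if_cong)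
    then show ?thesis by (simp add: exp_sum[symmetric] sum_negf sum_distrib_left)
  qed
  moreover have "(\<lambda>f. \<Sum>b\<in>(Basis::'a set). f b *\<^sub>R b) \<in> (\<Pi>\<^sub>M b\<in>Basis. (lborel :: real measure)) \<rightarrow>\<^sub>M borel"
    by measurable
  ultimately have "integrable (distr (\<Pi>\<^sub>M b\<in>Basis. (lborel :: real measure)) borel (\<lambda>f. \<Sum>b\<in>(Basis::'a set). f b *\<^sub>R b)) (\<lambda>z. exp (- (m * ((z - w) \<bullet> (z - w)))))"
    using meas by (subst integrable_distr_eq) auto
  then have "integrable lborel (\<lambda>z::'a. exp (- (m * ((z - w) \<bullet> (z - w)))))"
    by (simp add: lborel_def[where 'a='a] lborel_eq_real)
  then show ?thesis using meas by (simp add: integrable_completion)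
qed

lemma gaussian_L2:
  fixes w :: "'a::euclidean_space"
  assumes m: "0 < m" shows "(\<lambda>z. complex_of_real (C * exp (- (m * ((z - w) \<bullet> (z - w)))))) \<in> L2"
proof -
  have c: "continuous_on UNIV (\<lambda>z::'a. complex_of_real (C * exp (- (m * ((z - w) \<bullet> (z - w))))))"
    by (intro continuous_intros)
  have "(cmod (complex_of_real (C * exp (- (m * ((z - w) \<bullet> (z - w)))))))\<^sup>2 = C\<^sup>2 * exp (- (2 * m * ((z - w) \<bullet> (z - w))))" for z
    by (simp only: norm_of_real power2_abs power_mult_distrib) (simp add: exp_double[symmetric] mult.assoc)
  then show ?thesis using continuous_measurable_lebesgue[OF c] integrable_gaussian[of "2 * m" w] m
    unfolding L2_def by simp
qed

text \<open>
  Half of the exponential decay absorbs the polynomial factor, through \<open>x \<le> exp x\<close>.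
\<close>

lemma gaussian_polynomial_bound:
  fixes r m :: real
  assumes "0 < m" "0 \<le> r" shows "(1 + r) * exp (- (m * r)) \<le> (1 + 2 / m) * exp (- (m / 2 * r))"
proof -
  have "m / 2 * r \<le> exp (m / 2 * r)" using exp_ge_add_one_self[of "m / 2 * r"] by linarith
  then have "r * exp (- (m / 2 * r)) \<le> 2 / m"
    using assms by (simp add: exp_minus field_simps)
  moreover have "exp (- (m / 2 * r)) \<le> 1" using assms by simp
  ultimately have "(1 + r) * exp (- (m / 2 * r)) \<le> 1 + 2 / m" unfolding distrib_right mult_1_left by linarith
  then have "(1 + r) * exp (- (m / 2 * r)) * exp (- (m / 2 * r)) \<le> (1 + 2 / m) * exp (- (m / 2 * r))"
    by (rule mult_right_mono) simp
  moreover have "exp (- (m / 2 * r)) * exp (- (m / 2 * r)) = exp (- (m * r))"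
    by (simp add: exp_add[symmetric])
  ultimately show ?thesis by (simp only: mult.assoc)
qed

text \<open>
  Differentiation under the integral sign. The derivative bound by \<open>D\<close> dominates the difference
  quotients, and the filter limit is tested along sequences, as dominated convergence requires.
\<close>

lemma L2_inner_has_vector_derivative:
  fixes G :: "real \<Rightarrow> 'a::euclidean_space \<Rightarrow> complex"
  assumes h: "h \<in> L2" and D: "D \<in> L2" and G: "\<And>s. s \<in> S \<Longrightarrow> G s \<in> L2"
    and der: "\<And>s z. s \<in> S \<Longrightarrow> ((\<lambda>s. G s z) has_vector_derivative G' s z) (at s within S)"
    and bound: "\<And>s z. s \<in> S \<Longrightarrow> cmod (G' s z) \<le> cmod (D z)"
    and S: "convex S" "x \<in> S" and meas: "G' x \<in> borel_measurable lebesgue"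
  shows "((\<lambda>s. L2_inner h (G s)) has_vector_derivative L2_inner h (G' x)) (at x within S)"
  unfolding has_vector_derivative_iff_quotient tendsto_at_iff_sequentially
proof (intro allI impI)
  fix X assume X: "\<forall>i. X i \<in> S - {x}" "X \<longlonglongrightarrow> x"
  define q where "q n z = (G (X n) z - G x z) /\<^sub>R (X n - x)" for n z
  have "(\<lambda>n. LINT z|lebesgue. h z * cnj (q n z)) \<longlonglongrightarrow> (LINT z|lebesgue. h z * cnj (G' x z))"
  proof (rule integral_dominated_convergence[where w="\<lambda>z. cmod (h z) * cmod (D z)"])
    have hm: "h \<in> borel_measurable lebesgue" using h by (rule L2_measurable)
    have cm: "(\<lambda>z. cnj (f z)) \<in> borel_measurable lebesgue" if "f \<in> borel_measurable lebesgue" for f :: "'a \<Rightarrow> complex"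
      by (rule borel_measurable_continuous_on[OF continuous_on_cnj[OF continuous_on_id] that])
    show "(\<lambda>z. h z * cnj (G' x z)) \<in> borel_measurable lebesgue" by (intro borel_measurable_times hm cm meas)
    have "q n \<in> borel_measurable lebesgue" for n
      unfolding q_def[abs_def] using X(1) S(2) G[THEN L2_measurable]
      by (intro borel_measurable_scaleR borel_measurable_diff) auto
    then show "(\<lambda>z. h z * cnj (q n z)) \<in> borel_measurable lebesgue" for n by (intro borel_measurable_times hm cm)
    show "integrable lebesgue (\<lambda>z. cmod (h z) * cmod (D z))" by (rule L2_abs_mult_integrable[OF h D])
    show "AE z in lebesgue. (\<lambda>n. h z * cnj (q n z)) \<longlonglongrightarrow> h z * cnj (G' x z)"
    proof (rule AE_I2)
      fix z
      have "(\<lambda>n. q n z) \<longlonglongrightarrow> G' x z"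
        using der[OF S(2), of z] X unfolding has_vector_derivative_iff_quotient tendsto_at_iff_sequentially
        by (auto simp: q_def o_def)
      then show "(\<lambda>n. h z * cnj (q n z)) \<longlonglongrightarrow> h z * cnj (G' x z)" by (intro tendsto_intros)
    qed
    show "AE z in lebesgue. norm (h z * cnj (q n z)) \<le> cmod (h z) * cmod (D z)" for n
    proof (rule AE_I2)
      fix z
      have "cmod (q n z) \<le> cmod (D z)"
        unfolding q_def
        by (rule norm_difference_quotient_le[where f="\<lambda>s. G s z" and S=S, OF der S(1) bound S(2)]) (use X in auto)
      then show "norm (h z * cnj (q n z)) \<le> cmod (h z) * cmod (D z)" by (simp add: norm_mult mult_left_mono)
    qed
  qed
  moreover have "(LINT z|lebesgue. h z * cnj (q n z)) = (L2_inner h (G (X n)) - L2_inner h (G x)) /\<^sub>R (X n - x)" for n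
  proof -
    have L: "G (X n) \<in> L2" "G x \<in> L2" using G X S by auto
    have "(LINT z|lebesgue. h z * cnj (q n z)) = L2_inner h (\<lambda>z. complex_of_real (inverse (X n - x)) * (G (X n) z - G x z))"
      by (simp add: L2_inner_def q_def scaleR_conv_of_real)
    also have "\<dots> = complex_of_real (inverse (X n - x)) * (L2_inner h (G (X n)) - L2_inner h (G x))"
      using L h by (simp add: L2_inner_scale_right L2_inner_diff_right)
    finally show ?thesis by (simp add: scaleR_conv_of_real)
  qed
  ultimately show "((\<lambda>y. (L2_inner h (G y) - L2_inner h (G x)) /\<^sub>R (y - x)) \<circ> X) \<longlonglongrightarrow> L2_inner h (G' x)"
    by (simp add: o_def L2_inner_def[of h "G' x"])
qed

lemma sinh_cosh_parts:
  fixes z :: complex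
  shows "Re (sinh z) = sinh (Re z) * cos (Im z)" "Im (sinh z) = cosh (Re z) * sin (Im z)"
    "Re (cosh z) = cosh (Re z) * cos (Im z)" "Im (cosh z) = sinh (Re z) * sin (Im z)"
  by (simp_all add: sinh_def cosh_def Re_exp Im_exp field_simps)

lemma cmod_sinh_square: "(cmod (sinh z))\<^sup>2 = (sinh (Re z))\<^sup>2 + (sin (Im z))\<^sup>2" for z :: complex
proof -
  have "(cmod (sinh z))\<^sup>2 = (sinh (Re z))\<^sup>2 * (cos (Im z))\<^sup>2 + (cosh (Re z))\<^sup>2 * (sin (Im z))\<^sup>2"
    by (simp add: cmod_power2 sinh_cosh_parts power_mult_distrib)
  also have "\<dots> = (sinh (Re z))\<^sup>2 * ((cos (Im z))\<^sup>2 + (sin (Im z))\<^sup>2) + (sin (Im z))\<^sup>2"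
    by (simp add: cosh_square_eq algebra_simps del: sin_cos_squared_add sin_cos_squared_add2)
  finally show ?thesis by simp
qed

lemma cmod_cosh_le: "cmod (cosh z) \<le> cosh (Re z)" for z :: complex
proof (rule power2_le_imp_le)
  have "(cmod (cosh z))\<^sup>2 = (cosh (Re z))\<^sup>2 * (cos (Im z))\<^sup>2 + (sinh (Re z))\<^sup>2 * (sin (Im z))\<^sup>2"
    by (simp add: cmod_power2 sinh_cosh_parts power_mult_distrib)
  also have "\<dots> \<le> (cosh (Re z))\<^sup>2 * (cos (Im z))\<^sup>2 + (cosh (Re z))\<^sup>2 * (sin (Im z))\<^sup>2"
    by (intro add_left_mono mult_right_mono) (auto simp: cosh_square_eq)
  also have "\<dots> = (cosh (Re z))\<^sup>2" by (simp add: distrib_left[symmetric])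
  finally show "(cmod (cosh z))\<^sup>2 \<le> (cosh (Re z))\<^sup>2" .
qed simp

lemma Re_coth: "Re (cosh z / sinh z) = sinh (Re z) * cosh (Re z) / (cmod (sinh z))\<^sup>2" for z :: complex
proof -
  have eq: "C * c * (S * c) + S * s * (C * s) = S * C * (c\<^sup>2 + s\<^sup>2)" for C S c s :: real
    by (simp add: power2_eq_square algebra_simps)
  have "Re (cosh z * cnj (sinh z)) = Re (cosh z) * Re (sinh z) + Im (cosh z) * Im (sinh z)" by simp
  also have "\<dots> = sinh (Re z) * cosh (Re z) * ((cos (Im z))\<^sup>2 + (sin (Im z))\<^sup>2)"
    unfolding sinh_cosh_parts by (rule eq)
  finally have "Re (cosh z * cnj (sinh z)) = sinh (Re z) * cosh (Re z) * ((cos (Im z))\<^sup>2 + (sin (Im z))\<^sup>2)" .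
  then have "Re (cosh z * cnj (sinh z)) = sinh (Re z) * cosh (Re z)" by simp
  then show ?thesis by (simp add: complex_div_cnj[of "cosh z"])
qed

text \<open>
  The inverse width of the heat kernel. As a function of \<open>\<tau>\<close> it solves the Riccati equation
  \<open>\<beta>' = \<lambda>\<^sup>2 / 4 - 4 \<beta>\<^sup>2\<close>, whose right-hand side is the leading coefficient of \<open>hermite_factor\<close>.
\<close>

definition coth_coeff :: "real \<Rightarrow> complex \<Rightarrow> complex" where
  "coth_coeff lam \<tau> = complex_of_real (lam / 4) * (cosh (complex_of_real lam * \<tau>) / sinh (complex_of_real lam * \<tau>))"

text \<open>
  Up to a constant factor, the kernel at \<open>w\<close> of \<open>exp (- \<tau> L)\<close> for complex \<open>\<tau>\<close> with positive real
  part. On the imaginary axis it is still defined off the zeros of \<open>sinh\<close>, and there it is no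
  longer decaying.
\<close>

definition heat :: "real \<Rightarrow> complex^'d::finite \<Rightarrow> complex \<Rightarrow> complex^'d \<Rightarrow> complex" where
  "heat lam w \<tau> z = (1 / sinh (complex_of_real lam * \<tau>)) ^ CARD('d) * gaussian (coth_coeff lam \<tau>) (lam / 2) w z"

text \<open>
  The heat equation \<open>\<partial>\<^sub>\<tau> heat = - L heat\<close>, with \<open>L heat\<close> expressed through its multiplier. The
  Riccati equation of the width takes care of the quadratic part, and the power of \<open>1 / sinh\<close> of
  the constant part.
\<close>

lemma heat_has_field_derivative:
  fixes w :: "complex^'d::finite"
  assumes nz: "sinh (complex_of_real lam * \<tau>) \<noteq> 0"
  shows "((\<lambda>\<tau>. heat lam w \<tau> z) has_field_derivative - (hermite_factor lam (coth_coeff lam \<tau>) w z * heat lam w \<tau> z)) (at \<tau>)"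
proof -
  define l s c r where "l = complex_of_real lam" and "s = sinh (l * \<tau>)" and "c = cosh (l * \<tau>)"
    and "r = complex_of_real ((z - w) \<bullet> (z - w))"
  obtain n where n: "CARD('d) = Suc n" using not0_implies_Suc zero_less_card_finite by (metis less_numeral_extra(3))
  have s: "s \<noteq> 0" using nz by (simp add: s_def l_def)
  have cs: "c\<^sup>2 = s\<^sup>2 + 1" unfolding c_def s_def by (rule cosh_square_eq)
  have d1: "((\<lambda>\<tau>. 1 / sinh (l * \<tau>)) has_field_derivative - (l * (c / s)) * (1 / s)) (at \<tau>)"
    using s by (auto intro!: derivative_eq_intros simp: s_def c_def field_simps power2_eq_square)
  have d2: "((\<lambda>\<tau>. (1 / sinh (l * \<tau>)) ^ CARD('d)) has_field_derivative
      - (of_nat CARD('d) * l * (c / s)) * (1 / s) ^ CARD('d)) (at \<tau>)"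
    unfolding n using DERIV_power[OF d1, of "Suc n"] by (simp add: s_def mult_ac)
  have d3: "(coth_coeff lam has_field_derivative l * l / 4 - 4 * (coth_coeff lam \<tau>)\<^sup>2) (at \<tau>)"
  proof -
    have "((\<lambda>\<tau>. cosh (l * \<tau>) / sinh (l * \<tau>)) has_field_derivative l * (1 - (c / s)\<^sup>2)) (at \<tau>)"
      using s by (auto intro!: derivative_eq_intros simp: s_def c_def field_simps power2_eq_square)
    from DERIV_cmult[OF this, of "complex_of_real (lam / 4)"]
    have "(coth_coeff lam has_field_derivative complex_of_real (lam / 4) * (l * (1 - (c / s)\<^sup>2))) (at \<tau>)"
      unfolding coth_coeff_def[abs_def] l_def .
    then show ?thesis
      by (rule DERIV_cong) (simp add: coth_coeff_def l_def s_def c_def power2_eq_square algebra_simps)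
  qed
  have d4: "((\<lambda>\<tau>. gaussian (coth_coeff lam \<tau>) (lam / 2) w z) has_field_derivative
      - ((l * l / 4 - 4 * (coth_coeff lam \<tau>)\<^sup>2) * r) * gaussian (coth_coeff lam \<tau>) (lam / 2) w z) (at \<tau>)"
    unfolding gaussian_def r_def by (auto intro!: derivative_eq_intros d3)
  have b: "l * (c / s) = 4 * coth_coeff lam \<tau>" by (simp add: coth_coeff_def l_def s_def c_def)
  from DERIV_mult[OF d2 d4]
  have "((\<lambda>\<tau>. heat lam w \<tau> z) has_field_derivative
      - (of_nat CARD('d) * l * (c / s)) * (1 / s) ^ CARD('d) * gaussian (coth_coeff lam \<tau>) (lam / 2) w z
     + - ((l * l / 4 - 4 * (coth_coeff lam \<tau>)\<^sup>2) * r) * gaussian (coth_coeff lam \<tau>) (lam / 2) w z * (1 / sinh (l * \<tau>)) ^ CARD('d)) (at \<tau>)"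
    by (simp add: heat_def[abs_def] l_def)
  then show ?thesis
  proof (rule DERIV_cong)
    have e: "- (N * l * (c / s)) * S * g + - ((l * l / 4 - 4 * B\<^sup>2) * r) * g * S = - (((l * l / 4 - 4 * B\<^sup>2) * r + 4 * B * N) * (S * g))"
      if "l * (c / s) = 4 * B" for N S g B
    proof -
      have "N * l * (c / s) = N * (4 * B)" unfolding mult.assoc that ..
      then show ?thesis by (simp add: algebra_simps)
    qed
    show "- (of_nat CARD('d) * l * (c / s)) * (1 / s) ^ CARD('d) * gaussian (coth_coeff lam \<tau>) (lam / 2) w z
     + - ((l * l / 4 - 4 * (coth_coeff lam \<tau>)\<^sup>2) * r) * gaussian (coth_coeff lam \<tau>) (lam / 2) w z * (1 / sinh (l * \<tau>)) ^ CARD('d)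
     = - (hermite_factor lam (coth_coeff lam \<tau>) w z * heat lam w \<tau> z)"
      unfolding heat_def hermite_factor_def r_def[symmetric] l_def[symmetric] s_def[symmetric] e[OF b]
      by (simp add: l_def power2_eq_square)
  qed
qed

lemma heat_continuous: "continuous_on UNIV (heat lam w \<tau>)"
  unfolding heat_def[abs_def] by (intro continuous_intros gaussian_continuous)

lemma hermite_factor_continuous: "continuous_on UNIV (hermite_factor lam b w)"
  unfolding hermite_factor_def[abs_def] by (intro continuous_intros)

lemma cmod_gaussian: "cmod (gaussian b k w z) = exp (- (Re b * ((z - w) \<bullet> (z - w))))"
  by (simp add: gaussian_def)

context
  fixes lam \<epsilon> :: real
  assumes lam: "lam \<noteq> 0" and eps: "0 < \<epsilon>"
begin

lemma sinh_lam_eps: "\<bar>sinh (lam * \<epsilon>)\<bar> > 0" using lam eps by simp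

text \<open>
  The least decay of the heat kernels on the line \<open>Re \<tau> = \<epsilon>\<close>, which makes all of the bounds
  below uniform along the line.
\<close>

definition heat_rate :: real where "heat_rate = \<bar>lam\<bar> / 4 * (\<bar>sinh (lam * \<epsilon>)\<bar> / cosh (lam * \<epsilon>))"

lemma heat_rate_pos: "0 < heat_rate"
  unfolding heat_rate_def using lam sinh_lam_eps by (auto intro!: mult_pos_pos divide_pos_pos)

lemma cmod_sinh_ge: "Re \<tau> = \<epsilon> \<Longrightarrow> \<bar>sinh (lam * \<epsilon>)\<bar> \<le> cmod (sinh (complex_of_real lam * \<tau>))"
  by (rule power2_le_imp_le) (simp_all add: cmod_sinh_square)

lemma heat_rate_le:
  assumes "Re \<tau> = \<epsilon>"
  shows "heat_rate \<le> Re (coth_coeff lam \<tau>)"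
proof -
  let ?s = "sinh (lam * \<epsilon>)" and ?c = "cosh (lam * \<epsilon>)" and ?S = "(cmod (sinh (complex_of_real lam * \<tau>)))\<^sup>2"
  have S: "0 < ?S" using cmod_sinh_ge[OF assms] sinh_lam_eps by (intro zero_less_power) linarith
  have "?S \<le> ?s\<^sup>2 + 1"
    using abs_square_le_1[of "sin (lam * Im \<tau>)"] assms by (simp add: cmod_sinh_square)
  then have le: "?S \<le> ?c\<^sup>2" by (simp add: cosh_square_eq)
  have pos: "lam * ?s = \<bar>lam\<bar> * \<bar>?s\<bar>"
    using eps lam by (cases "lam > 0") (auto simp: abs_if not_less mult_less_0_iff zero_less_mult_iff)
  have "heat_rate = \<bar>lam\<bar> * \<bar>?s\<bar> * ?c / 4 / ?c\<^sup>2"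
    unfolding heat_rate_def by (simp add: power2_eq_square)
  also have "\<dots> \<le> \<bar>lam\<bar> * \<bar>?s\<bar> * ?c / 4 / ?S"
    by (rule divide_left_mono[OF le]) (use S in \<open>auto simp: cosh_real_pos less_imp_le\<close>)
  also have "\<dots> = lam / 4 * (?s * ?c / ?S)" unfolding pos[symmetric] by simp
  also have "\<dots> = Re (coth_coeff lam \<tau>)"
    unfolding coth_coeff_def times_complex.simps(1) Re_complex_of_real Im_complex_of_real Re_coth
    using assms by simp
  finally show ?thesis .
qed

lemma sinh_nonzero: "Re \<tau> = \<epsilon> \<Longrightarrow> sinh (complex_of_real lam * \<tau>) \<noteq> 0"
  using cmod_sinh_ge[of \<tau>] sinh_lam_eps by (metis norm_zero not_less)

lemma coth_coeff_le:
  assumes "Re \<tau> = \<epsilon>"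
  shows "cmod (coth_coeff lam \<tau>) \<le> \<bar>lam\<bar> / 4 * (cosh (lam * \<epsilon>) / \<bar>sinh (lam * \<epsilon>)\<bar>)"
proof -
  have "cmod (coth_coeff lam \<tau>) = \<bar>lam\<bar> / 4 * (cmod (cosh (complex_of_real lam * \<tau>)) / cmod (sinh (complex_of_real lam * \<tau>)))"
    by (simp add: coth_coeff_def norm_mult norm_divide)
  also have "\<dots> \<le> \<bar>lam\<bar> / 4 * (cosh (lam * \<epsilon>) / \<bar>sinh (lam * \<epsilon>)\<bar>)"
    using cmod_cosh_le[of "complex_of_real lam * \<tau>"] cmod_sinh_ge[OF assms] sinh_lam_eps assms
    by (intro mult_left_mono frac_le) auto
  finally show ?thesis .
qed

lemma cmod_heat_le:
  fixes w :: "complex^'d::finite"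
  assumes "Re \<tau> = \<epsilon>"
  shows "cmod (heat lam w \<tau> z) \<le> (1 / \<bar>sinh (lam * \<epsilon>)\<bar>) ^ CARD('d) * exp (- (heat_rate * ((z - w) \<bullet> (z - w))))"
  unfolding heat_def norm_mult norm_power norm_divide norm_one cmod_gaussian
proof (intro mult_mono power_mono divide_left_mono)
  show "exp (- (Re (coth_coeff lam \<tau>) * ((z - w) \<bullet> (z - w)))) \<le> exp (- (heat_rate * ((z - w) \<bullet> (z - w))))"
    using heat_rate_le[OF assms] by (simp add: mult_right_mono)
  show "\<bar>sinh (lam * \<epsilon>)\<bar> \<le> cmod (sinh (complex_of_real lam * \<tau>))" by (rule cmod_sinh_ge[OF assms])
  show "0 < cmod (sinh (complex_of_real lam * \<tau>)) * \<bar>sinh (lam * \<epsilon>)\<bar>"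
    using sinh_nonzero[OF assms] sinh_lam_eps by simp
qed (use sinh_lam_eps in auto)

lemma heat_L2:
  fixes w :: "complex^'d::finite"
  assumes "Re \<tau> = \<epsilon>"
  shows "heat lam w \<tau> \<in> L2"
    "L2_norm (heat lam w \<tau>) \<le> L2_norm (\<lambda>z. complex_of_real ((1 / \<bar>sinh (lam * \<epsilon>)\<bar>) ^ CARD('d) * exp (- (heat_rate * ((z - w) \<bullet> (z - w))))))"
proof -
  have le: "cmod (heat lam w \<tau> z) \<le> 1 * cmod (complex_of_real ((1 / \<bar>sinh (lam * \<epsilon>)\<bar>) ^ CARD('d) * exp (- (heat_rate * ((z - w) \<bullet> (z - w))))))" for z
    by (rule order_trans[OF cmod_heat_le[OF assms]]) (simp only: norm_of_real mult_1_left abs_ge_self)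
  note * = L2_dominated[OF gaussian_L2[OF heat_rate_pos] continuous_measurable_lebesgue[OF heat_continuous] AE_I2[OF le]]
  show "heat lam w \<tau> \<in> L2" by (rule *) simp
  have "L2_norm (heat lam w \<tau>) \<le> 1 * L2_norm (\<lambda>z. complex_of_real ((1 / \<bar>sinh (lam * \<epsilon>)\<bar>) ^ CARD('d) * exp (- (heat_rate * ((z - w) \<bullet> (z - w))))))"
    by (rule *) simp
  then show "L2_norm (heat lam w \<tau>) \<le> L2_norm (\<lambda>z. complex_of_real ((1 / \<bar>sinh (lam * \<epsilon>)\<bar>) ^ CARD('d) * exp (- (heat_rate * ((z - w) \<bullet> (z - w))))))"
    by simp
qed

lemma hermite_heat_le:
  obtains D where "\<And>w :: complex^'d::finite. (\<lambda>z. complex_of_real (D * exp (- (heat_rate / 2 * ((z - w) \<bullet> (z - w)))))) \<in> L2"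
    "\<And>(w :: complex^'d) \<tau> z. Re \<tau> = \<epsilon> \<Longrightarrow> cmod (hermite_factor lam (coth_coeff lam \<tau>) w z * heat lam w \<tau> z)
      \<le> cmod (complex_of_real (D * exp (- (heat_rate / 2 * ((z - w) \<bullet> (z - w))))))"
proof -
  define B where "B = \<bar>lam\<bar> / 4 * (cosh (lam * \<epsilon>) / \<bar>sinh (lam * \<epsilon>)\<bar>)"
  define C where "C = lam\<^sup>2 / 4 + 4 * B\<^sup>2 + 4 * B * real CARD('d)"
  define A where "A = (1 / \<bar>sinh (lam * \<epsilon>)\<bar>) ^ CARD('d)"
  define D where "D = C * A * (1 + 2 / heat_rate)"
  have B: "0 \<le> B" unfolding B_def using sinh_lam_eps by (auto simp: less_imp_le)
  have C: "0 \<le> C" unfolding C_def using B by simp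
  have A: "0 \<le> A" unfolding A_def by simp
  have D: "0 \<le> D" unfolding D_def using A C heat_rate_pos by simp
  show thesis
  proof (rule that)
    show "(\<lambda>z. complex_of_real (D * exp (- (heat_rate / 2 * ((z - w) \<bullet> (z - w)))))) \<in> L2" for w :: "complex^'d"
      by (rule gaussian_L2) (use heat_rate_pos in simp)
    fix w :: "complex^'d" and \<tau> z assume \<tau>: "Re \<tau> = \<epsilon>"
    define r where "r = (z - w) \<bullet> (z - w)"
    have r: "0 \<le> r" by (simp add: r_def)
    have b: "cmod (coth_coeff lam \<tau>) \<le> B" unfolding B_def by (rule coth_coeff_le[OF \<tau>])
    then have b2: "(cmod (coth_coeff lam \<tau>))\<^sup>2 \<le> B\<^sup>2" by (intro power_mono) auto
    have "cmod (hermite_factor lam (coth_coeff lam \<tau>) w z)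
        \<le> cmod (complex_of_real (lam\<^sup>2 / 4) - 4 * (coth_coeff lam \<tau>)\<^sup>2) * r + 4 * cmod (coth_coeff lam \<tau>) * real CARD('d)"
      unfolding hermite_factor_def r_def[symmetric]
      by (rule order_trans[OF norm_triangle_ineq]) (use r in \<open>simp add: norm_mult\<close>)
    also have "\<dots> \<le> (lam\<^sup>2 / 4 + 4 * B\<^sup>2) * r + 4 * B * real CARD('d)"
    proof (intro add_mono mult_right_mono)
      have "cmod (complex_of_real (lam\<^sup>2 / 4) - 4 * (coth_coeff lam \<tau>)\<^sup>2) \<le> cmod (complex_of_real (lam\<^sup>2 / 4)) + cmod (4 * (coth_coeff lam \<tau>)\<^sup>2)"
        by (rule norm_triangle_ineq4)
      also have "cmod (complex_of_real (lam\<^sup>2 / 4)) = lam\<^sup>2 / 4" by (simp only: norm_of_real) simp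
      also have "cmod (4 * (coth_coeff lam \<tau>)\<^sup>2) = 4 * (cmod (coth_coeff lam \<tau>))\<^sup>2" by (simp add: norm_mult norm_power)
      finally show "cmod (complex_of_real (lam\<^sup>2 / 4) - 4 * (coth_coeff lam \<tau>)\<^sup>2) \<le> lam\<^sup>2 / 4 + 4 * B\<^sup>2" using b2 by linarith
    qed (use b r in auto)
    also have "\<dots> \<le> C * (1 + r)"
    proof -
      have "0 \<le> (lam\<^sup>2 / 4 + 4 * B\<^sup>2) + 4 * B * real CARD('d) * r" using B r by simp
      moreover have "(a + e) * (1 + r) = a * r + e + (a + e * r)" for a e :: real by (simp add: algebra_simps)
      ultimately show ?thesis unfolding C_def by simp
    qed
    finally have "cmod (hermite_factor lam (coth_coeff lam \<tau>) w z) \<le> C * (1 + r)" .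
    moreover have "cmod (heat lam w \<tau> z) \<le> A * exp (- (heat_rate * r))"
      unfolding A_def r_def by (rule cmod_heat_le[OF \<tau>])
    ultimately have "cmod (hermite_factor lam (coth_coeff lam \<tau>) w z * heat lam w \<tau> z) \<le> (C * (1 + r)) * (A * exp (- (heat_rate * r)))"
      unfolding norm_mult using C r by (intro mult_mono) auto
    also have "\<dots> = C * A * ((1 + r) * exp (- (heat_rate * r)))" by simp
    also have "\<dots> \<le> C * A * ((1 + 2 / heat_rate) * exp (- (heat_rate / 2 * r)))"
      by (intro mult_left_mono gaussian_polynomial_bound heat_rate_pos r) (use C A in simp)
    also have "\<dots> = cmod (complex_of_real (D * exp (- (heat_rate / 2 * r))))"
    proof -
      have "0 \<le> D * exp (- (heat_rate / 2 * r))" using D by simp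
      then have "cmod (complex_of_real (D * exp (- (heat_rate / 2 * r)))) = D * exp (- (heat_rate / 2 * r))"
        by (simp only: norm_of_real abs_of_nonneg)
      then show ?thesis by (simp add: D_def)
    qed
    finally show "cmod (hermite_factor lam (coth_coeff lam \<tau>) w z * heat lam w \<tau> z) \<le> cmod (complex_of_real (D * exp (- (heat_rate / 2 * ((z - w) \<bullet> (z - w))))))"
      unfolding r_def .
  qed
qed

text \<open>
  On the line \<open>Re \<tau> = \<epsilon>\<close> the heat kernels \<open>G s = heat w (\<epsilon> + i (s - t))\<close> run from \<open>\<epsilon> - i t\<close> to
  \<open>\<epsilon>\<close> and satisfy \<open>G' = - i L G\<close>, so they are transported by the same unitary group as \<open>u\<close>.
\<close>

lemma heat_pairing:
  fixes w :: "complex^'d::finite"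
  assumes P: "spectral_resolution P (special_hermite_closure lam)"
    and u: "u\<^sub>0 \<in> L2" "(u\<^sub>0, u) \<in> spectral_integral P (\<lambda>x. exp (- \<i> * complex_of_real (t * x)))" and t: "0 \<le> t"
  shows "L2_inner u (heat lam w (complex_of_real \<epsilon>)) = L2_inner u\<^sub>0 (heat lam w (Complex \<epsilon> (- t)))"
proof -
  interpret pvm P using P by (unfold_locales) (simp add: spectral_resolution_def)
  have T: "special_hermite_closure lam = spectral_integral P complex_of_real" using P by (simp add: spectral_resolution_def)
  define \<tau> where "\<tau> s = Complex \<epsilon> (s - t)" for s
  have \<tau>: "Re (\<tau> s) = \<epsilon>" for s by (simp add: \<tau>_def)
  define LG where "LG s z = hermite_factor lam (coth_coeff lam (\<tau> s)) w z * heat lam w (\<tau> s) z" for s z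
  obtain D where D0: "\<And>w :: complex^'d. (\<lambda>z. complex_of_real (D * exp (- (heat_rate / 2 * ((z - w) \<bullet> (z - w)))))) \<in> L2"
    "\<And>(w :: complex^'d) \<tau> z. Re \<tau> = \<epsilon> \<Longrightarrow> cmod (hermite_factor lam (coth_coeff lam \<tau>) w z * heat lam w \<tau> z)
      \<le> cmod (complex_of_real (D * exp (- (heat_rate / 2 * ((z - w) \<bullet> (z - w))))))"
    by (rule hermite_heat_le[where 'd='d]) (rule that)
  have D: "(\<lambda>z. complex_of_real (D * exp (- (heat_rate / 2 * ((z - w) \<bullet> (z - w)))))) \<in> L2"
    "\<And>s z. cmod (LG s z) \<le> cmod (complex_of_real (D * exp (- (heat_rate / 2 * ((z - w) \<bullet> (z - w))))))"
    unfolding LG_def by (rule D0(1), rule D0(2)[OF \<tau>])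
  have cLG: "LG s \<in> borel_measurable lebesgue" for s
    unfolding LG_def[abs_def]
    by (intro continuous_measurable_lebesgue continuous_on_mult hermite_factor_continuous heat_continuous)
  have LG: "LG s \<in> L2" for s
    by (rule L2_dominated[OF D(1) cLG, where C=1]) (use D(2) in auto)
  have der: "((\<lambda>s. heat lam w (\<tau> s) z) has_vector_derivative - \<i> * LG s z) (at s within S)" for s z S
  proof -
    have "(\<tau> has_vector_derivative \<i>) (at s within S)"
    proof -
      have eq: "\<tau> = (\<lambda>s. complex_of_real \<epsilon> + \<i> * complex_of_real (s - t))"
        by (simp add: \<tau>_def fun_eq_iff complex_eq_iff)
      show ?thesis unfolding eq has_vector_derivative_def
        by (auto intro!: derivative_eq_intros simp: scaleR_conv_of_real)
    qed
    from field_vector_diff_chain_within[OF this has_field_derivative_at_within[OF heat_has_field_derivative[OF sinh_nonzero[OF \<tau>]]]]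
    show ?thesis by (simp add: o_def LG_def mult_ac)
  qed
  have "L2_inner u (heat lam w (\<tau> t)) = L2_inner u\<^sub>0 (heat lam w (\<tau> 0))"
  proof (rule evolution_pairing[OF T u t, where G="\<lambda>s. heat lam w (\<tau> s)"])
    show "heat lam w (\<tau> s) \<in> L2" for s by (rule heat_L2[OF \<tau>])
    show "L2_norm (heat lam w (\<tau> s)) \<le> L2_norm (\<lambda>z. complex_of_real ((1 / \<bar>sinh (lam * \<epsilon>)\<bar>) ^ CARD('d) * exp (- (heat_rate * ((z - w) \<bullet> (z - w))))))" for s
      by (rule heat_L2[OF \<tau>])
    fix h v :: "complex^'d \<Rightarrow> complex" and s assume hv: "(h, v) \<in> special_hermite_closure lam" and s: "s \<in> {0..t}"
    have h: "h \<in> L2" using hv unfolding T by (simp add: spectral_integral_def)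
    have "((\<lambda>s. L2_inner h (heat lam w (\<tau> s))) has_vector_derivative L2_inner h (\<lambda>z. - \<i> * LG s z)) (at s within {0..t})"
    proof (rule L2_inner_has_vector_derivative[OF h D(1) heat_L2(1)[OF \<tau>] der])
      show "cmod (- \<i> * LG s z) \<le> cmod (complex_of_real (D * exp (- (heat_rate / 2 * ((z - w) \<bullet> (z - w))))))" for s z
        using D(2)[of s z] by (simp add: norm_mult)
      show "(\<lambda>z. - \<i> * LG s z) \<in> borel_measurable lebesgue" by (intro borel_measurable_times cLG) simp
    qed (use s in auto)
    also have "L2_inner h (\<lambda>z. - \<i> * LG s z) = \<i> * L2_inner h (LG s)"
      by (subst L2_inner_scale_right) simp
    also have "L2_inner h (LG s) = L2_inner v (heat lam w (\<tau> s))"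
      using closure_pairing[OF hv, of "(1 / sinh (complex_of_real lam * \<tau> s)) ^ CARD('d)" "coth_coeff lam (\<tau> s)" w] heat_L2(1)[OF \<tau>, of w s] LG[of s]
      unfolding LG_def[abs_def] heat_def[abs_def] by simp
    finally show "((\<lambda>s. L2_inner h (heat lam w (\<tau> s))) has_vector_derivative \<i> * L2_inner v (heat lam w (\<tau> s))) (at s within {0..t})" .
  qed
  then show ?thesis by (simp add: \<tau>_def complex_of_real_def)
qed

end

section \<open>Continuity of translations and approximate identities\<close>

text \<open>
  Both one-sided differences of \<open>A\<close> and its translate have the same measure, so it is enough
  that the part of \<open>A\<close> which leaves \<open>A\<close> shrinks. If \<open>U\<close> is an open set slightly larger than \<open>A\<close>,
  points of \<open>A\<close> stay in \<open>U\<close> for small translations, and those that end up in \<open>U - A\<close> have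
  measure at most that of \<open>U - A\<close>.
\<close>

lemma indicator_translation_tendsto:
  fixes A :: "'a::euclidean_space set"
  assumes A: "A \<in> sets lebesgue" "emeasure lebesgue A < \<infinity>" and h: "h \<longlonglongrightarrow> (0::'a)"
  shows "(\<lambda>n. LINT x|lebesgue. \<bar>indicator A (x + h n) - indicator A x\<bar> :: real) \<longlonglongrightarrow> 0"
proof -
  have iA: "integrable lebesgue (indicator A :: 'a \<Rightarrow> real)" using A by (simp add: integrable_indicator_iff)
  have mA: "(indicator A :: 'a \<Rightarrow> real) \<in> borel_measurable lebesgue" using A by simp
  define d where "d n x = (indicator A x * (1 - indicator A (x + h n)) :: real)" for n x
  have id: "integrable lebesgue (d n)" for n
  proof (rule Bochner_Integration.integrable_bound[OF iA])
    show "d n \<in> borel_measurable lebesgue" unfolding d_def[abs_def]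
      by (intro borel_measurable_times borel_measurable_diff mA measurable_translate[OF mA] borel_measurable_const)
  qed (auto simp: d_def indicator_def)
  have double: "(LINT x|lebesgue. \<bar>indicator A (x + h n) - indicator A x\<bar> :: real) = 2 * (LINT x|lebesgue. d n x)" for n
  proof -
    have "(LINT x|lebesgue. \<bar>indicator A (x + h n) - indicator A x\<bar> :: real)
        = (LINT x|lebesgue. 2 * d n x + (indicator A (x + h n) - indicator A x))"
      by (intro Bochner_Integration.integral_cong refl) (auto simp: d_def indicator_def)
    also have "\<dots> = 2 * (LINT x|lebesgue. d n x) + ((LINT x|lebesgue. indicator A (x + h n)) - (LINT x|lebesgue. indicator A x))"
      using id iA integrable_translation[OF iA] by simp
    finally show ?thesis using integral_translation[OF mA] by simp
  qed
  have small: "\<exists>N. \<forall>n\<ge>N. (LINT x|lebesgue. d n x) < e" if e: "e > 0" for e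
  proof -
    obtain U where U: "open U" "A \<subseteq> U" "U - A \<in> lmeasurable" "emeasure lebesgue (U - A) < ennreal (e/2)"
      using sets_lebesgue_outer_open[OF A(1), of "e/2"] e by auto
    have mU: "(indicator U :: 'a \<Rightarrow> real) \<in> borel_measurable lebesgue"
      using U(1) by (intro borel_measurable_indicator sets_completionI_sets) simp
    have iUA: "integrable lebesgue (indicator (U - A) :: 'a \<Rightarrow> real)" 
      by (rule integrable_real_indicator[OF fmeasurableD[OF U(3)] fmeasurableD2[OF U(3), unfolded less_top, folded infinity_ennreal_def]])
    define g where "g n x = (indicator A x * (1 - indicator U (x + h n)) :: real)" for n x
    have ig: "integrable lebesgue (g n)" for n
    proof (rule Bochner_Integration.integrable_bound[OF iA])
      show "g n \<in> borel_measurable lebesgue" unfolding g_def[abs_def]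
        by (intro borel_measurable_times borel_measurable_diff mA measurable_translate[OF mU] borel_measurable_const)
    qed (auto simp: g_def indicator_def)
    have "(\<lambda>n. LINT x|lebesgue. g n x) \<longlonglongrightarrow> (LINT x|(lebesgue :: 'a measure). 0)"
    proof (rule integral_dominated_convergence[where w="indicator A"])
      show "AE x in lebesgue. (\<lambda>n. g n x) \<longlonglongrightarrow> 0"
      proof (rule AE_I2)
        fix x
        show "(\<lambda>n. g n x) \<longlonglongrightarrow> 0"
        proof (cases "x \<in> A")
          case True
          have "(\<lambda>n. x + h n) \<longlonglongrightarrow> x + 0" by (intro tendsto_add tendsto_const h)
          then have "eventually (\<lambda>n. x + h n \<in> U) sequentially"
            using True U by (intro topological_tendstoD) auto
          then have "eventually (\<lambda>n. g n x = 0) sequentially" by eventually_elim (simp add: g_def)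
          then show ?thesis by (rule tendsto_eventually)
        qed (simp add: g_def)
      qed
      show "AE x in lebesgue. norm (g n x) \<le> indicator A x" for n by (auto simp: g_def indicator_def)
    qed (use iA ig in \<open>auto intro: borel_measurable_integrable\<close>)
    then have "eventually (\<lambda>n. (LINT x|lebesgue. g n x) < e/2) sequentially"
      using e by (intro order_tendstoD(2)) auto
    then obtain N where N: "\<And>n. n \<ge> N \<Longrightarrow> (LINT x|lebesgue. g n x) < e/2" by (auto simp: eventually_sequentially)
    have meas: "(LINT x|lebesgue. indicator (U - A) x :: real) < e/2"
    proof -
      have "measure lebesgue (U - A) < e/2"
        using U(4) emeasure_eq_measure2[OF U(3)] by (simp only: ennreal_less_iff[OF measure_nonneg])
      then show ?thesis using fmeasurableD[OF U(3)] by simp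
    qed
    have "(LINT x|lebesgue. d n x) < e" if "n \<ge> N" for n
    proof -
      have "(LINT x|lebesgue. d n x) \<le> (LINT x|lebesgue. g n x + indicator (U - A) (x + h n))"
      proof (rule integral_mono)
        show "integrable lebesgue (d n)" by (rule id)
        show "integrable lebesgue (\<lambda>x. g n x + indicator (U - A) (x + h n))"
          by (intro Bochner_Integration.integrable_add ig integrable_translation[OF iUA])
        show "d n x \<le> g n x + indicator (U - A) (x + h n)" for x
          using U(2) by (auto simp: d_def g_def indicator_def)
      qed
      also have "\<dots> = (LINT x|lebesgue. g n x) + (LINT x|lebesgue. indicator (U - A) x)"
        using ig integrable_translation[OF iUA] integral_translation[OF borel_measurable_integrable[OF iUA]] by simp
      finally show ?thesis using N[OF that] meas by linarith
    qed
    then show ?thesis by blast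
  qed
  have "(\<lambda>n. LINT x|lebesgue. d n x) \<longlonglongrightarrow> 0"
  proof (rule LIMSEQ_I)
    fix e :: real assume "e > 0"
    moreover have "0 \<le> (LINT x|lebesgue. d n x)" for n by (auto simp: d_def indicator_def intro!: Bochner_Integration.integral_nonneg)
    ultimately show "\<exists>no. \<forall>n\<ge>no. norm ((LINT x|lebesgue. d n x) - 0) < e" using small by simp
  qed
  from tendsto_mult_right_zero[OF this, of 2] show ?thesis unfolding double .
qed

text \<open>
  The property holds for indicators, is stable under sums, and passes to limits because
  translations are isometries.
\<close>

lemma L1_translation_tendsto:
  fixes f :: "'a::euclidean_space \<Rightarrow> complex"
  assumes "integrable lebesgue f" and h: "h \<longlonglongrightarrow> (0::'a)"
  shows "(\<lambda>n. LINT x|lebesgue. norm (f (x + h n) - f x)) \<longlonglongrightarrow> 0"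
  using assms(1)
proof (induction rule: integrable_induct)
  case (base A c)
  have "norm (indicator A (x + h n) *\<^sub>R c - indicator A x *\<^sub>R c) = \<bar>indicator A (x + h n) - indicator A x\<bar> * norm c" for n x
    by (simp add: scaleR_left_diff_distrib[symmetric])
  then show ?case
    using tendsto_mult_left_zero[OF indicator_translation_tendsto[OF base h], of "norm c"] by simp
next
  case (add f g)
  show ?case
  proof (rule Lim_null_comparison[OF always_eventually, rule_format])
    have i: "integrable lebesgue (\<lambda>x. norm (f (x + h n) - f x))" "integrable lebesgue (\<lambda>x. norm (g (x + h n) - g x))" for n
      using integrable_translation[OF add.hyps(1)] integrable_translation[OF add.hyps(2)] add.hyps by auto
    show "norm (LINT x|lebesgue. norm (f (x + h n) + g (x + h n) - (f x + g x)))
        \<le> (LINT x|lebesgue. norm (f (x + h n) - f x)) + (LINT x|lebesgue. norm (g (x + h n) - g x))" for n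
    proof -
      have "(LINT x|lebesgue. norm (f (x + h n) + g (x + h n) - (f x + g x)))
          \<le> (LINT x|lebesgue. norm (f (x + h n) - f x) + norm (g (x + h n) - g x))"
      proof (rule integral_mono)
        show "integrable lebesgue (\<lambda>x. norm (f (x + h n) + g (x + h n) - (f x + g x)))"
          using integrable_translation[OF add.hyps(1), of "h n"] integrable_translation[OF add.hyps(2), of "h n"] add.hyps by auto
        show "norm (f (x + h n) + g (x + h n) - (f x + g x)) \<le> norm (f (x + h n) - f x) + norm (g (x + h n) - g x)" for x
          using norm_triangle_ineq[of "f (x + h n) - f x" "g (x + h n) - g x"] by (simp add: algebra_simps)
      qed (use i in auto)
      then show ?thesis using i by simp
    qed
    show "(\<lambda>n. (LINT x|lebesgue. norm (f (x + h n) - f x)) + (LINT x|lebesgue. norm (g (x + h n) - g x))) \<longlonglongrightarrow> 0"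
      using tendsto_add[OF add.IH] by simp
  qed
next
  case (lim f s)
  have sf: "(\<lambda>i. LINT x|lebesgue. norm (s i x - f x)) \<longlonglongrightarrow> 0"
  proof -
    have "(\<lambda>i. LINT x|lebesgue. norm (s i x - f x)) \<longlonglongrightarrow> (LINT x|(lebesgue :: 'a measure). 0)"
    proof (rule integral_dominated_convergence[where w="\<lambda>x. 3 * norm (f x)"])
      show "AE x in lebesgue. (\<lambda>i. norm (s i x - f x)) \<longlonglongrightarrow> 0"
      proof (rule AE_I2)
        fix x :: 'a assume "x \<in> space lebesgue"
        from lim.hyps(2)[OF this] show "(\<lambda>i. norm (s i x - f x)) \<longlonglongrightarrow> 0" by (simp add: tendsto_norm_zero_iff LIM_zero_iff)
      qed
      show "AE x in lebesgue. norm (norm (s i x - f x)) \<le> 3 * norm (f x)" for i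
      proof (rule AE_I2)
        fix x :: 'a assume "x \<in> space lebesgue"
        from lim.hyps(3)[OF this, of i] norm_triangle_ineq4[of "s i x" "f x"]
        show "norm (norm (s i x - f x)) \<le> 3 * norm (f x)" by simp
      qed
    qed (use lim.hyps in \<open>auto intro!: borel_measurable_integrable\<close>)
    then show ?thesis by simp
  qed
  show ?case
  proof (rule LIMSEQ_I)
    fix e :: real assume e: "e > 0"
    obtain i where i: "(LINT x|lebesgue. norm (s i x - f x)) < e/3"
    proof -
      have "eventually (\<lambda>i. (LINT x|lebesgue. norm (s i x - f x)) < e/3) sequentially"
        using e by (intro order_tendstoD(2)[OF sf]) auto
      then show ?thesis using that by (auto simp: eventually_sequentially)
    qed
    obtain N where N: "\<And>n. n \<ge> N \<Longrightarrow> norm ((LINT x|lebesgue. norm (s i (x + h n) - s i x)) - 0) < e/3"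
      using LIMSEQ_D[OF lim.IH[of i], of "e/3"] e by auto
    have "norm ((LINT x|lebesgue. norm (f (x + h n) - f x)) - 0) < e" if n: "n \<ge> N" for n
    proof -
      have d: "integrable lebesgue (\<lambda>x. norm (s i x - f x))" using lim.hyps(1)[of i] lim.hyps(4) by auto
      have d2: "integrable lebesgue (\<lambda>x. norm (s i (x + h n) - f (x + h n)))"
        using integrable_translation[OF d, of "h n"] .
      have d3: "integrable lebesgue (\<lambda>x. norm (s i (x + h n) - s i x))"
        using integrable_translation[OF lim.hyps(1)[of i], of "h n"] lim.hyps(1)[of i] by auto
      have "(LINT x|lebesgue. norm (f (x + h n) - f x))
          \<le> (LINT x|lebesgue. norm (s i (x + h n) - f (x + h n)) + norm (s i (x + h n) - s i x) + norm (s i x - f x))"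
      proof (rule integral_mono)
        show "integrable lebesgue (\<lambda>x. norm (f (x + h n) - f x))" using lim.hyps(4) integrable_translation[OF lim.hyps(4)] by auto
        fix x
        have "f (x + h n) - f x = (s i (x + h n) - s i x) + (s i x - f x) - (s i (x + h n) - f (x + h n))" by simp
        from arg_cong[OF this, of norm] show "norm (f (x + h n) - f x) \<le> norm (s i (x + h n) - f (x + h n)) + norm (s i (x + h n) - s i x) + norm (s i x - f x)"
          using norm_triangle_ineq4[of "(s i (x + h n) - s i x) + (s i x - f x)" "s i (x + h n) - f (x + h n)"]
            norm_triangle_ineq[of "s i (x + h n) - s i x" "s i x - f x"] by linarith
      qed (use d d2 d3 in auto)
      also have "\<dots> = (LINT x|lebesgue. norm (s i x - f x)) + (LINT x|lebesgue. norm (s i (x + h n) - s i x)) + (LINT x|lebesgue. norm (s i x - f x))"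
        using d d2 d3 integral_translation[OF borel_measurable_integrable[OF d], of "h n"] by simp
      also have "\<dots> < e" using i N[OF n] by simp
      finally show ?thesis by simp
    qed
    then show "\<exists>no. \<forall>n\<ge>no. norm ((LINT x|lebesgue. norm (f (x + h n) - f x)) - 0) < e" by blast
  qed
qed

lemma integral_scaling:
  fixes f :: "'a::euclidean_space \<Rightarrow> complex"
  assumes f: "f \<in> borel_measurable borel" and c: "0 < c"
  shows "(LINT x|lborel. f x) = of_real (c ^ DIM('a)) * (LINT x|lborel. f (t + c *\<^sub>R x))"
proof -
  have "(LINT x|lborel. f x) = (LINT x|density (distr lborel borel (\<lambda>x. t + c *\<^sub>R x)) (\<lambda>_. ennreal (c ^ DIM('a))). f x)"
    using lborel_affine[of c t] c by simp
  also have "\<dots> = (LINT x|distr lborel borel (\<lambda>x. t + c *\<^sub>R x). (c ^ DIM('a)) *\<^sub>R f x)"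
    using f c by (subst integral_density) auto
  also have "\<dots> = (LINT x|lborel. (c ^ DIM('a)) *\<^sub>R f (t + c *\<^sub>R x))"
    using f by (subst integral_distr) auto
  finally show ?thesis by (simp add: scaleR_conv_of_real)
qed

lemma L2_translate:
  assumes "f \<in> L2" shows "(\<lambda>x. f (x + a)) \<in> L2" "L2_norm (\<lambda>x. f (x + a)) = L2_norm f"
proof -
  have m: "(\<lambda>x. (cmod (f x))\<^sup>2) \<in> borel_measurable lebesgue" using L2_integrable_square[OF assms] by auto
  show "(\<lambda>x. f (x + a)) \<in> L2"
    using integrable_translation[OF L2_integrable_square[OF assms], of a] measurable_translate[OF L2_measurable[OF assms], of a]
    by (simp add: L2_def)
  show "L2_norm (\<lambda>x. f (x + a)) = L2_norm f"
    unfolding L2_norm_def using integral_translation[OF m, of a] by simp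
qed

lemma bounded_support_L2:
  fixes f :: "'a::euclidean_space \<Rightarrow> complex"
  assumes f: "f \<in> borel_measurable lebesgue" "\<And>x. cmod (f x) \<le> C" "\<And>x. norm x > r \<Longrightarrow> f x = 0"
  shows "f \<in> L2"
proof -
  have C: "0 \<le> C" using order_trans[OF norm_ge_zero f(2)] .
  have "integrable lebesgue (\<lambda>x::'a. C\<^sup>2 * indicator (cball 0 r) x :: real)"
    using emeasure_lborel_cball_finite[of "0::'a" r] by (intro integrable_mult_right) (simp add: integrable_indicator_iff)
  then have "integrable lebesgue (\<lambda>x. (cmod (f x))\<^sup>2)"
  proof (rule Bochner_Integration.integrable_bound)
    show "(\<lambda>x. (cmod (f x))\<^sup>2) \<in> borel_measurable lebesgue" using f(1) by measurable
    show "AE x in lebesgue. norm ((cmod (f x))\<^sup>2) \<le> norm (C\<^sup>2 * indicator (cball 0 r) x :: real)"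
    proof (rule AE_I2)
      fix x show "norm ((cmod (f x))\<^sup>2) \<le> norm (C\<^sup>2 * indicator (cball 0 r) x :: real)"
        using power_mono[OF f(2)[of x], of 2] f(3)[of x] by (cases "norm x \<le> r") auto
    qed
  qed
  then show ?thesis using f(1) by (simp add: L2_def)
qed

text \<open>
  Testing against \<open>\<psi>\<close> replaces pointwise convergence. After Fubini, the inner integral
  \<open>\<Theta> h\<close> pairs \<open>\<psi>\<close> with the translate of \<open>u\<close> by \<open>h = \<sigma> n y\<close>, twisted by the phase \<open>p\<close>. It
  is bounded by Cauchy and Schwarz and continuous at \<open>h = 0\<close>, so the outer integral against \<open>G\<close>
  converges by domination.
\<close>

lemma twisted_approximate_identity:
  fixes u \<psi> :: "'a::euclidean_space \<Rightarrow> complex" and p :: "'a \<Rightarrow> 'a \<Rightarrow> complex" and G :: "'a \<Rightarrow> real"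
  assumes u: "u \<in> L2" "u \<in> borel_measurable borel"
    and \<psi>: "\<psi> \<in> borel_measurable borel" "\<And>w. cmod (\<psi> w) \<le> 1" "\<And>w. norm w > r \<Longrightarrow> \<psi> w = 0"
    and p: "continuous_on UNIV (\<lambda>(h, w). p h w)" "\<And>h w. cmod (p h w) = 1" "\<And>w. p 0 w = 1"
    and G: "integrable lborel G" "\<And>y. 0 \<le> G y" and \<sigma>: "\<sigma> \<longlonglongrightarrow> 0"
  shows "(\<lambda>n. LINT w|lborel. \<psi> w * (LINT y|lborel. of_real (G y) * (u (w + \<sigma> n *\<^sub>R y) * p (\<sigma> n *\<^sub>R y) w)))
    \<longlonglongrightarrow> of_real (LINT y|lborel. G y) * (LINT w|lborel. \<psi> w * u w)"
proof -
  have \<psi>L: "\<psi> \<in> borel_measurable lebesgue" using \<psi>(1) by (intro measurable_completion) simp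
  have \<psi>2: "\<psi> \<in> L2" by (rule bounded_support_L2[OF \<psi>L \<psi>(2,3)])
  have pm: "(\<lambda>(h, w). p h w) \<in> borel_measurable borel" by (rule borel_measurable_continuous_onI[OF p(1)])
  have pm2: "(\<lambda>x. p (f x) (g x)) \<in> borel_measurable M" if "f \<in> borel_measurable M" "g \<in> borel_measurable M" for f g and M :: "'b measure"
    using measurable_compose[OF borel_measurable_Pair[OF that] pm] by simp
  define \<Theta> where "\<Theta> h = (LINT w|lborel. \<psi> w * (u (w + h) * p h w))" for h
  have um: "(\<lambda>w. u (w + h)) \<in> borel_measurable borel" for h using u(2) by measurable
  have tm: "(\<lambda>w. \<psi> w * (u (w + h) * p h w)) \<in> borel_measurable borel" for h
    by (intro borel_measurable_times \<psi>(1) um pm2) auto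
  have tb: "cmod (\<psi> w * (u (w + h) * p h w)) = cmod (\<psi> w) * cmod (u (w + h))" for w h by (simp add: norm_mult p(2))
  have absL: "integrable lebesgue (\<lambda>w. cmod (\<psi> w) * cmod (u (w + h)))" for h
    by (rule L2_abs_mult_integrable[OF \<psi>2 L2_translate(1)[OF u(1)]])
  have absm: "(\<lambda>w. cmod (\<psi> w) * cmod (u (w + h))) \<in> borel_measurable borel" for h using \<psi>(1) um[of h] by measurable
  have abs: "integrable lborel (\<lambda>w. cmod (\<psi> w) * cmod (u (w + h)))" for h
    using absL[of h] absm[of h] by (simp add: integrable_completion)
  have abs_le: "(LINT w|lborel. cmod (\<psi> w) * cmod (u (w + h))) \<le> L2_norm \<psi> * L2_norm u" for h
    using L2_Holder[OF \<psi>2 L2_translate(1)[OF u(1)], of h] absm[of h] L2_translate(2)[OF u(1), of h]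
    by (simp add: integral_completion)
  have ti: "integrable lborel (\<lambda>w. \<psi> w * (u (w + h) * p h w))" for h
    by (rule Bochner_Integration.integrable_bound[OF abs[of h]]) (use tm[of h] in \<open>auto simp: tb\<close>)
  have \<Theta>_le: "cmod (\<Theta> h) \<le> L2_norm \<psi> * L2_norm u" for h
    unfolding \<Theta>_def using abs_le[of h] by (intro order_trans[OF integral_norm_bound]) (simp add: tb)
  have Gm: "G \<in> borel_measurable borel" using G(1) by auto
  have swap: "(LINT w|lborel. \<psi> w * (LINT y|lborel. of_real (G y) * (u (w + s *\<^sub>R y) * p (s *\<^sub>R y) w)))
      = (LINT y|lborel. of_real (G y) * \<Theta> (s *\<^sub>R y))" for s
  proof -
    define f where "f = (\<lambda>(y, w). complex_of_real (G y) * (\<psi> w * (u (w + s *\<^sub>R y) * p (s *\<^sub>R y) w)))"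
    interpret lborel_pair: pair_sigma_finite "lborel :: 'a measure" "lborel :: 'a measure" ..
    have of_real_meas: "complex_of_real \<in> borel_measurable borel"
      by (intro borel_measurable_continuous_onI continuous_intros)
    have fm: "f \<in> borel_measurable (lborel \<Otimes>\<^sub>M lborel)"
    proof -
      have m1: "(\<lambda>x. fst x) \<in> (lborel \<Otimes>\<^sub>M lborel) \<rightarrow>\<^sub>M (borel :: 'a measure)" "(\<lambda>x. snd x) \<in> (lborel \<Otimes>\<^sub>M lborel) \<rightarrow>\<^sub>M (borel :: 'a measure)"
        by measurable
      have m2: "(\<lambda>x. s *\<^sub>R fst x) \<in> (lborel \<Otimes>\<^sub>M lborel) \<rightarrow>\<^sub>M (borel :: 'a measure)" "(\<lambda>x. snd x + s *\<^sub>R fst x) \<in> (lborel \<Otimes>\<^sub>M lborel) \<rightarrow>\<^sub>M (borel :: 'a measure)"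
        by measurable
      have "(\<lambda>x. complex_of_real (G (fst x)) * (\<psi> (snd x) * (u (snd x + s *\<^sub>R fst x) * p (s *\<^sub>R fst x) (snd x)))) \<in> borel_measurable (lborel \<Otimes>\<^sub>M lborel)"
        by (intro borel_measurable_times measurable_compose[OF measurable_compose[OF m1(1) Gm] of_real_meas] pm2 m1 m2 measurable_compose[OF m1(2) \<psi>(1)] measurable_compose[OF m2(2) u(2)])
      then show ?thesis by (simp add: f_def case_prod_unfold)
    qed
    have nf: "(LINT w|lborel. norm (f (y, w))) = G y * (LINT w|lborel. cmod (\<psi> w) * cmod (u (w + s *\<^sub>R y)))" for y
      using abs[of "s *\<^sub>R y"] G(2)[of y] by (simp add: f_def norm_mult[of "complex_of_real _"] tb)
    have fi: "integrable (lborel \<Otimes>\<^sub>M lborel) f"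
    proof (rule lborel_pair.Fubini_integrable[OF fm])
      have "(\<lambda>y. LINT w|lborel. norm (f (y, w))) \<in> borel_measurable lborel"
        using lborel.borel_measurable_lebesgue_integral[of "\<lambda>y w. norm (f (y, w))" lborel] fm by (simp add: case_prod_unfold)
      then show "integrable lborel (\<lambda>y. LINT w|lborel. norm (f (y, w)))"
      proof (rule Bochner_Integration.integrable_bound[OF integrable_mult_left[OF G(1), of "L2_norm \<psi> * L2_norm u"]])
        have "0 \<le> (LINT w|lborel. cmod (\<psi> w) * cmod (u (w + h)))" for h by (rule Bochner_Integration.integral_nonneg) simp
        then show "AE y in lborel. norm (LINT w|lborel. norm (f (y, w))) \<le> norm (G y * (L2_norm \<psi> * L2_norm u))"
          unfolding nf using abs_le G(2) by (intro AE_I2) (simp add: abs_mult mult_left_mono)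
      qed
      show "AE y in lborel. integrable lborel (\<lambda>w. f (y, w))"
        unfolding f_def prod.case by (intro AE_I2 integrable_mult_right ti)
    qed
    have "(LINT w|lborel. (LINT y|lborel. f (y, w))) = (LINT y|lborel. (LINT w|lborel. f (y, w)))"
      using lborel_pair.Fubini_integral[of "\<lambda>y w. f (y, w)"] fi by (simp add: case_prod_unfold)
    moreover have "(LINT y|lborel. f (y, w)) = \<psi> w * (LINT y|lborel. of_real (G y) * (u (w + s *\<^sub>R y) * p (s *\<^sub>R y) w))" for w
      unfolding f_def prod.case by (subst integral_mult_right_zero[symmetric]) (simp add: mult_ac)
    moreover have "(LINT w|lborel. f (y, w)) = of_real (G y) * \<Theta> (s *\<^sub>R y)" for y
      unfolding f_def prod.case \<Theta>_def by simp
    ultimately show ?thesis by simp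
  qed
  have \<Theta>_lim: "(\<lambda>n. \<Theta> (h n)) \<longlonglongrightarrow> (LINT w|lborel. \<psi> w * u w)" if h: "h \<longlonglongrightarrow> 0" for h
  proof -
    \<comment> \<open>For \<open>\<bar>h\<bar> \<le> 1\<close> only values of \<open>u\<close> on the ball of radius \<open>r + 1\<close> enter. The truncation is
        integrable, which \<open>u\<close> itself need not be, so translations are continuous on it in the
        mean.\<close>
    define v where "v w = indicator (cball 0 (r + 1)) w * u w" for w
    have "(\<lambda>w. indicator (cball 0 (r + 1)) w :: complex) \<in> L2"
      by (rule bounded_support_L2[where C=1 and r="r + 1"]) (auto simp: indicator_def intro!: measurable_completion)
    then have vi: "integrable lebesgue v" unfolding v_def[abs_def] by (rule L2_mult_integrable[OF _ u(1)])
    have vm: "v \<in> borel_measurable borel" unfolding v_def[abs_def]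
      by (intro borel_measurable_times borel_measurable_indicator u(2)) simp
    have vi': "integrable lborel v" using vi vm by (simp add: integrable_completion)
    have vt: "integrable lebesgue (\<lambda>x. v (x + a))" for a by (rule integrable_translation[OF vi])
    have vtm: "(\<lambda>x. v (x + a)) \<in> borel_measurable borel" for a using vm by measurable
    have vt': "integrable lborel (\<lambda>x. v (x + a))" for a using vt[of a] vtm[of a] by (simp add: integrable_completion)
    have L1: "(\<lambda>n. LINT x|lborel. norm (v (x + h n) - v x)) \<longlonglongrightarrow> 0"
    proof -
      have "(\<lambda>x. norm (v (x + h n) - v x)) \<in> borel_measurable borel" for n using vtm[of "h n"] vm by measurable
      then show ?thesis using L1_translation_tendsto[OF vi h] by (simp add: integral_completion)
    qed
    have L2: "(\<lambda>n. LINT x|lborel. norm (v x * (p (h n) x - 1))) \<longlonglongrightarrow> (LINT x|(lborel::'a measure). 0)"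
    proof (rule integral_dominated_convergence[where w="\<lambda>x. 2 * norm (v x)"])
      show "AE x in lborel. (\<lambda>n. norm (v x * (p (h n) x - 1))) \<longlonglongrightarrow> 0"
      proof (rule AE_I2)
        fix x :: 'a
        have "(\<lambda>n. (h n, x)) \<longlonglongrightarrow> (0, x)" by (intro tendsto_Pair h tendsto_const)
        then have "(\<lambda>n. (\<lambda>(h, w). p h w) (h n, x)) \<longlonglongrightarrow> (\<lambda>(h, w). p h w) (0, x)"
          by (rule continuous_on_tendsto_compose[OF p(1)]) auto
        then have "(\<lambda>n. p (h n) x) \<longlonglongrightarrow> 1" by (simp add: p(3))
        then have "(\<lambda>n. norm (v x * (p (h n) x - 1))) \<longlonglongrightarrow> norm (v x * (1 - 1))" by (intro tendsto_intros)
        then show "(\<lambda>n. norm (v x * (p (h n) x - 1))) \<longlonglongrightarrow> 0" by simp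
      qed
      show "AE x in lborel. norm (norm (v x * (p (h n) x - 1))) \<le> 2 * norm (v x)" for n
      proof (rule AE_I2)
        fix x :: 'a
        have p2: "norm (p (h n) x - 1) \<le> 2" using norm_triangle_ineq4[of "p (h n) x" 1] by (simp add: p(2))
        then show "norm (norm (v x * (p (h n) x - 1))) \<le> 2 * norm (v x)"
          using mult_left_mono[OF p2 norm_ge_zero[of "v x"]] by (simp add: norm_mult)
      qed
      show "(\<lambda>x. norm (v x * (p (h n) x - 1))) \<in> borel_measurable lborel" for n
      proof -
        have "(\<lambda>x. p (h n) x) \<in> borel_measurable borel" by (intro pm2) auto
        then show ?thesis using vm by simp
      qed
    qed (use vi' in auto)
    have i2: "integrable lborel (\<lambda>x. v x * (p (h n) x - 1))" for n
    proof (rule Bochner_Integration.integrable_bound[where f="\<lambda>x. 2 * norm (v x)"])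
      have "(\<lambda>x. p (h n) x) \<in> borel_measurable borel" by (intro pm2) auto
      then show "(\<lambda>x. v x * (p (h n) x - 1)) \<in> borel_measurable lborel" using vm by simp
      show "AE x in lborel. norm (v x * (p (h n) x - 1)) \<le> norm (2 * norm (v x))"
      proof (rule AE_I2)
        fix x :: 'a
        have p2: "norm (p (h n) x - 1) \<le> 2" using norm_triangle_ineq4[of "p (h n) x" 1] by (simp add: p(2))
        then show "norm (v x * (p (h n) x - 1)) \<le> norm (2 * norm (v x))"
          using mult_left_mono[OF p2 norm_ge_zero[of "v x"]] by (simp add: norm_mult)
      qed
    qed (use vi' in auto)
    have u0i: "integrable lborel (\<lambda>w. \<psi> w * u w)" using ti[of 0] by (simp add: p(3))
    have diff: "norm (\<Theta> (h n) - (LINT w|lborel. \<psi> w * u w)) \<le> (LINT x|lborel. norm (v (x + h n) - v x)) + (LINT x|lborel. norm (v x * (p (h n) x - 1)))"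
      if hn: "norm (h n) \<le> 1" for n
    proof -
      have i1: "integrable lborel (\<lambda>x. norm (v (x + h n) - v x))" using vt' vi' by auto
      have "\<Theta> (h n) - (LINT w|lborel. \<psi> w * u w) = (LINT w|lborel. \<psi> w * (u (w + h n) * p (h n) w) - \<psi> w * u w)"
        unfolding \<Theta>_def using ti u0i by simp
      also have "norm \<dots> \<le> (LINT w|lborel. norm (\<psi> w * (u (w + h n) * p (h n) w) - \<psi> w * u w))" by (rule integral_norm_bound)
      also have "\<dots> \<le> (LINT x|lborel. norm (v (x + h n) - v x) + norm (v x * (p (h n) x - 1)))"
      proof (rule integral_mono)
        show "integrable lborel (\<lambda>w. norm (\<psi> w * (u (w + h n) * p (h n) w) - \<psi> w * u w))" using ti u0i by auto
        show "integrable lborel (\<lambda>x. norm (v (x + h n) - v x) + norm (v x * (p (h n) x - 1)))" using i1 i2 by auto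
        fix w
        show "norm (\<psi> w * (u (w + h n) * p (h n) w) - \<psi> w * u w) \<le> norm (v (w + h n) - v w) + norm (v w * (p (h n) w - 1))"
        proof (cases "norm w \<le> r")
          case True
          then have "w + h n \<in> cball 0 (r + 1)" "w \<in> cball 0 (r + 1)"
            using norm_triangle_ineq[of w "h n"] hn by auto
          then have vw: "v (w + h n) = u (w + h n)" "v w = u w" by (auto simp: v_def)
          have "\<psi> w * (u (w + h n) * p (h n) w) - \<psi> w * u w = \<psi> w * ((v (w + h n) - v w) * p (h n) w + v w * (p (h n) w - 1))"
            unfolding vw by (simp add: algebra_simps)
          then have "norm (\<psi> w * (u (w + h n) * p (h n) w) - \<psi> w * u w) = norm (\<psi> w) * norm ((v (w + h n) - v w) * p (h n) w + v w * (p (h n) w - 1))"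
            by (simp only: norm_mult)
          also have "\<dots> \<le> 1 * (norm ((v (w + h n) - v w) * p (h n) w) + norm (v w * (p (h n) w - 1)))"
            by (intro mult_mono \<psi>(2) norm_triangle_ineq) auto
          finally show ?thesis by (simp add: norm_mult p(2))
        qed (simp add: \<psi>(3))
      qed
      finally show ?thesis using i1 i2 by simp
    qed
    have ev: "eventually (\<lambda>n. norm (h n) \<le> 1) sequentially"
      using h by (auto simp: tendsto_iff dist_norm elim!: allE[of _ 1] eventually_mono)
    have "(\<lambda>n. \<Theta> (h n) - (LINT w|lborel. \<psi> w * u w)) \<longlonglongrightarrow> 0"
    proof (rule Lim_null_comparison)
      show "\<forall>\<^sub>F n in sequentially. norm (\<Theta> (h n) - (LINT w|lborel. \<psi> w * u w)) \<le> (LINT x|lborel. norm (v (x + h n) - v x)) + (LINT x|lborel. norm (v x * (p (h n) x - 1)))"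
        using ev by eventually_elim (rule diff)
      show "(\<lambda>n. (LINT x|lborel. norm (v (x + h n) - v x)) + (LINT x|lborel. norm (v x * (p (h n) x - 1)))) \<longlonglongrightarrow> 0"
        using tendsto_add[OF L1 L2] by simp
    qed
    then show ?thesis by (rule Lim_null[THEN iffD2])
  qed
  have \<Theta>m: "(\<lambda>y. \<Theta> (s *\<^sub>R y)) \<in> borel_measurable borel" for s
  proof -
    have m2: "(\<lambda>x. s *\<^sub>R fst x) \<in> (borel \<Otimes>\<^sub>M lborel) \<rightarrow>\<^sub>M (borel :: 'a measure)" "(\<lambda>x. snd x + s *\<^sub>R fst x) \<in> (borel \<Otimes>\<^sub>M lborel) \<rightarrow>\<^sub>M (borel :: 'a measure)"
      "(\<lambda>x. snd x) \<in> (borel \<Otimes>\<^sub>M lborel) \<rightarrow>\<^sub>M (borel :: 'a measure)"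
      by measurable
    have "(\<lambda>x. \<psi> (snd x) * (u (snd x + s *\<^sub>R fst x) * p (s *\<^sub>R fst x) (snd x))) \<in> borel_measurable (borel \<Otimes>\<^sub>M lborel)"
      by (intro borel_measurable_times pm2 m2 measurable_compose[OF m2(3) \<psi>(1)] measurable_compose[OF m2(2) u(2)])
    then show ?thesis unfolding \<Theta>_def
      using lborel.borel_measurable_lebesgue_integral[of "\<lambda>y w. \<psi> w * (u (w + s *\<^sub>R y) * p (s *\<^sub>R y) w)" borel]
      by (simp add: case_prod_unfold)
  qed
  have "(\<lambda>n. LINT y|lborel. of_real (G y) * \<Theta> (\<sigma> n *\<^sub>R y)) \<longlonglongrightarrow> (LINT y|lborel. of_real (G y) * (LINT w|lborel. \<psi> w * u w))"
  proof (rule integral_dominated_convergence[where w="\<lambda>y. G y * (L2_norm \<psi> * L2_norm u)"])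
    show "integrable lborel (\<lambda>y. G y * (L2_norm \<psi> * L2_norm u))" using G(1) by auto
    show "(\<lambda>y. complex_of_real (G y) * (LINT w|lborel. \<psi> w * u w)) \<in> borel_measurable lborel" using Gm by simp
    show "(\<lambda>y. complex_of_real (G y) * \<Theta> (\<sigma> n *\<^sub>R y)) \<in> borel_measurable lborel" for n using Gm \<Theta>m[of "\<sigma> n"] by simp
    show "AE y in lborel. (\<lambda>n. complex_of_real (G y) * \<Theta> (\<sigma> n *\<^sub>R y)) \<longlonglongrightarrow> complex_of_real (G y) * (LINT w|lborel. \<psi> w * u w)"
    proof (rule AE_I2)
      fix y :: 'a
      have "(\<lambda>n. \<sigma> n *\<^sub>R y) \<longlonglongrightarrow> 0 *\<^sub>R y" by (rule tendsto_scaleR[OF \<sigma> tendsto_const])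
      then have "(\<lambda>n. \<Theta> (\<sigma> n *\<^sub>R y)) \<longlonglongrightarrow> (LINT w|lborel. \<psi> w * u w)" by (intro \<Theta>_lim) simp
      then show "(\<lambda>n. complex_of_real (G y) * \<Theta> (\<sigma> n *\<^sub>R y)) \<longlonglongrightarrow> complex_of_real (G y) * (LINT w|lborel. \<psi> w * u w)"
        by (intro tendsto_mult tendsto_const)
    qed
    show "AE y in lborel. norm (complex_of_real (G y) * \<Theta> (\<sigma> n *\<^sub>R y)) \<le> G y * (L2_norm \<psi> * L2_norm u)" for n
      using \<Theta>_le G(2) by (intro AE_I2) (simp add: norm_mult mult_left_mono)
  qed
  then show ?thesis unfolding swap by simp
qed

section \<open>The Mehler kernel\<close>

lemma lebesgue_borel_representative:
  fixes f :: "'a::euclidean_space \<Rightarrow> complex"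
  assumes "f \<in> borel_measurable lebesgue"
  shows "\<exists>g\<in>borel_measurable borel. AE x in lebesgue. f x = g x"
proof -
  have "(\<lambda>x. Re (f x)) \<in> borel_measurable lebesgue" "(\<lambda>x. Im (f x)) \<in> borel_measurable lebesgue"
    using assms by measurable
  from completion_ex_borel_measurable_real[OF this(1)] completion_ex_borel_measurable_real[OF this(2)]
  obtain a b where ab: "a \<in> borel_measurable lborel" "AE x in lborel. Re (f x) = a x"
    "b \<in> borel_measurable lborel" "AE x in lborel. Im (f x) = b x" by auto
  have m: "(\<lambda>x. complex_of_real (a x) + \<i> * complex_of_real (b x)) \<in> borel_measurable borel"
    using ab(1,3) by simp
  have "AE x in lborel. f x = complex_of_real (a x) + \<i> * complex_of_real (b x)"
    using ab(2,4) by eventually_elim (simp add: complex_eq_iff)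
  then have "AE x in lebesgue. f x = complex_of_real (a x) + \<i> * complex_of_real (b x)" by (rule AE_completion)
  then show ?thesis by (rule bexI[OF _ m])
qed

lemma symplectic_self [simp]: "symplectic w w = 0"
  by (simp add: symplectic_def mult.commute)

lemma symplectic_add: "symplectic (z + z') w = symplectic z w + symplectic z' w"
  by (rule linear_add[OF bounded_linear.linear[OF bounded_linear_symplectic]])

lemma continuous_symplectic: "continuous_on UNIV (\<lambda>(z, w). symplectic z w)"
  unfolding symplectic_def case_prod_unfold by (intro continuous_intros)

lemma gaussian_integral_pos:
  "0 < (LINT y|lborel. exp (- (y \<bullet> y)) :: real)" (is "0 < integral\<^sup>L _ ?G")
proof -
  have m: "?G \<in> borel_measurable borel" by (intro borel_measurable_continuous_onI continuous_intros)
  have i: "integrable lborel ?G" using integrable_gaussian[of 1 "0::'a"] m by (simp add: integrable_completion)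
  have "integral\<^sup>L lborel ?G \<noteq> 0"
  proof
    assume "integral\<^sup>L lborel ?G = 0"
    then have "AE y in (lborel :: 'a measure). ?G y = 0" by (subst (asm) integral_nonneg_eq_0_iff_AE[OF i]) auto
    then have "AE y in (lborel :: 'a measure). False" by simp
    then show False by (simp add: eventually_False ae_filter_eq_bot_iff)
  qed
  moreover have "0 \<le> integral\<^sup>L lborel ?G" by (rule Bochner_Integration.integral_nonneg) simp
  ultimately show ?thesis by linarith
qed

text \<open>
  The phase of the Mehler kernel: the width \<open>coth_coeff\<close> at \<open>\<tau> = - i t\<close> is purely imaginary, so
  the Gaussian becomes a pure oscillation.
\<close>

definition mehler_phase :: "real \<Rightarrow> real \<Rightarrow> complex^'d::finite \<Rightarrow> complex^'d \<Rightarrow> real" where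
  "mehler_phase lam t w z = lam / 4 * (cos (lam * t) / sin (lam * t)) * ((w - z) \<bullet> (w - z)) + - (lam / 2) * symplectic w z"

lemma sinh_imaginary: "sinh (complex_of_real lam * Complex 0 (- t)) = Complex 0 (- sin (lam * t))"
  "cosh (complex_of_real lam * Complex 0 (- t)) = complex_of_real (cos (lam * t))"
  by (simp_all add: complex_eq_iff sinh_cosh_parts)

lemma cnj_heat_imaginary:
  fixes w :: "complex^'d::finite"
  assumes "sin (lam * t) \<noteq> 0"
  shows "cnj (heat lam w (Complex 0 (- t)) z) = (1 / Complex 0 (sin (lam * t))) ^ CARD('d) * cis (mehler_phase lam t w z)"
proof -
  have b: "coth_coeff lam (Complex 0 (- t)) = \<i> * complex_of_real (lam / 4 * (cos (lam * t) / sin (lam * t)))"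
    unfolding coth_coeff_def sinh_imaginary using assms by (simp add: complex_eq_iff Re_divide Im_divide power2_eq_square)
  have "cnj (1 / sinh (complex_of_real lam * Complex 0 (- t))) = 1 / Complex 0 (sin (lam * t))"
    unfolding sinh_imaginary by (simp add: complex_eq_iff Re_divide Im_divide)
  moreover have "cnj (gaussian (coth_coeff lam (Complex 0 (- t))) (lam / 2) w z) = cis (mehler_phase lam t w z)"
    unfolding cnj_gaussian b
    unfolding gaussian_def mehler_phase_def cis_conv_exp symplectic_antisym[of w z]
    by (simp add: inner_diff_left inner_diff_right inner_commute algebra_simps)
  ultimately show ?thesis unfolding heat_def complex_cnj_mult complex_cnj_power by simp
qed

lemma sin_le_cmod_sinh: "\<bar>sin (Im z)\<bar> \<le> cmod (sinh z)" for z :: complex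
  by (rule power2_le_imp_le) (simp_all add: cmod_sinh_square)

text \<open>
  Uniform down to \<open>\<epsilon> = 0\<close>, in contrast to the bounds on a fixed line: off the resonances
  \<open>sin (\<lambda>t) = 0\<close>, the modulus of \<open>sinh\<close> is at least \<open>\<bar>sin (\<lambda>t)\<bar>\<close> for every \<open>\<epsilon>\<close>.
\<close>

lemma heat_uniform_bound:
  fixes w :: "complex^'d::finite"
  assumes "lam \<noteq> 0" "0 < \<epsilon>" "sin (lam * t) \<noteq> 0"
  shows "cmod (heat lam w (Complex \<epsilon> (- t)) z) \<le> (1 / \<bar>sin (lam * t)\<bar>) ^ CARD('d)"
proof -
  have s: "\<bar>sin (lam * t)\<bar> \<le> cmod (sinh (complex_of_real lam * Complex \<epsilon> (- t)))"
    using sin_le_cmod_sinh[of "complex_of_real lam * Complex \<epsilon> (- t)"] by simp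
  then have "(1 / cmod (sinh (complex_of_real lam * Complex \<epsilon> (- t)))) ^ CARD('d) \<le> (1 / \<bar>sin (lam * t)\<bar>) ^ CARD('d)"
    using assms(3) by (intro power_mono divide_left_mono mult_pos_pos) auto
  moreover have "0 \<le> Re (coth_coeff lam (Complex \<epsilon> (- t)))"
    using heat_rate_le[OF assms(1,2), of "Complex \<epsilon> (- t)"] heat_rate_pos[OF assms(1,2)] by simp
  then have "cmod (gaussian (coth_coeff lam (Complex \<epsilon> (- t))) (lam / 2) w z) \<le> 1" by (simp add: cmod_gaussian)
  ultimately have "(1 / cmod (sinh (complex_of_real lam * Complex \<epsilon> (- t)))) ^ CARD('d) * cmod (gaussian (coth_coeff lam (Complex \<epsilon> (- t))) (lam / 2) w z)
      \<le> (1 / \<bar>sin (lam * t)\<bar>) ^ CARD('d) * 1"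
    by (intro mult_mono) auto
  then show ?thesis by (simp add: heat_def norm_mult norm_power norm_divide)
qed

text \<open>
  The substitution \<open>z = w + \<sigma> y\<close>, with \<open>\<sigma>\<^sup>2\<close> the width of the heat kernel at time \<open>\<epsilon>\<close>, exhibits
  the pairing as a twisted approximate identity. Its Jacobian \<open>\<sigma> ^ (2 d)\<close> cancels the singular
  factor \<open>sinh ^ (- d)\<close>, and the twist is a function of \<open>\<sigma> y\<close> since the symplectic form vanishes
  on the diagonal.
\<close>

lemma heat_real_pairing:
  fixes w :: "complex^'d::finite"
  assumes lam: "lam \<noteq> 0" and eps: "0 < \<epsilon>" and u: "u \<in> borel_measurable borel"
  defines "\<sigma> \<equiv> sqrt (4 / lam * (sinh (lam * \<epsilon>) / cosh (lam * \<epsilon>)))"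
  shows "L2_inner u (heat lam w (complex_of_real \<epsilon>)) = complex_of_real ((4 / (lam * cosh (lam * \<epsilon>))) ^ CARD('d)) *
    (LINT y|lborel. complex_of_real (exp (- (y \<bullet> y))) * (u (w + \<sigma> *\<^sub>R y) * cis (lam / 2 * symplectic (\<sigma> *\<^sub>R y) w)))"
proof -
  let ?s = "sinh (lam * \<epsilon>)" and ?c = "cosh (lam * \<epsilon>)"
  define b where "b = lam / 4 * (?c / ?s)"
  have s0: "?s \<noteq> 0" using lam eps by simp
  have "0 < lam * ?s" using lam eps by (cases "lam > 0") (auto simp: zero_less_mult_iff mult_less_0_iff not_less)
  then have "0 < lam / ?s" by (simp add: zero_less_mult_iff zero_less_divide_iff)
  then have b: "0 < b" using mult_pos_pos[of "lam / ?s" "?c / 4"] by (simp add: b_def)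
  have \<sigma>b: "\<sigma> = sqrt (1 / b)" by (simp add: \<sigma>_def b_def)
  have \<sigma>2: "\<sigma>\<^sup>2 = 1 / b" and \<sigma>: "0 < \<sigma>" unfolding \<sigma>b using b by simp_all
  have tr: "sinh (complex_of_real lam * complex_of_real \<epsilon>) = complex_of_real ?s" "cosh (complex_of_real lam * complex_of_real \<epsilon>) = complex_of_real ?c"
    by (simp_all add: complex_eq_iff sinh_cosh_parts)
  have h: "cnj (heat lam w (complex_of_real \<epsilon>) z) = complex_of_real ((1 / ?s) ^ CARD('d)) * (complex_of_real (exp (- (b * ((z - w) \<bullet> (z - w))))) * cis (lam / 2 * symplectic z w))" for z
  proof -
    have "coth_coeff lam (complex_of_real \<epsilon>) = complex_of_real b" by (simp add: coth_coeff_def tr b_def)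
    then have "cnj (gaussian (coth_coeff lam (complex_of_real \<epsilon>)) (lam / 2) w z) = complex_of_real (exp (- (b * ((z - w) \<bullet> (z - w))))) * cis (lam / 2 * symplectic z w)"
      unfolding cnj_gaussian by (simp add: gaussian_def cis_conv_exp exp_of_real[symmetric] exp_add[symmetric])
    then show ?thesis by (simp add: heat_def tr)
  qed
  define f where "f z = u z * cnj (heat lam w (complex_of_real \<epsilon>) z)" for z
  have hm: "heat lam w (complex_of_real \<epsilon>) \<in> borel_measurable borel"
    unfolding heat_def[abs_def] by (intro borel_measurable_continuous_onI continuous_intros gaussian_continuous)
  have fm: "f \<in> borel_measurable borel"
    unfolding f_def[abs_def]
    by (intro borel_measurable_times u borel_measurable_continuous_on[OF continuous_on_cnj[OF continuous_on_id] hm])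
  have "L2_inner u (heat lam w (complex_of_real \<epsilon>)) = (LINT z|lborel. f z)"
    unfolding L2_inner_def f_def[symmetric] using fm by (simp add: integral_completion)
  also have "\<dots> = of_real (\<sigma> ^ DIM(complex^'d)) * (LINT y|lborel. f (w + \<sigma> *\<^sub>R y))"
    by (rule integral_scaling[OF fm \<sigma>])
  also have "(\<lambda>y. f (w + \<sigma> *\<^sub>R y)) = (\<lambda>y. complex_of_real ((1 / ?s) ^ CARD('d)) * (complex_of_real (exp (- (y \<bullet> y))) * (u (w + \<sigma> *\<^sub>R y) * cis (lam / 2 * symplectic (\<sigma> *\<^sub>R y) w))))"
  proof
    fix y
    have "b * ((w + \<sigma> *\<^sub>R y - w) \<bullet> (w + \<sigma> *\<^sub>R y - w)) = (b * \<sigma>\<^sup>2) * (y \<bullet> y)" by (simp add: power2_eq_square)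
    also have "\<dots> = y \<bullet> y" using b \<sigma>2 by simp
    finally show "f (w + \<sigma> *\<^sub>R y) = complex_of_real ((1 / ?s) ^ CARD('d)) * (complex_of_real (exp (- (y \<bullet> y))) * (u (w + \<sigma> *\<^sub>R y) * cis (lam / 2 * symplectic (\<sigma> *\<^sub>R y) w)))"
      unfolding f_def h symplectic_add symplectic_self by (simp add: mult_ac)
  qed
  also have "of_real (\<sigma> ^ DIM(complex^'d)) * (LINT y|lborel. complex_of_real ((1 / ?s) ^ CARD('d)) * (complex_of_real (exp (- (y \<bullet> y))) * (u (w + \<sigma> *\<^sub>R y) * cis (lam / 2 * symplectic (\<sigma> *\<^sub>R y) w))))
      = complex_of_real (\<sigma> ^ DIM(complex^'d) * (1 / ?s) ^ CARD('d)) * (LINT y|lborel. complex_of_real (exp (- (y \<bullet> y))) * (u (w + \<sigma> *\<^sub>R y) * cis (lam / 2 * symplectic (\<sigma> *\<^sub>R y) w)))"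
    by (simp add: mult.assoc)
  also have "\<sigma> ^ DIM(complex^'d) * (1 / ?s) ^ CARD('d) = (4 / (lam * ?c)) ^ CARD('d)"
  proof -
    have "\<sigma> ^ DIM(complex^'d) = (\<sigma>\<^sup>2) ^ CARD('d)" by (simp add: power_mult[symmetric] mult.commute)
    then have "\<sigma> ^ DIM(complex^'d) * (1 / ?s) ^ CARD('d) = ((1 / b) * (1 / ?s)) ^ CARD('d)"
      unfolding \<sigma>2 by (simp only: power_mult_distrib)
    also have "(1 / b) * (1 / ?s) = 4 / (lam * ?c)" using s0 by (simp add: b_def)
    finally show ?thesis .
  qed
  finally show ?thesis .
qed

text \<open>
  Mehler's formula. Both sides of \<open>heat_pairing\<close> are followed to \<open>\<epsilon> = 0\<close>. The right-hand side
  converges pointwise in \<open>w\<close> by domination, as \<open>u\<^sub>0\<close> is integrable and the kernels are uniformly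
  bounded. The left-hand side converges to \<open>c * u\<close> weakly. The two limits agree when tested
  against bounded functions of bounded support, hence almost everywhere. The constant comes out
  independent of the solution and of the spectral measure.
\<close>

lemma schroedinger_kernel:
  fixes lam t :: real
  assumes lam: "lam \<noteq> 0" and sin: "sin (lam * t) \<noteq> 0" and t: "0 \<le> t"
  shows "\<exists>c. \<forall>P u\<^sub>0 u. spectral_resolution P (special_hermite_closure lam) \<longrightarrow> u\<^sub>0 \<in> L2 \<longrightarrow> integrable lebesgue u\<^sub>0 \<longrightarrow>
    (u\<^sub>0, u) \<in> spectral_integral P (\<lambda>x. exp (- \<i> * complex_of_real (t * x))) \<longrightarrow>
    (AE w in lebesgue. u w = (LINT z|lebesgue. c * cis (mehler_phase lam t w (z :: complex^'d::finite)) * u\<^sub>0 z))"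
proof -
  define S where "S = (1 / Complex 0 (sin (lam * t))) ^ CARD('d)"
  define G where "G y = exp (- (y \<bullet> y))" for y :: "complex^'d"
  define c where "c = (4 / lam) ^ CARD('d) * (LINT y|lborel. G y)"
  have c0: "c \<noteq> 0" using gaussian_integral_pos[where 'a="complex^'d"] lam by (simp add: c_def G_def[abs_def])
  have Gi: "integrable lborel G"
  proof -
    have m: "G \<in> borel_measurable borel" unfolding G_def[abs_def] by (intro borel_measurable_continuous_onI continuous_intros)
    show ?thesis using integrable_gaussian[of 1 "0::complex^'d"] m by (simp add: integrable_completion G_def[abs_def])
  qed
  have main: "AE w in lebesgue. u w = (LINT z|lebesgue. S / complex_of_real c * cis (mehler_phase lam t w z) * u\<^sub>0 z)"
    if P: "spectral_resolution P (special_hermite_closure lam)" and u0: "u\<^sub>0 \<in> L2" "integrable lebesgue u\<^sub>0"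
      and u: "(u\<^sub>0, u) \<in> spectral_integral P (\<lambda>x. exp (- \<i> * complex_of_real (t * x)))" for P and u\<^sub>0 u :: "complex^'d \<Rightarrow> complex"
  proof -
    have uL: "u \<in> L2" using u by (simp add: spectral_integral_def)
    \<comment> \<open>Product measurability in Fubini's theorem is for Borel functions, whereas \<open>u\<close> is Lebesgue
        measurable only.\<close>
    obtain v where v: "v \<in> borel_measurable borel" "AE x in lebesgue. u x = v x"
      using lebesgue_borel_representative[OF L2_measurable[OF uL]] by auto
    have vL: "v \<in> L2"
    proof (rule L2_dominated(1)[OF uL, where C=1])
      show "v \<in> borel_measurable lebesgue" using v(1) by (intro measurable_completion) simp
      show "AE z in lebesgue. cmod (v z) \<le> 1 * cmod (u z)" using v(2) by eventually_elim simp
    qed simp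
    define \<epsilon> where "\<epsilon> n = 1 / real (Suc n)" for n
    have \<epsilon>: "0 < \<epsilon> n" for n by (simp add: \<epsilon>_def)
    have \<epsilon>lim: "\<epsilon> \<longlonglongrightarrow> 0" unfolding \<epsilon>_def using lim_inverse_n'[THEN LIMSEQ_Suc] by simp
    define M where "M n w = L2_inner u\<^sub>0 (heat lam w (Complex (\<epsilon> n) (- t)))" for n w
    define R where "R w = (LINT z|lebesgue. S * cis (mehler_phase lam t w z) * u\<^sub>0 z)" for w
    define \<sigma> where "\<sigma> n = sqrt (4 / lam * (sinh (lam * \<epsilon> n) / cosh (lam * \<epsilon> n)))" for n
    define C where "C n = (4 / (lam * cosh (lam * \<epsilon> n))) ^ CARD('d)" for n
    define A where "A n w = (LINT y|lborel. complex_of_real (G y) * (v (w + \<sigma> n *\<^sub>R y) * cis (lam / 2 * symplectic (\<sigma> n *\<^sub>R y) w)))" for n w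
    \<comment> \<open>\<open>M\<close> is computed in two ways: here as a twisted convolution of \<open>u\<close>, and in \<open>M_lim\<close> as an
        integral of \<open>u\<^sub>0\<close>.\<close>
    have MA: "M n w = complex_of_real (C n) * A n w" for n w
    proof -
      have "M n w = L2_inner u (heat lam w (complex_of_real (\<epsilon> n)))"
        unfolding M_def by (rule heat_pairing[OF lam \<epsilon> P u0(1) u t, symmetric])
      also have "\<dots> = L2_inner v (heat lam w (complex_of_real (\<epsilon> n)))"
      proof (rule L2_inner_cong)
        show "heat lam w (complex_of_real (\<epsilon> n)) \<in> L2" by (rule heat_L2(1)[OF lam \<epsilon>]) simp
        then show "heat lam w (complex_of_real (\<epsilon> n)) \<in> L2" .
      qed (use uL vL v(2) in \<open>auto simp: L2_eq_def\<close>)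
      also have "\<dots> = complex_of_real (C n) * A n w"
        unfolding heat_real_pairing[OF lam \<epsilon> v(1)] C_def A_def G_def \<sigma>_def ..
      finally show ?thesis .
    qed
    define B where "B = (LINT z|lebesgue. cmod (u\<^sub>0 z)) * (1 / \<bar>sin (lam * t)\<bar>) ^ CARD('d)"
    have M_le: "cmod (M n w) \<le> B" for n w
    proof -
      have "cmod (M n w) \<le> (LINT z|lebesgue. cmod (u\<^sub>0 z * cnj (heat lam w (Complex (\<epsilon> n) (- t)) z)))"
        unfolding M_def L2_inner_def by (rule integral_norm_bound)
      also have "\<dots> \<le> (LINT z|lebesgue. cmod (u\<^sub>0 z) * (1 / \<bar>sin (lam * t)\<bar>) ^ CARD('d))"
      proof (rule integral_mono)
        show "integrable lebesgue (\<lambda>z. cmod (u\<^sub>0 z * cnj (heat lam w (Complex (\<epsilon> n) (- t)) z)))"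
          using L2_inner_integrable[OF u0(1) heat_L2(1)[OF lam \<epsilon>[of n], of "Complex (\<epsilon> n) (- t)" w]] by auto
        show "integrable lebesgue (\<lambda>z. cmod (u\<^sub>0 z) * (1 / \<bar>sin (lam * t)\<bar>) ^ CARD('d))"
          using u0(2) by (intro integrable_mult_left) auto
        show "cmod (u\<^sub>0 z * cnj (heat lam w (Complex (\<epsilon> n) (- t)) z)) \<le> cmod (u\<^sub>0 z) * (1 / \<bar>sin (lam * t)\<bar>) ^ CARD('d)" for z
          unfolding norm_mult complex_mod_cnj by (intro mult_left_mono heat_uniform_bound[OF lam \<epsilon> sin]) simp
      qed
      finally show ?thesis by (simp add: B_def)
    qed
    have M_lim: "(\<lambda>n. M n w) \<longlonglongrightarrow> R w" for w
    proof -
      have "(\<lambda>n. LINT z|lebesgue. u\<^sub>0 z * cnj (heat lam w (Complex (\<epsilon> n) (- t)) z)) \<longlonglongrightarrow> (LINT z|lebesgue. u\<^sub>0 z * cnj (heat lam w (Complex 0 (- t)) z))"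
      proof (rule integral_dominated_convergence[where w="\<lambda>z. cmod (u\<^sub>0 z) * (1 / \<bar>sin (lam * t)\<bar>) ^ CARD('d)"])
        have um: "u\<^sub>0 \<in> borel_measurable lebesgue" using u0 by auto
        have hm: "(\<lambda>z. cnj (heat lam w \<tau> z)) \<in> borel_measurable lebesgue" for \<tau>
          by (intro continuous_measurable_lebesgue continuous_intros heat_continuous)
        show "(\<lambda>z. u\<^sub>0 z * cnj (heat lam w (Complex 0 (- t)) z)) \<in> borel_measurable lebesgue" by (intro borel_measurable_times um hm)
        show "(\<lambda>z. u\<^sub>0 z * cnj (heat lam w (Complex (\<epsilon> n) (- t)) z)) \<in> borel_measurable lebesgue" for n by (intro borel_measurable_times um hm)
        show "integrable lebesgue (\<lambda>z. cmod (u\<^sub>0 z) * (1 / \<bar>sin (lam * t)\<bar>) ^ CARD('d))" using u0(2) by (intro integrable_mult_left) auto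
        show "AE z in lebesgue. (\<lambda>n. u\<^sub>0 z * cnj (heat lam w (Complex (\<epsilon> n) (- t)) z)) \<longlonglongrightarrow> u\<^sub>0 z * cnj (heat lam w (Complex 0 (- t)) z)"
        proof (rule AE_I2)
          fix z
          have "sinh (complex_of_real lam * Complex 0 (- t)) \<noteq> 0" unfolding sinh_imaginary using sin by (simp add: complex_eq_iff)
          from DERIV_isCont[OF heat_has_field_derivative[OF this]]
          have cont: "isCont (\<lambda>\<tau>. heat lam w \<tau> z) (Complex 0 (- t))" .
          have "(\<lambda>n. Complex (\<epsilon> n) (- t)) \<longlonglongrightarrow> Complex 0 (- t)" by (intro tendsto_Complex \<epsilon>lim tendsto_const)
          from isCont_tendsto_compose[OF cont this]
          show "(\<lambda>n. u\<^sub>0 z * cnj (heat lam w (Complex (\<epsilon> n) (- t)) z)) \<longlonglongrightarrow> u\<^sub>0 z * cnj (heat lam w (Complex 0 (- t)) z)"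
            by (intro tendsto_mult tendsto_const tendsto_cnj)
        qed
        show "AE z in lebesgue. norm (u\<^sub>0 z * cnj (heat lam w (Complex (\<epsilon> n) (- t)) z)) \<le> cmod (u\<^sub>0 z) * (1 / \<bar>sin (lam * t)\<bar>) ^ CARD('d)" for n
          unfolding norm_mult complex_mod_cnj by (intro AE_I2 mult_left_mono heat_uniform_bound[OF lam \<epsilon> sin]) simp
      qed
      then show ?thesis unfolding M_def L2_inner_def R_def cnj_heat_imaginary[OF sin] S_def by (simp add: mult_ac)
    qed
    have Am: "A n \<in> borel_measurable borel" for n
    proof -
      have m: "(\<lambda>x. fst x) \<in> (borel \<Otimes>\<^sub>M lborel) \<rightarrow>\<^sub>M (borel :: (complex^'d) measure)" "(\<lambda>x. snd x) \<in> (borel \<Otimes>\<^sub>M lborel) \<rightarrow>\<^sub>M (borel :: (complex^'d) measure)"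
        "(\<lambda>x. \<sigma> n *\<^sub>R snd x) \<in> (borel \<Otimes>\<^sub>M lborel) \<rightarrow>\<^sub>M (borel :: (complex^'d) measure)" "(\<lambda>x. fst x + \<sigma> n *\<^sub>R snd x) \<in> (borel \<Otimes>\<^sub>M lborel) \<rightarrow>\<^sub>M (borel :: (complex^'d) measure)"
        by measurable
      have c1: "(\<lambda>y. complex_of_real (G y)) \<in> borel_measurable borel" unfolding G_def by (intro borel_measurable_continuous_onI continuous_intros)
      have c2: "(\<lambda>x. cis (lam / 2 * (\<lambda>(z, w). symplectic z w) x)) \<in> borel_measurable (borel :: ((complex^'d) \<times> (complex^'d)) measure)"
        by (intro borel_measurable_continuous_onI continuous_on_cis continuous_on_mult continuous_on_const continuous_symplectic)
      have "(\<lambda>x. complex_of_real (G (snd x)) * (v (fst x + \<sigma> n *\<^sub>R snd x) * cis (lam / 2 * (\<lambda>(z, w). symplectic z w) (\<sigma> n *\<^sub>R snd x, fst x)))) \<in> borel_measurable (borel \<Otimes>\<^sub>M lborel)"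
        by (intro borel_measurable_times measurable_compose[OF m(2) c1] measurable_compose[OF m(4) v(1)] measurable_compose[OF borel_measurable_Pair[OF m(3,1)] c2])
      then show ?thesis unfolding A_def[abs_def]
        using lborel.borel_measurable_lebesgue_integral[of "\<lambda>w y. complex_of_real (G y) * (v (w + \<sigma> n *\<^sub>R y) * cis (lam / 2 * symplectic (\<sigma> n *\<^sub>R y) w))" borel]
        by (simp add: case_prod_unfold)
    qed
    have Mm: "M n \<in> borel_measurable borel" for n unfolding MA[abs_def] using Am by simp
    have Rm: "R \<in> borel_measurable borel" by (rule borel_measurable_LIMSEQ_metric[OF Mm M_lim])
    have R_le: "cmod (R w) \<le> B" for w by (rule LIMSEQ_le_const2[OF tendsto_norm[OF M_lim]]) (use M_le in auto)
    define f where "f w = complex_of_real c * v w - R w" for w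
    have fm: "f \<in> borel_measurable borel" unfolding f_def[abs_def] using v(1) Rm by simp
    \<comment> \<open>Testing with the conjugate sign of \<open>f\<close>, cut off to a ball, detects the integral of \<open>\<bar>f\<bar>\<close>
        over the ball.\<close>
    have ball: "AE w in lborel. norm w \<le> real k \<longrightarrow> f w = 0" for k :: nat
    proof -
      define \<psi> where "\<psi> w = indicator (cball 0 (real k)) w * cnj (sgn (f w))" for w
      have \<psi>m: "\<psi> \<in> borel_measurable borel"
      proof -
        have "(\<lambda>w. sgn (f w)) \<in> borel_measurable borel" using fm unfolding sgn_div_norm by measurable
        then show ?thesis unfolding \<psi>_def[abs_def]
          by (intro borel_measurable_times borel_measurable_indicator borel_measurable_continuous_on[OF continuous_on_cnj[OF continuous_on_id]]) auto
      qed
      have \<psi>_le: "cmod (\<psi> w) \<le> indicator (cball 0 (real k)) w" for w by (simp add: \<psi>_def norm_mult norm_sgn indicator_def)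
      have \<psi>1: "cmod (\<psi> w) \<le> 1" for w by (rule order_trans[OF \<psi>_le]) (simp add: indicator_def)
      have \<psi>0: "\<psi> w = 0" if "norm w > real k" for w using that by (simp add: \<psi>_def indicator_def)
      have ind: "integrable lborel (indicator (cball 0 (real k)) :: complex^'d \<Rightarrow> real)"
        using emeasure_lborel_cball_finite[of "0::complex^'d" "real k"] by (simp add: integrable_indicator_iff)
      have "(\<lambda>n. LINT w|lborel. \<psi> w * A n w) \<longlonglongrightarrow> complex_of_real (LINT y|lborel. G y) * (LINT w|lborel. \<psi> w * v w)"
        unfolding A_def
      proof (rule twisted_approximate_identity[OF vL v(1) \<psi>m \<psi>1 \<psi>0, where p="\<lambda>h w. cis (lam / 2 * symplectic h w)" and G=G])
        have "continuous_on UNIV (\<lambda>x. cis (lam / 2 * (\<lambda>(z, w). symplectic z w) x))"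
          by (intro continuous_on_cis continuous_on_mult continuous_on_const continuous_symplectic)
        then show "continuous_on UNIV (\<lambda>(h, w). cis (lam / 2 * symplectic h w))" by (simp add: case_prod_unfold)
        show "cis (lam / 2 * symplectic 0 w) = 1" for w by (simp add: symplectic_def)
        show "\<sigma> \<longlonglongrightarrow> 0"
        proof -
          have "(\<lambda>n. sqrt (4 / lam * (sinh (lam * \<epsilon> n) / cosh (lam * \<epsilon> n)))) \<longlonglongrightarrow> sqrt (4 / lam * (sinh (lam * 0) / cosh (lam * 0)))"
            by (intro tendsto_intros \<epsilon>lim) auto
          then show ?thesis by (simp add: \<sigma>_def[abs_def])
        qed
      qed (use Gi in \<open>auto simp: G_def\<close>)
      moreover have "(\<lambda>n. complex_of_real (C n)) \<longlonglongrightarrow> complex_of_real ((4 / (lam * cosh (lam * 0))) ^ CARD('d))"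
        unfolding C_def by (intro tendsto_intros \<epsilon>lim) (use lam in auto)
      ultimately have "(\<lambda>n. complex_of_real (C n) * (LINT w|lborel. \<psi> w * A n w)) \<longlonglongrightarrow>
          complex_of_real ((4 / (lam * cosh (lam * 0))) ^ CARD('d)) * (complex_of_real (LINT y|lborel. G y) * (LINT w|lborel. \<psi> w * v w))"
        by (rule tendsto_mult[rotated])
      moreover have "complex_of_real (C n) * (LINT w|lborel. \<psi> w * A n w) = (LINT w|lborel. \<psi> w * M n w)" for n
        unfolding MA by (subst integral_mult_right_zero[symmetric]) (simp add: mult_ac)
      ultimately have lim1: "(\<lambda>n. LINT w|lborel. \<psi> w * M n w) \<longlonglongrightarrow> complex_of_real c * (LINT w|lborel. \<psi> w * v w)"
        by (simp add: c_def mult.assoc)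
      have B0: "0 \<le> B" using order_trans[OF norm_ge_zero M_le] .
      have \<psi>B: "cmod (\<psi> w * x) \<le> B * indicator (cball 0 (real k)) w" if "cmod x \<le> B" for w x
        using mult_mono[OF \<psi>_le[of w] that] B0 by (simp add: norm_mult mult.commute)
      have lim2: "(\<lambda>n. LINT w|lborel. \<psi> w * M n w) \<longlonglongrightarrow> (LINT w|lborel. \<psi> w * R w)"
      proof (rule integral_dominated_convergence[where w="\<lambda>w. B * indicator (cball 0 (real k)) w"])
        show "AE w in lborel. (\<lambda>n. \<psi> w * M n w) \<longlonglongrightarrow> \<psi> w * R w" by (intro AE_I2 tendsto_mult tendsto_const M_lim)
        show "AE w in lborel. norm (\<psi> w * M n w) \<le> B * indicator (cball 0 (real k)) w" for n by (intro AE_I2 \<psi>B M_le)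
      qed (use \<psi>m Rm Mm ind in auto)
      have eq: "complex_of_real c * (LINT w|lborel. \<psi> w * v w) = (LINT w|lborel. \<psi> w * R w)" by (rule LIMSEQ_unique[OF lim1 lim2])
      have iR: "integrable lborel (\<lambda>w. \<psi> w * R w)"
        by (rule Bochner_Integration.integrable_bound[where f="\<lambda>w. B * indicator (cball 0 (real k)) w"])
           (use \<psi>m Rm ind \<psi>B[OF R_le] B0 in \<open>auto simp: abs_mult\<close>)
      have iv: "integrable lborel (\<lambda>w. \<psi> w * v w)"
      proof -
        have "\<psi> \<in> L2" by (rule bounded_support_L2[OF _ \<psi>1 \<psi>0]) (use \<psi>m in \<open>auto intro: measurable_completion\<close>)
        then have "integrable lebesgue (\<lambda>w. \<psi> w * v w)" using vL by (rule L2_mult_integrable)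
        then show ?thesis using \<psi>m v(1) by (simp add: integrable_completion)
      qed
      have pt: "\<psi> w * f w = complex_of_real (indicator (cball 0 (real k)) w * cmod (f w))" for w
      proof -
        have "cnj (sgn (f w)) * f w = complex_of_real (cmod (f w))"
          by (cases "f w = 0") (simp_all add: sgn_eq complex_norm_square[symmetric] power2_eq_square mult.commute[of "cnj _"])
        then show ?thesis by (simp add: \<psi>_def indicator_def)
      qed
      have if': "integrable lborel (\<lambda>w. \<psi> w * f w)" and zero: "(LINT w|lborel. \<psi> w * f w) = 0"
      proof -
        have e: "(\<lambda>w. \<psi> w * f w) = (\<lambda>w. complex_of_real c * (\<psi> w * v w) - \<psi> w * R w)" by (simp add: f_def fun_eq_iff algebra_simps)
        show "integrable lborel (\<lambda>w. \<psi> w * f w)" unfolding e using iv iR by (intro Bochner_Integration.integrable_diff integrable_mult_right)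
        show "(LINT w|lborel. \<psi> w * f w) = 0" unfolding e using iv iR eq by simp
      qed
      have "integrable lborel (\<lambda>w. indicator (cball 0 (real k)) w * cmod (f w))"
        using integrable_norm[OF if'] unfolding pt norm_of_real by (simp add: abs_mult)
      moreover have "(LINT w|lborel. indicator (cball 0 (real k)) w * cmod (f w)) = 0"
        using zero unfolding pt by (simp only: integral_complex_of_real of_real_eq_0_iff)
      ultimately have "AE w in lborel. indicator (cball 0 (real k)) w * cmod (f w) = 0"
        by (subst (asm) integral_nonneg_eq_0_iff_AE) auto
      then show ?thesis by eventually_elim (auto simp: indicator_def)
    qed
    have "AE w in lborel. \<forall>k::nat. norm w \<le> real k \<longrightarrow> f w = 0" 
      by (rule AE_all_countable[THEN iffD2, OF allI[OF ball]])
    then have "AE w in lborel. f w = 0"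
      by eventually_elim (meson real_arch_simple)
    then have "AE w in lebesgue. f w = 0" by (rule AE_completion)
    then show ?thesis using v(2)
    proof eventually_elim
      case (elim w)
      then have "u w = R w / complex_of_real c" using c0 by (simp add: f_def field_simps)
      also have "\<dots> = (LINT z|lebesgue. S / complex_of_real c * cis (mehler_phase lam t w z) * u\<^sub>0 z)"
        unfolding R_def by (subst integral_divide_zero[symmetric]) simp
      finally show ?case .
    qed
  qed
  then show ?thesis by blast
qed

section \<open>Orthonormal systems and translates of sets\<close>

lemma L2_Bessel:
  fixes N :: nat
  assumes e: "\<And>i. i < N \<Longrightarrow> e i \<in> L2" "\<And>i j. i < N \<Longrightarrow> j < N \<Longrightarrow> L2_inner (e i) (e j) = (if i = j then 1 else 0)"
    and g: "g \<in> L2"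
  shows "(\<Sum>i<N. (cmod (L2_inner (e i) g))\<^sup>2) \<le> (L2_norm g)\<^sup>2"
proof -
  define a where "a i = L2_inner g (e i)" for i
  define s where "s z = (\<Sum>i<N. a i * e i z)" for z
  have ae: "(\<lambda>z. a i * e i z) \<in> L2" if "i < N" for i using e(1)[OF that] by (rule L2_scale)
  have s: "s \<in> L2" unfolding s_def[abs_def] using ae by (intro L2_sum) auto
  have gs: "L2_inner g s = complex_of_real (\<Sum>i<N. (cmod (a i))\<^sup>2)"
  proof -
    have "L2_inner g s = (\<Sum>i<N. cnj (a i) * L2_inner g (e i))"
      unfolding s_def[abs_def] using ae g by (subst L2_inner_sum_right) (auto simp: L2_inner_scale_right)
    then show ?thesis unfolding a_def of_real_sum complex_norm_square by (simp add: mult.commute)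
  qed
  have ss: "L2_inner s s = complex_of_real (\<Sum>i<N. (cmod (a i))\<^sup>2)"
  proof -
    have "L2_inner s s = (\<Sum>i<N. a i * L2_inner (e i) s)"
    proof -
      have "L2_inner (\<lambda>z. \<Sum>i<N. a i * e i z) s = (\<Sum>i<N. a i * L2_inner (e i) s)"
        using ae s by (subst L2_inner_sum_left) (auto simp: L2_inner_scale_left)
      moreover have "s = (\<lambda>z. \<Sum>i<N. a i * e i z)" by (simp add: s_def fun_eq_iff)
      ultimately show ?thesis by metis
    qed
    also have "\<dots> = (\<Sum>i<N. a i * cnj (a i))"
    proof (rule sum.cong[OF refl])
      fix i assume i: "i \<in> {..<N}"
      have "L2_inner (e i) s = (\<Sum>j<N. cnj (a j) * L2_inner (e i) (e j))"
        unfolding s_def[abs_def] using ae e(1) i by (subst L2_inner_sum_right) (auto simp: L2_inner_scale_right)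
      also have "\<dots> = (\<Sum>j<N. if j = i then cnj (a j) else 0)"
        using e(2) i by (intro sum.cong refl) auto
      also have "\<dots> = cnj (a i)" using i by simp
      finally show "a i * L2_inner (e i) s = a i * cnj (a i)" by simp
    qed
    finally show ?thesis unfolding of_real_sum complex_norm_square .
  qed
  have "complex_of_real ((L2_norm (\<lambda>z. g z - s z))\<^sup>2) = L2_inner (\<lambda>z. g z - s z) (\<lambda>z. g z - s z)"
    by (rule L2_inner_self[symmetric])
  also have "\<dots> = L2_inner g g - L2_inner g s - (L2_inner s g - L2_inner s s)"
    using g s L2_diff[OF g s] by (simp add: L2_inner_diff_left L2_inner_diff_right)
  also have "L2_inner s g = L2_inner g s" by (subst L2_inner_commute) (simp add: gs)
  also have "L2_inner g g - L2_inner g s - (L2_inner g s - L2_inner s s) = complex_of_real ((L2_norm g)\<^sup>2 - (\<Sum>i<N. (cmod (a i))\<^sup>2))"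
    unfolding gs ss L2_inner_self[of g] by simp
  finally have "(L2_norm (\<lambda>z. g z - s z))\<^sup>2 = (L2_norm g)\<^sup>2 - (\<Sum>i<N. (cmod (a i))\<^sup>2)" by (simp only: of_real_eq_iff)
  moreover have "cmod (L2_inner (e i) g) = cmod (a i)" for i
    unfolding a_def by (subst L2_inner_commute) simp
  ultimately show ?thesis using zero_le_power2[of "L2_norm (\<lambda>z. g z - s z)"] by simp
qed

text \<open>
  Gram and Schmidt: \<open>f N\<close> minus its projection onto the earlier vectors is nonzero because \<open>f N\<close>
  lies outside the subspace \<open>W N\<close> which contains them. Independence is thus certified by
  membership in the chain, and closure under almost-everywhere equality makes the norm of the
  remainder nonzero. The new vector stays in \<open>W (Suc N)\<close>.
\<close>

lemma orthonormal_chain: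
  assumes W: "\<And>k. W k \<subseteq> L2" "\<And>k. W k \<subseteq> W (Suc k)" "\<And>k. (\<lambda>z. 0) \<in> W k"
    "\<And>k f g a b. f \<in> W k \<Longrightarrow> g \<in> W k \<Longrightarrow> (\<lambda>z. a * f z + b * g z) \<in> W k"
    "\<And>k f g. f \<in> W k \<Longrightarrow> g \<in> L2 \<Longrightarrow> L2_eq f g \<Longrightarrow> g \<in> W k"
    and f: "\<And>k. k < N \<Longrightarrow> f k \<in> W (Suc k)" "\<And>k. k < N \<Longrightarrow> f k \<notin> W k"
  shows "\<exists>e. (\<forall>i<N. e i \<in> W (Suc i)) \<and> (\<forall>i<N. \<forall>j<N. L2_inner (e i) (e j) = (if i = j then 1 else 0))"
  using f
proof (induction N)
  case (Suc N)
  have "\<exists>e. (\<forall>i<N. e i \<in> W (Suc i)) \<and> (\<forall>i<N. \<forall>j<N. L2_inner (e i) (e j) = (if i = j then 1 else 0))"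
    by (rule Suc.IH) (use Suc.prems in auto)
  then obtain e where "(\<forall>i<N. e i \<in> W (Suc i)) \<and> (\<forall>i<N. \<forall>j<N. L2_inner (e i) (e j) = (if i = j then 1 else 0))" ..
  then have e: "\<And>i. i < N \<Longrightarrow> e i \<in> W (Suc i)"
    "\<And>i j. i < N \<Longrightarrow> j < N \<Longrightarrow> L2_inner (e i) (e j) = (if i = j then 1 else 0)" by blast+
  have mono: "W i \<subseteq> W j" if "i \<le> j" for i j using that lift_Suc_mono_le[of W i j] W(2) by blast
  have fN: "f N \<in> W (Suc N)" "f N \<notin> W N" using Suc.prems by auto
  have eL: "e i \<in> L2" if "i < N" for i using e(1)[OF that] W(1) by blast
  have fL: "f N \<in> L2" using fN W(1) by blast
  define s where "s z = (\<Sum>i<N. L2_inner (f N) (e i) * e i z)" for z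
  have sW: "(\<lambda>z. \<Sum>i<m. L2_inner (f N) (e i) * e i z) \<in> W N" if "m \<le> N" for m
    using that
  proof (induction m)
    case (Suc m)
    have "e m \<in> W N" using e(1)[of m] mono[of "Suc m" N] Suc.prems by auto
    with Suc show ?case using W(4)[of "\<lambda>z. \<Sum>i<m. L2_inner (f N) (e i) * e i z" N "e m" 1 "L2_inner (f N) (e m)"] by simp
  qed (simp add: W(3))
  then have s: "s \<in> W N" unfolding s_def[abs_def] by simp
  then have sL: "s \<in> L2" using W(1) by blast
  define r where "r z = f N z - s z" for z
  have rW: "r \<in> W (Suc N)" using W(4)[OF fN(1), of s 1 "-1"] s W(2) by (auto simp: r_def[abs_def])
  have rL: "r \<in> L2" using rW W(1) by blast
  have r0: "L2_norm r \<noteq> 0"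
  proof
    assume "L2_norm r = 0"
    then have "L2_eq s (f N)" using L2_eq_iff_norm[OF fL sL] by (simp add: r_def[abs_def] L2_eq_sym)
    then show False using W(5)[OF s fL] fN(2) by blast
  qed
  have orth: "L2_inner (e i) r = 0" if i: "i < N" for i
  proof -
    have "L2_inner (e i) s = (\<Sum>j<N. cnj (L2_inner (f N) (e j)) * L2_inner (e i) (e j))"
      unfolding s_def[abs_def] using eL i by (subst L2_inner_sum_right) (auto simp: L2_inner_scale_right)
    also have "\<dots> = (\<Sum>j<N. if j = i then cnj (L2_inner (f N) (e j)) else 0)"
      using e(2) i by (intro sum.cong refl) auto
    also have "\<dots> = L2_inner (e i) (f N)" using i L2_inner_commute[of "e i" "f N"] by simp
    finally show ?thesis unfolding r_def[abs_def] using eL[OF i] fL sL by (simp add: L2_inner_diff_right)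
  qed
  define n where "n z = complex_of_real (1 / L2_norm r) * r z" for z
  have nW: "n \<in> W (Suc N)" using W(4)[OF rW rW, of "complex_of_real (1 / L2_norm r)" 0] by (simp add: n_def[abs_def])
  have nn: "L2_inner n n = 1"
  proof -
    have "L2_norm n = 1" unfolding n_def[abs_def] L2_norm_scale norm_of_real using r0 by simp
    then show ?thesis by (simp add: L2_inner_self)
  qed
  have en: "L2_inner (e i) n = 0" "L2_inner n (e i) = 0" if "i < N" for i
    unfolding n_def[abs_def] L2_inner_scale_left L2_inner_scale_right
    using orth[OF that] L2_inner_commute[of r "e i"] by simp_all
  show ?case
  proof (intro exI[of _ "e(N := n)"] conjI allI impI)
    fix i assume "i < Suc N" then show "(e(N := n)) i \<in> W (Suc i)" using e(1) nW by (auto simp: less_Suc_eq)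
  next
    fix i j assume "i < Suc N" "j < Suc N"
    then show "L2_inner ((e(N := n)) i) ((e(N := n)) j) = (if i = j then 1 else 0)"
      using e(2) nn en by (auto simp: less_Suc_eq)
  qed
qed simp

definition shift :: "'a::euclidean_space \<Rightarrow> 'a set \<Rightarrow> 'a set" where
  "shift a S = {x. x - a \<in> S}"

lemma shift_measurable [simp, intro]: "S \<in> sets lebesgue \<Longrightarrow> shift a S \<in> sets lebesgue"
proof -
  assume "S \<in> sets lebesgue"
  from measurable_sets[OF lebesgue_translation(2)[of "- a"] this]
  show ?thesis by (simp add: shift_def vimage_def)
qed

lemma emeasure_shift: "S \<in> sets lebesgue \<Longrightarrow> emeasure lebesgue (shift a S) = emeasure lebesgue S"
proof -
  assume S: "S \<in> sets lebesgue"
  have "emeasure lebesgue S = emeasure (distr lebesgue lebesgue (\<lambda>x. x + - a)) S" by (simp only: lebesgue_translation)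
  also have "\<dots> = emeasure lebesgue (shift a S)"
    using S lebesgue_translation(2)[of "- a"] by (subst emeasure_distr) (auto simp: shift_def vimage_def)
  finally show ?thesis by simp
qed

lemma shift_fmeasurable [simp, intro]: "S \<in> lmeasurable \<Longrightarrow> shift a S \<in> lmeasurable"
proof -
  assume S: "S \<in> lmeasurable"
  have "emeasure lebesgue (shift a S) < \<infinity>"
    unfolding emeasure_shift[OF fmeasurableD[OF S]] using S by (simp only: fmeasurable_def mem_Collect_eq)
  then show ?thesis using S by (intro fmeasurableI) auto
qed

lemma shift_shift: "shift a (shift b S) = shift (a + b) S" by (simp add: shift_def algebra_simps)
lemma shift_UN: "shift a (\<Union>i\<in>I. S i) = (\<Union>i\<in>I. shift a (S i))" by (auto simp: shift_def)
lemma shift_Diff: "shift a (S - T) = shift a S - shift a T" by (auto simp: shift_def)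

text \<open>
  A special case of the continuity of translations: the escaping part lies in the symmetric
  difference.
\<close>

lemma shift_diff_tendsto:
  assumes S: "S \<in> lmeasurable" and h: "h \<longlonglongrightarrow> (0 :: 'a::euclidean_space)"
  shows "(\<lambda>n. measure lebesgue (shift (h n) S - S)) \<longlonglongrightarrow> 0"
proof -
  have S': "S \<in> sets lebesgue" "emeasure lebesgue S < \<infinity>" using S by (auto simp: fmeasurable_def)
  have "(\<lambda>n. - h n) \<longlonglongrightarrow> 0" using tendsto_minus[OF h] by simp
  from indicator_translation_tendsto[OF S' this]
  have lim: "(\<lambda>n. LINT x|lebesgue. \<bar>indicator S (x - h n) - indicator S x\<bar> :: real) \<longlonglongrightarrow> 0" by simp
  have iS: "integrable lebesgue (indicator S :: 'a \<Rightarrow> real)" using S' by (simp add: integrable_indicator_iff)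
  have le: "measure lebesgue (shift (h n) S - S) \<le> (LINT x|lebesgue. \<bar>indicator S (x - h n) - indicator S x\<bar> :: real)" for n
  proof -
    have "shift (h n) S - S \<in> lmeasurable" using S by (intro fmeasurable.Diff) auto
    then have *: "shift (h n) S - S \<in> sets lebesgue" "emeasure lebesgue (shift (h n) S - S) < \<infinity>"
      by (auto simp: fmeasurable_def)
    have "measure lebesgue (shift (h n) S - S) = (LINT x|lebesgue. indicator (shift (h n) S - S) x :: real)"
      using * by simp
    also have "\<dots> \<le> (LINT x|lebesgue. \<bar>indicator S (x - h n) - indicator S x\<bar> :: real)"
    proof (rule integral_mono)
      show "integrable lebesgue (indicator (shift (h n) S - S) :: 'a \<Rightarrow> real)" by (rule integrable_real_indicator[OF *])
      show "integrable lebesgue (\<lambda>x. \<bar>indicator S (x - h n) - indicator S x\<bar> :: real)"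
        using integrable_translation[OF iS, of "- h n"] iS by (intro integrable_abs Bochner_Integration.integrable_diff) auto
      show "indicator (shift (h n) S - S) x \<le> (\<bar>indicator S (x - h n) - indicator S x\<bar> :: real)" for x
        by (auto simp: indicator_def shift_def)
    qed
    finally show ?thesis .
  qed
  show ?thesis
    by (rule Lim_null_comparison[OF always_eventually lim]) (use le in auto)
qed

text \<open>
  If the \<open>k\<close>-th translate of \<open>S\<close> were covered by the earlier ones, then so would be all later
  translates, by induction. They run off to infinity in the direction of \<open>h\<close>, while the covering
  set has finite measure; so the mass of \<open>S\<close> in each half-space \<open>x \<bullet> h > s\<close> would vanish, and
  with it \<open>S\<close>.
\<close>

lemma translates_not_covered:
  fixes h :: "'a::euclidean_space"
  assumes S: "S \<in> lmeasurable" "S \<notin> null_sets lebesgue" and h: "h \<noteq> 0"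
  shows "shift (real k *\<^sub>R h) S - (\<Union>i<k. shift (real i *\<^sub>R h) S) \<notin> null_sets lebesgue"
proof
  define U where "U = (\<Union>i<k. shift (real i *\<^sub>R h) S)"
  assume null: "shift (real k *\<^sub>R h) S - (\<Union>i<k. shift (real i *\<^sub>R h) S) \<in> null_sets lebesgue"
  have Um: "U \<in> lmeasurable" unfolding U_def using S by (intro fmeasurable.finite_UN) auto
  have Ss: "S \<in> sets lebesgue" using S by auto
  have cover: "shift (real m *\<^sub>R h) S - U \<in> null_sets lebesgue" if "m \<ge> k" for m
    using that
  proof (induction m rule: dec_induct)
    case base
    then show ?case using null by (simp add: U_def)
  next
    case (step m)
    have e: "shift h (shift (real i *\<^sub>R h) S) = shift (real (Suc i) *\<^sub>R h) S" for i
      by (simp add: shift_shift scaleR_left_distrib)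
    have "shift h (shift (real m *\<^sub>R h) S - U) \<in> null_sets lebesgue"
      using step.IH emeasure_shift[of "shift (real m *\<^sub>R h) S - U" h] by (auto simp: null_sets_def)
    moreover have "shift (real k *\<^sub>R h) S - U \<in> null_sets lebesgue" using null by (simp add: U_def)
    ultimately have "shift h (shift (real m *\<^sub>R h) S - U) \<union> (shift (real k *\<^sub>R h) S - U) \<in> null_sets lebesgue" by (rule null_sets.Un)
    moreover have "shift (real (Suc m) *\<^sub>R h) S - U \<subseteq> shift h (shift (real m *\<^sub>R h) S - U) \<union> (shift (real k *\<^sub>R h) S - U)"
    proof -
      have "shift h U \<subseteq> U \<union> shift (real k *\<^sub>R h) S"
      proof
        fix x assume "x \<in> shift h U"
        then obtain i where "i < k" "x \<in> shift (real (Suc i) *\<^sub>R h) S" unfolding U_def shift_UN e by auto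
        moreover have "Suc i < k \<or> Suc i = k" using \<open>i < k\<close> by linarith
        ultimately show "x \<in> U \<union> shift (real k *\<^sub>R h) S" unfolding U_def by blast
      qed
      then show ?thesis unfolding shift_Diff e by blast
    qed
    moreover have "shift (real (Suc m) *\<^sub>R h) S - U \<in> sets lebesgue" using Ss Um by auto
    ultimately show ?case using null_sets_subset by blast
  qed
  define A where "A s = {x. x \<bullet> h > s}" for s
  have A: "A s \<in> sets lebesgue" for s
    unfolding A_def by (intro sets_completionI_sets) (simp add: borel_open open_Collect_less continuous_intros)
  have zero: "emeasure lebesgue (S \<inter> A s) = 0" for s
  proof -
    \<comment> \<open>Shifting \<open>m\<close> times moves the half-space by \<open>m * (h \<bullet> h)\<close>, and the part of \<open>U\<close> beyond it
        tends to zero.\<close>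
    define B where "B m = U \<inter> A (s + real m * (h \<bullet> h))" for m
    have "(\<lambda>m. emeasure lebesgue (B m)) \<longlonglongrightarrow> emeasure lebesgue (\<Inter>m. B m)"
    proof (rule Lim_emeasure_decseq)
      show "range B \<subseteq> sets lebesgue" unfolding B_def using Um A by auto
      have "B n \<subseteq> B m" if "m \<le> n" for m n
      proof -
        have "real m * (h \<bullet> h) \<le> real n * (h \<bullet> h)" using that by (intro mult_right_mono) auto
        then show ?thesis by (auto simp: B_def A_def)
      qed
      then show "decseq B" by (simp add: decseq_def)
      show "emeasure lebesgue (B m) \<noteq> \<infinity>" for m
        unfolding B_def infinity_ennreal_def by (rule fmeasurableD2[OF fmeasurable_Int_fmeasurable[OF Um A]])
    qed
    moreover have "(\<Inter>m. B m) = {}"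
    proof -
      have "\<exists>m::nat. x \<notin> B m" for x
      proof -
        obtain m :: nat where "(x \<bullet> h - s) / (h \<bullet> h) < real m" using reals_Archimedean2 by blast
        then have "x \<bullet> h < s + real m * (h \<bullet> h)" using h by (simp add: field_simps)
        then show ?thesis by (intro exI[of _ m]) (simp add: B_def A_def)
      qed
      then show ?thesis by blast
    qed
    ultimately have lim: "(\<lambda>m. emeasure lebesgue (B m)) \<longlonglongrightarrow> 0" by simp
    have "emeasure lebesgue (S \<inter> A s) \<le> emeasure lebesgue (B m)" if m: "m \<ge> k" for m
    proof -
      have SA: "S \<inter> A s \<in> sets lebesgue" using Ss A by auto
      have eq: "shift (real m *\<^sub>R h) (S \<inter> A s) = shift (real m *\<^sub>R h) S \<inter> A (s + real m * (h \<bullet> h))"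
        by (auto simp: shift_def A_def inner_diff_left)
      have "emeasure lebesgue (S \<inter> A s) = emeasure lebesgue (shift (real m *\<^sub>R h) (S \<inter> A s))" by (rule emeasure_shift[OF SA, symmetric])
      also have "\<dots> \<le> emeasure lebesgue (B m \<union> (shift (real m *\<^sub>R h) S - U))"
        unfolding eq B_def using Um A cover[OF m] Ss by (intro emeasure_mono) auto
      also have "\<dots> = emeasure lebesgue (B m)"
        using cover[OF m] Um A by (intro emeasure_Un_null_set) (auto simp: B_def)
      finally show ?thesis .
    qed
    then have "emeasure lebesgue (S \<inter> A s) \<le> 0"
      by (intro LIMSEQ_le_const[OF lim]) blast
    then show ?thesis by simp
  qed
  have "(\<Union>n::nat. S \<inter> A (- real n)) \<in> null_sets lebesgue"
    using zero Ss A by (intro null_sets_UN) (auto simp: null_sets_def)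
  moreover have "S \<subseteq> (\<Union>n::nat. S \<inter> A (- real n))"
  proof
    fix x assume "x \<in> S"
    moreover obtain n :: nat where "- (x \<bullet> h) < real n" using reals_Archimedean2 by blast
    ultimately show "x \<in> (\<Union>n::nat. S \<inter> A (- real n))" by (auto simp: A_def intro!: exI[of _ n])
  qed
  ultimately show False using S null_sets_subset Ss by blast
qed

section \<open>The uncertainty principle for oscillatory kernels\<close>

text \<open>
  The phase is a function of \<open>z - w\<close> plus a bilinear form, so translating both arguments changes it by
  terms that separate. For the Fourier transform \<open>q = 0\<close> and \<open>om\<close> is a multiple of the inner product.
\<close>

locale oscillatory_kernel =
  fixes c :: complex and q :: "'a::euclidean_space \<Rightarrow> real" and om :: "'a \<Rightarrow> 'a \<Rightarrow> real"
  assumes q: "continuous_on UNIV q" and om: "bounded_bilinear om"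
begin

definition K :: "'a \<Rightarrow> 'a \<Rightarrow> complex" where
  "K z w = c * cis (q (z - w) + om z w)"

definition T :: "('a \<Rightarrow> complex) \<Rightarrow> 'a \<Rightarrow> complex" where
  "T f z = (LINT w|lebesgue. K z w * f w)"

lemma cmod_K [simp]: "cmod (K z w) = cmod c"
  by (simp add: K_def norm_mult)

lemma K_continuous: "continuous_on UNIV (\<lambda>(z, w). K z w)"
  unfolding K_def case_prod_unfold
  by (intro continuous_intros continuous_on_compose2[OF q] bounded_bilinear.continuous_on[OF om]) auto

lemma K_tendsto:
  assumes "X \<longlonglongrightarrow> z" shows "(\<lambda>n. K (X n) w) \<longlonglongrightarrow> K z w"
  using continuous_on_tendsto_compose[OF K_continuous tendsto_Pair[OF assms tendsto_const[of w]]] by simp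

lemma K_measurable: "(\<lambda>w. K z w) \<in> borel_measurable lebesgue"
  using continuous_on_compose2[OF K_continuous continuous_on_Pair[OF continuous_on_const[of UNIV z] continuous_on_id]]
  by (intro continuous_measurable_lebesgue) simp

lemma K_mult_integrable:
  assumes "integrable lebesgue f" shows "integrable lebesgue (\<lambda>w. K z w * f w)"
proof (rule Bochner_Integration.integrable_bound)
  show "integrable lebesgue (\<lambda>w. cmod c * cmod (f w))" using assms by auto
  show "(\<lambda>w. K z w * f w) \<in> borel_measurable lebesgue"
    using assms by (intro borel_measurable_times K_measurable) auto
qed (simp add: norm_mult)

lemma T_linear:
  assumes "integrable lebesgue f" "integrable lebesgue g"
  shows "T (\<lambda>w. a * f w + b * g w) z = a * T f z + b * T g z"
proof -
  have "T (\<lambda>w. a * f w + b * g w) z = (LINT w|lebesgue. a * (K z w * f w) + b * (K z w * g w))"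
    unfolding T_def by (simp add: algebra_simps)
  then show ?thesis using K_mult_integrable[OF assms(1)] K_mult_integrable[OF assms(2)] by (simp add: T_def)
qed

lemma T_diff:
  assumes "integrable lebesgue f" "integrable lebesgue g"
  shows "T (\<lambda>w. f w - g w) z = T f z - T g z"
  using T_linear[OF assms, of 1 "-1" z] by simp

lemma T_continuous:
  assumes f: "integrable lebesgue f" shows "continuous_on UNIV (T f)"
  unfolding continuous_on_sequentially
proof (intro allI ballI impI)
  fix X :: "nat \<Rightarrow> 'a" and z assume X: "(\<forall>n. X n \<in> UNIV) \<and> X \<longlonglongrightarrow> z"
  have "(\<lambda>n. LINT w|lebesgue. K (X n) w * f w) \<longlonglongrightarrow> (LINT w|lebesgue. K z w * f w)"
  proof (rule integral_dominated_convergence[where w="\<lambda>w. cmod c * cmod (f w)"])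
    show "(\<lambda>w. K z w * f w) \<in> borel_measurable lebesgue" by (rule borel_measurable_integrable[OF K_mult_integrable[OF f]])
    show "(\<lambda>w. K (X n) w * f w) \<in> borel_measurable lebesgue" for n by (rule borel_measurable_integrable[OF K_mult_integrable[OF f]])
    show "integrable lebesgue (\<lambda>w. cmod c * cmod (f w))" using f by auto
    show "AE w in lebesgue. (\<lambda>n. K (X n) w * f w) \<longlonglongrightarrow> K z w * f w"
      using X by (intro AE_I2 tendsto_mult tendsto_const K_tendsto) auto
  qed (simp add: norm_mult)
  then show "(T f \<circ> X) \<longlonglongrightarrow> T f z" by (simp add: T_def o_def)
qed

text \<open>
  Translation by \<open>a\<close>, with the phase that compensates the change of the bilinear form under
  \<open>w \<mapsto> w + a\<close>.
\<close>

definition tau :: "'a \<Rightarrow> ('a \<Rightarrow> complex) \<Rightarrow> 'a \<Rightarrow> complex" where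
  "tau a f w = cis (- om a (w - a)) * f (w - a)"

lemma tau_L2:
  assumes "f \<in> L2" shows "tau a f \<in> L2"
proof -
  have "(\<lambda>w. cis (- om a (w - a))) \<in> borel_measurable lebesgue"
    by (intro continuous_measurable_lebesgue continuous_intros bounded_bilinear.continuous_on[OF om])
  then show ?thesis
    unfolding tau_def[abs_def] using L2_translate(1)[OF assms, of "- a"]
    by (intro L2_bounded_mult(1)[where C=1]) auto
qed

text \<open>
  The image of a twisted translate is a translate of the image up to a phase, so supports are
  moved by \<open>a\<close> on both sides.
\<close>

lemma T_tau:
  assumes "f \<in> borel_measurable lebesgue"
  shows "T (tau a f) z = cis (om z a) * T f (z - a)"
proof -
  interpret om: bounded_bilinear om by (rule om)
  have c: "(\<lambda>w. cis (- om a (w - a))) \<in> borel_measurable lebesgue"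
    by (intro continuous_measurable_lebesgue continuous_intros bounded_bilinear.continuous_on[OF om])
  have m: "(\<lambda>w. K z w * tau a f w) \<in> borel_measurable lebesgue"
    unfolding tau_def using measurable_translate[OF assms, of "- a"] c by (intro borel_measurable_times K_measurable) auto
  have "T (tau a f) z = (LINT w|lebesgue. K z (w + a) * tau a f (w + a))"
    unfolding T_def by (rule integral_translation[OF m, symmetric])
  also have "\<dots> = (LINT w|lebesgue. cis (om z a) * (K (z - a) w * f w))"
  proof (rule Bochner_Integration.integral_cong[OF refl])
    fix w
    have e: "q (z - (w + a)) + om z (w + a) + - om a w = om z a + (q (z - a - w) + om (z - a) w)"
      by (simp add: om.add_right om.diff_left algebra_simps)
    have "K z (w + a) * tau a f (w + a) = c * (cis (q (z - (w + a)) + om z (w + a)) * cis (- om a w)) * f w"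
      by (simp add: K_def tau_def mult_ac)
    also have "\<dots> = cis (om z a) * (K (z - a) w * f w)" unfolding cis_mult e K_def
      by (simp add: cis_mult[symmetric] mult_ac)
    finally show "K z (w + a) * tau a f (w + a) = cis (om z a) * (K (z - a) w * f w)" .
  qed
  finally show ?thesis by (simp add: T_def)
qed

end

lemma indicator_L2:
  fixes E :: "'a::euclidean_space set"
  shows "E \<in> lmeasurable \<Longrightarrow> (\<lambda>w. indicator E w :: complex) \<in> L2"
  "E \<in> lmeasurable \<Longrightarrow> L2_norm (\<lambda>w. indicator E w :: complex) = sqrt (measure lebesgue E)"
proof -
  assume E: "E \<in> lmeasurable"
  have e: "(cmod (indicator E w))\<^sup>2 = indicator E w" for w by (simp add: indicator_def)
  have i: "integrable lebesgue (indicator E :: 'a \<Rightarrow> real)"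
    by (rule integrable_real_indicator[OF fmeasurableD[OF E] fmeasurableD2[OF E, unfolded less_top, folded infinity_ennreal_def]])
  show "(\<lambda>w. indicator E w :: complex) \<in> L2" 
    using i E by (simp add: L2_def e fmeasurableD)
  show "L2_norm (\<lambda>w. indicator E w :: complex) = sqrt (measure lebesgue E)"
    unfolding L2_norm_def e using E by (simp add: fmeasurableD)
qed

lemma support_integrable:
  assumes f: "f \<in> L2" and E: "E \<in> lmeasurable" and supp: "AE w in lebesgue. w \<notin> E \<longrightarrow> f w = 0"
  shows "integrable lebesgue f"
proof -
  have "integrable lebesgue (\<lambda>w. indicator E w * f w)" by (rule L2_mult_integrable[OF indicator_L2(1)[OF E] f])
  moreover have "AE w in lebesgue. indicator E w * f w = f w" using supp by eventually_elim (auto simp: indicator_def)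
  ultimately show ?thesis
    using integrable_cong_AE[of "\<lambda>w. indicator E w * f w" lebesgue f] L2_measurable[OF f] by auto
qed

locale unitary_kernel = oscillatory_kernel c q om
  for c :: complex and q :: "'a::euclidean_space \<Rightarrow> real" and om :: "'a \<Rightarrow> 'a \<Rightarrow> real" +
  assumes T_L2: "\<And>f. f \<in> L2 \<Longrightarrow> integrable lebesgue f \<Longrightarrow> T f \<in> L2"
    and T_norm: "\<And>f. f \<in> L2 \<Longrightarrow> integrable lebesgue f \<Longrightarrow> L2_norm (T f) = L2_norm f"
begin

text \<open>
  The kernel at \<open>z\<close> as a vector: for functions supported in \<open>E\<close>, applying \<open>T\<close> is taking inner
  products with slices, whose norms are bounded uniformly in \<open>z\<close>.
\<close>

definition slice :: "'a set \<Rightarrow> 'a \<Rightarrow> 'a \<Rightarrow> complex" where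
  "slice E z w = indicator E w * cnj (K z w)"

lemma slice_L2:
  assumes "E \<in> lmeasurable"
  shows "slice E z \<in> L2" "L2_norm (slice E z) \<le> cmod c * sqrt (measure lebesgue E)"
proof -
  have m: "(\<lambda>w. cnj (K z w)) \<in> borel_measurable lebesgue"
    by (rule borel_measurable_continuous_on[OF continuous_on_cnj[OF continuous_on_id] K_measurable])
  have e: "slice E z = (\<lambda>w. cnj (K z w) * indicator E w)" by (simp add: slice_def fun_eq_iff)
  note * = L2_bounded_mult[OF indicator_L2(1)[OF assms] m, of "cmod c"]
  show "slice E z \<in> L2" "L2_norm (slice E z) \<le> cmod c * sqrt (measure lebesgue E)"
    unfolding e using * indicator_L2(2)[OF assms] by auto
qed

lemma T_eq_inner:
  assumes "f \<in> L2" "E \<in> lmeasurable" "AE w in lebesgue. w \<notin> E \<longrightarrow> f w = 0"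
  shows "T f z = L2_inner f (slice E z)"
  unfolding T_def L2_inner_def
proof (rule integral_cong_AE)
  show "(\<lambda>w. K z w * f w) \<in> borel_measurable lebesgue" by (intro borel_measurable_times K_measurable L2_measurable assms)
  show "(\<lambda>w. f w * cnj (slice E z w)) \<in> borel_measurable lebesgue"
    using L2_inner_integrable[OF assms(1) slice_L2(1)[OF assms(2)]] by auto
  show "AE w in lebesgue. K z w * f w = f w * cnj (slice E z w)"
    using assms(3) by eventually_elim (auto simp: slice_def indicator_def)
qed

text \<open>
  Since \<open>T\<close> is isometric, \<open>N\<close> is the integral over \<open>Om\<close> of \<open>\<Sum>i. \<bar>T (e i) z\<bar>\<^sup>2\<close>, and
  Bessel's inequality bounds the integrand by the squared norm of the slice at \<open>z\<close>. In other
  words, the squared Hilbert-Schmidt norm of the kernel on \<open>Om \<times> E\<close> bounds the dimension of a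
  space on which it is isometric.
\<close>

lemma dimension_bound:
  fixes N :: nat
  assumes E: "E \<in> lmeasurable" and O: "Om \<in> lmeasurable"
    and e: "\<And>i. i < N \<Longrightarrow> e i \<in> L2" "\<And>i j. i < N \<Longrightarrow> j < N \<Longrightarrow> L2_inner (e i) (e j) = (if i = j then 1 else 0)"
    and sE: "\<And>i. i < N \<Longrightarrow> AE w in lebesgue. w \<notin> E \<longrightarrow> e i w = 0"
    and sO: "\<And>i. i < N \<Longrightarrow> AE z in lebesgue. z \<notin> Om \<longrightarrow> T (e i) z = 0"
  shows "real N \<le> (cmod c)\<^sup>2 * measure lebesgue E * measure lebesgue Om"
proof -
  have ei: "integrable lebesgue (e i)" if "i < N" for i by (rule support_integrable[OF e(1)[OF that] E sE[OF that]])
  have TL: "T (e i) \<in> L2" if "i < N" for i by (rule T_L2[OF e(1)[OF that] ei[OF that]])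
  have one: "(LINT z|lebesgue. (cmod (T (e i) z))\<^sup>2) = 1" if "i < N" for i
  proof -
    have "complex_of_real ((L2_norm (e i))\<^sup>2) = 1" using e(2)[OF that that] by (simp add: L2_inner_self)
    then have "(L2_norm (e i))\<^sup>2 = 1" by (simp only: of_real_eq_1_iff)
    then show ?thesis using T_norm[OF e(1)[OF that] ei[OF that]] by (simp add: L2_norm_square[symmetric])
  qed
  have sq: "integrable lebesgue (\<lambda>z. (cmod (T (e i) z))\<^sup>2)" if "i < N" for i by (rule L2_integrable_square[OF TL[OF that]])
  have "real N = (\<Sum>i<N. LINT z|lebesgue. (cmod (T (e i) z))\<^sup>2)" using one by simp
  also have "\<dots> = (LINT z|lebesgue. (\<Sum>i<N. (cmod (T (e i) z))\<^sup>2))" using sq by (subst Bochner_Integration.integral_sum) auto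
  also have "\<dots> \<le> (LINT z|lebesgue. (cmod c)\<^sup>2 * measure lebesgue E * indicator Om z)"
  proof (rule integral_mono_AE)
    show "integrable lebesgue (\<lambda>z. \<Sum>i<N. (cmod (T (e i) z))\<^sup>2)" using sq by auto
    show "integrable lebesgue (\<lambda>z. (cmod c)\<^sup>2 * measure lebesgue E * indicator Om z)"
      by (intro integrable_mult_right integrable_real_indicator fmeasurableD[OF O] fmeasurableD2[OF O, unfolded less_top, folded infinity_ennreal_def])
    have "AE z in lebesgue. \<forall>i\<in>{..<N}. z \<notin> Om \<longrightarrow> T (e i) z = 0"
      using sO by (intro AE_finite_allI) auto
    then show "AE z in lebesgue. (\<Sum>i<N. (cmod (T (e i) z))\<^sup>2) \<le> (cmod c)\<^sup>2 * measure lebesgue E * indicator Om z"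
    proof eventually_elim
      case (elim z)
      show ?case
      proof (cases "z \<in> Om")
        case True
        have "(\<Sum>i<N. (cmod (T (e i) z))\<^sup>2) = (\<Sum>i<N. (cmod (L2_inner (e i) (slice E z)))\<^sup>2)"
          using T_eq_inner[OF e(1) E sE] by (intro sum.cong) auto
        also have "\<dots> \<le> (L2_norm (slice E z))\<^sup>2" by (rule L2_Bessel[OF e slice_L2(1)[OF E]]) auto
        also have "\<dots> \<le> (cmod c * sqrt (measure lebesgue E))\<^sup>2" by (intro power_mono slice_L2(2)[OF E]) simp
        also have "\<dots> = (cmod c)\<^sup>2 * measure lebesgue E" by (simp add: power_mult_distrib)
        finally show ?thesis using True by simp
      next
        case False
        then show ?thesis using elim by simp
      qed
    qed
  qed
  also have "\<dots> = (cmod c)\<^sup>2 * measure lebesgue E * measure lebesgue Om" using fmeasurableD[OF O] by simp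
  finally show ?thesis .
qed

lemma null_sets_shift: "A \<in> null_sets lebesgue \<Longrightarrow> shift a A \<in> null_sets lebesgue"
  using emeasure_shift[of A a] by (auto simp: null_sets_def)

lemma AE_translate:
  assumes "AE x in lebesgue. P x" shows "AE x in lebesgue. P (x - a)"
proof -
  obtain A where A: "A \<in> null_sets lebesgue" "{x. \<not> P x} \<subseteq> A" 
    using assms by (rule AE_E3) (rule that, auto)
  then have "{x. \<not> P (x - a)} \<subseteq> shift a A" by (auto simp: shift_def)
  then show ?thesis using null_sets_shift[OF A(1), of a] by (intro AE_I'[of "shift a A"]) auto
qed

text \<open>
  Translate \<open>f\<close> by multiples \<open>0, \<dots>, N - 1\<close> of a tiny vector \<open>h\<close>, twisted so that the images are
  translated as well. All these functions are supported in a set of measure at most \<open>\<bar>S\<bar> + 1\<close>,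
  where \<open>S\<close> is the essential support of \<open>f\<close>, and their images in a set of measure at most
  \<open>\<bar>Om\<bar> + 1\<close>. They are linearly independent because no translate of \<open>S\<close> is covered by the
  earlier ones. For large \<open>N\<close> this exceeds the dimension bound.
\<close>

lemma no_concentration:
  assumes E: "E \<in> lmeasurable" and O: "Om \<in> lmeasurable" and f: "f \<in> L2"
    and fE: "AE w in lebesgue. w \<notin> E \<longrightarrow> f w = 0" and fO: "AE z in lebesgue. z \<notin> Om \<longrightarrow> T f z = 0"
  shows "L2_norm f = 0"
proof (rule ccontr)
  assume nz: "L2_norm f \<noteq> 0"
  have fi: "integrable lebesgue f" by (rule support_integrable[OF f E fE])
  \<comment> \<open>The support of \<open>f\<close> itself must be translated, not the larger set \<open>E\<close>: only then does leaving
      the earlier translates mean being a new function.\<close>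
  define S where "S = {w \<in> E. f w \<noteq> 0}"
  have Ss: "S \<in> sets lebesgue"
  proof -
    have "f -` (- {0}) \<inter> space lebesgue \<in> sets lebesgue" by (rule measurable_sets[OF L2_measurable[OF f]]) auto
    moreover have "S = E \<inter> (f -` (- {0}) \<inter> space lebesgue)" by (auto simp: S_def)
    ultimately show ?thesis using fmeasurableD[OF E] by (simp only: sets.Int)
  qed
  have S: "S \<in> lmeasurable" by (rule fmeasurableI2[OF E _ Ss]) (auto simp: S_def)
  have fS: "AE w in lebesgue. w \<notin> S \<longrightarrow> f w = 0" using fE by eventually_elim (auto simp: S_def)
  have Snull: "S \<notin> null_sets lebesgue"
  proof
    assume "S \<in> null_sets lebesgue"
    then have "AE w in lebesgue. w \<notin> S" by (rule AE_not_in)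
    then have "AE w in lebesgue. f w = 0" using fS by eventually_elim auto
    then show False using nz L2_norm_zero_iff[OF f] by simp
  qed
  \<comment> \<open>Each unit leaves room for \<open>N\<close> translates which escape by at most \<open>1 / N\<close> each, so \<open>N\<close> can be
      fixed before the step \<open>h\<close>.\<close>
  define B where "B = (cmod c)\<^sup>2 * (measure lebesgue S + 1) * (measure lebesgue Om + 1)"
  obtain N :: nat where N: "B < real N" using reals_Archimedean2 by blast
  have "0 \<le> B" unfolding B_def by (intro mult_nonneg_nonneg) auto
  then have N0: "0 < real N" using N by linarith
  define v where "v = (SOME b. b \<in> (Basis :: 'a set))"
  have v: "v \<in> Basis" unfolding v_def by (rule someI_ex) (use nonempty_Basis in blast)
  have small: "\<exists>n. \<forall>i<N. measure lebesgue (shift (real i *\<^sub>R (1 / real (Suc n)) *\<^sub>R v) S - S) \<le> 1 / real N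
      \<and> measure lebesgue (shift (real i *\<^sub>R (1 / real (Suc n)) *\<^sub>R v) Om - Om) \<le> 1 / real N"
  proof -
    have h: "(\<lambda>n. real i *\<^sub>R (1 / real (Suc n)) *\<^sub>R v) \<longlonglongrightarrow> 0" for i
    proof -
      have "(\<lambda>n. real i *\<^sub>R (1 / real (Suc n)) *\<^sub>R v) \<longlonglongrightarrow> real i *\<^sub>R 0 *\<^sub>R v"
        by (intro tendsto_scaleR tendsto_const lim_inverse_n'[THEN LIMSEQ_Suc])
      then show ?thesis by simp
    qed
    have "eventually (\<lambda>n. measure lebesgue (shift (real i *\<^sub>R (1 / real (Suc n)) *\<^sub>R v) A - A) < 1 / real N) sequentially"
      if "A \<in> lmeasurable" for A i
      using shift_diff_tendsto[OF that h] N0 by (intro order_tendstoD(2)) auto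
    from eventually_conj[OF this[OF S] this[OF O]]
    have "\<forall>\<^sub>F n in sequentially. \<forall>i\<in>{..<N}. measure lebesgue (shift (real i *\<^sub>R (1 / real (Suc n)) *\<^sub>R v) S - S) < 1 / real N
      \<and> measure lebesgue (shift (real i *\<^sub>R (1 / real (Suc n)) *\<^sub>R v) Om - Om) < 1 / real N"
      by (intro eventually_ball_finite) auto
    then show ?thesis by (auto simp: eventually_sequentially intro: less_imp_le)
  qed
  then obtain n where n: "\<And>i. i < N \<Longrightarrow> measure lebesgue (shift (real i *\<^sub>R (1 / real (Suc n)) *\<^sub>R v) S - S) \<le> 1 / real N"
    "\<And>i. i < N \<Longrightarrow> measure lebesgue (shift (real i *\<^sub>R (1 / real (Suc n)) *\<^sub>R v) Om - Om) \<le> 1 / real N" by blast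
  define h where "h = (1 / real (Suc n)) *\<^sub>R v"
  have h0: "h \<noteq> 0" using v nonzero_Basis by (auto simp: h_def)
  define U where "U A k = (\<Union>i<k. shift (real i *\<^sub>R h) A)" for A :: "'a set" and k
  have Um: "U A k \<in> lmeasurable" if "A \<in> lmeasurable" for A k unfolding U_def using that by (intro fmeasurable.finite_UN) auto
  have U_le: "measure lebesgue (U A N) \<le> measure lebesgue A + 1"
    if A: "A \<in> lmeasurable" and le: "\<And>i. i < N \<Longrightarrow> measure lebesgue (shift (real i *\<^sub>R h) A - A) \<le> 1 / real N" for A
  proof -
    have m: "shift (real i *\<^sub>R h) A - A \<in> lmeasurable" for i using A by (intro fmeasurable.Diff) auto
    have "measure lebesgue (U A N) \<le> measure lebesgue (A \<union> (\<Union>i<N. shift (real i *\<^sub>R h) A - A))"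
      unfolding U_def using A m by (intro measure_mono_fmeasurable fmeasurable.Un fmeasurable.finite_UN) (auto dest: fmeasurableD)
    also have "\<dots> \<le> measure lebesgue A + measure lebesgue (\<Union>i<N. shift (real i *\<^sub>R h) A - A)"
      using A m by (intro measure_Un_le sets.finite_UN) (auto dest: fmeasurableD)
    also have "measure lebesgue (\<Union>i<N. shift (real i *\<^sub>R h) A - A) \<le> (\<Sum>i<N. measure lebesgue (shift (real i *\<^sub>R h) A - A))"
      using m by (intro measure_UNION_le) (auto dest: fmeasurableD)
    also have "\<dots> \<le> (\<Sum>i<N. 1 / real N)" using le by (intro sum_mono) auto
    also have "\<dots> = 1" using N0 by simp
    finally show ?thesis by simp
  qed
  \<comment> \<open>The support condition grows with \<open>k\<close>; the condition on the image is the final one throughout.\<close>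
  define W where "W k = {g \<in> L2. (AE w in lebesgue. w \<notin> U S k \<longrightarrow> g w = 0) \<and> (AE z in lebesgue. z \<notin> U Om N \<longrightarrow> T g z = 0)}" for k
  have Wi: "integrable lebesgue g" if "g \<in> W k" for g k
    using that support_integrable[OF _ Um[OF S]] by (auto simp: W_def)
  define F where "F k = tau (real k *\<^sub>R h) f" for k
  have T0: "T (\<lambda>z. 0) z = 0" for z by (simp add: T_def)
  have Uk: "U S k \<subseteq> U S (Suc k)" for k unfolding U_def by (intro UN_mono) auto
  have "\<exists>e. (\<forall>i<N. e i \<in> W (Suc i)) \<and> (\<forall>i<N. \<forall>j<N. L2_inner (e i) (e j) = (if i = j then 1 else 0))"
  proof (rule orthonormal_chain[where f=F])
    show "W k \<subseteq> L2" for k by (auto simp: W_def)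
    show "W k \<subseteq> W (Suc k)" for k using Uk[of k] by (auto simp: W_def elim!: eventually_mono)
    show "(\<lambda>z. 0) \<in> W k" for k by (simp add: W_def T0)
    show "(\<lambda>z. a * f z + b * g z) \<in> W k" if "f \<in> W k" "g \<in> W k" for k f g a b
    proof -
      have "(\<lambda>z. a * f z + b * g z) \<in> L2" using that by (auto simp: W_def)
      moreover have "AE w in lebesgue. w \<notin> U S k \<longrightarrow> f w = 0" "AE w in lebesgue. w \<notin> U S k \<longrightarrow> g w = 0"
        using that by (auto simp: W_def)
      then have "AE w in lebesgue. w \<notin> U S k \<longrightarrow> a * f w + b * g w = 0" by eventually_elim auto
      moreover have "AE z in lebesgue. z \<notin> U Om N \<longrightarrow> T f z = 0" "AE z in lebesgue. z \<notin> U Om N \<longrightarrow> T g z = 0"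
        using that by (auto simp: W_def)
      then have "AE z in lebesgue. z \<notin> U Om N \<longrightarrow> T (\<lambda>z. a * f z + b * g z) z = 0"
        unfolding T_linear[OF Wi[OF that(1)] Wi[OF that(2)]] by eventually_elim auto
      ultimately show ?thesis by (simp add: W_def)
    qed
    show "g \<in> W k" if fW: "f \<in> W k" and g: "g \<in> L2" and eq: "L2_eq f g" for k f g
    proof -
      have eq': "AE w in lebesgue. f w = g w" using eq by (simp add: L2_eq_def)
      have "T g z = T f z" for z
        unfolding T_def using eq' L2_measurable[OF g] fW K_measurable[of z]
        by (intro integral_cong_AE borel_measurable_times) (auto simp: W_def dest: L2_measurable elim!: eventually_mono)
      moreover have "AE w in lebesgue. w \<notin> U S k \<longrightarrow> g w = 0"
      proof -
        have "AE w in lebesgue. w \<notin> U S k \<longrightarrow> f w = 0" using fW by (simp add: W_def)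
        then show ?thesis using eq' by eventually_elim auto
      qed
      ultimately show ?thesis using fW g by (simp add: W_def)
    qed
    fix k assume k: "k < N"
    show "F k \<in> W (Suc k)"
    proof -
      have "AE w in lebesgue. w - real k *\<^sub>R h \<notin> S \<longrightarrow> f (w - real k *\<^sub>R h) = 0" by (rule AE_translate[OF fS])
      then have "AE w in lebesgue. w \<notin> U S (Suc k) \<longrightarrow> F k w = 0"
        by eventually_elim (auto simp: F_def tau_def U_def shift_def)
      moreover have "AE z in lebesgue. z - real k *\<^sub>R h \<notin> Om \<longrightarrow> T f (z - real k *\<^sub>R h) = 0" by (rule AE_translate[OF fO])
      then have "AE z in lebesgue. z \<notin> U Om N \<longrightarrow> T (F k) z = 0"
        unfolding F_def T_tau[OF L2_measurable[OF f]] 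
        by eventually_elim (use k in \<open>auto simp: U_def shift_def\<close>)
      ultimately show ?thesis using tau_L2[OF f] by (simp add: W_def F_def)
    qed
    show "F k \<notin> W k"
    proof
      assume "F k \<in> W k"
      then have "AE w in lebesgue. w \<notin> U S k \<longrightarrow> F k w = 0" by (simp add: W_def)
      then have "AE w in lebesgue. w \<notin> shift (real k *\<^sub>R h) S - U S k"
        by eventually_elim (auto simp: F_def tau_def shift_def S_def)
      moreover have "shift (real k *\<^sub>R h) S - U S k \<in> sets lebesgue" using Ss Um[OF S] by auto
      ultimately have "shift (real k *\<^sub>R h) S - U S k \<in> null_sets lebesgue"
        using AE_iff_null_sets by blast
      then show False using translates_not_covered[OF S Snull h0, of k] by (simp add: U_def)
    qed
  qed
  then obtain e where e: "\<And>i. i < N \<Longrightarrow> e i \<in> W (Suc i)"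
    "\<And>i j. i < N \<Longrightarrow> j < N \<Longrightarrow> L2_inner (e i) (e j) = (if i = j then 1 else 0)" by blast
  have "real N \<le> (cmod c)\<^sup>2 * measure lebesgue (U S N) * measure lebesgue (U Om N)"
  proof (rule dimension_bound[OF Um[OF S] Um[OF O] _ e(2)])
    fix i assume i: "i < N"
    have eW: "e i \<in> W (Suc i)" by (rule e(1)[OF i])
    then show "e i \<in> L2" by (simp add: W_def)
    have "U S (Suc i) \<subseteq> U S N" unfolding U_def using i by (intro UN_mono) auto
    moreover have "AE w in lebesgue. w \<notin> U S (Suc i) \<longrightarrow> e i w = 0" using eW by (simp add: W_def)
    ultimately show "AE w in lebesgue. w \<notin> U S N \<longrightarrow> e i w = 0" by (auto elim!: eventually_mono)
    show "AE z in lebesgue. z \<notin> U Om N \<longrightarrow> T (e i) z = 0" using eW by (simp add: W_def)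
  qed
  also have "\<dots> \<le> B"
    unfolding B_def
    by (intro mult_mono mult_left_mono U_le[OF S n(1)[folded h_def]] U_le[OF O n(2)[folded h_def]]) auto
  finally show False using N by simp
qed

text \<open>
  Slices depend continuously on the point, by domination with a constant on \<open>E\<close>.
\<close>

lemma slice_difference_tendsto:
  assumes E: "E \<in> lmeasurable" and X: "X \<longlonglongrightarrow> z"
  shows "(\<lambda>n. L2_norm (\<lambda>w. slice E (X n) w - slice E z w)) \<longlonglongrightarrow> 0"
proof -
  have L: "(\<lambda>w. slice E (X n) w - slice E z w) \<in> L2" for n using slice_L2(1)[OF E] by auto
  have "(\<lambda>n. LINT w|lebesgue. (cmod (slice E (X n) w - slice E z w))\<^sup>2) \<longlonglongrightarrow> (LINT w|(lebesgue :: 'a measure). 0)"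
  proof (rule integral_dominated_convergence[where w="\<lambda>w. (2 * cmod c)\<^sup>2 * indicator E w"])
    show "(\<lambda>w. (cmod (slice E (X n) w - slice E z w))\<^sup>2) \<in> borel_measurable lebesgue" for n
      using L2_integrable_square[OF L[of n]] by auto
    show "integrable lebesgue (\<lambda>w. (2 * cmod c)\<^sup>2 * indicator E w)"
      by (intro integrable_mult_right integrable_real_indicator fmeasurableD[OF E] fmeasurableD2[OF E, unfolded less_top, folded infinity_ennreal_def])
    show "AE w in lebesgue. (\<lambda>n. (cmod (slice E (X n) w - slice E z w))\<^sup>2) \<longlonglongrightarrow> 0"
    proof (rule AE_I2)
      fix w
      have "(\<lambda>n. (cmod (slice E (X n) w - slice E z w))\<^sup>2) \<longlonglongrightarrow> (cmod (slice E z w - slice E z w))\<^sup>2"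
        unfolding slice_def by (intro tendsto_intros K_tendsto X)
      then show "(\<lambda>n. (cmod (slice E (X n) w - slice E z w))\<^sup>2) \<longlonglongrightarrow> 0" by simp
    qed
    show "AE w in lebesgue. norm ((cmod (slice E (X n) w - slice E z w))\<^sup>2) \<le> (2 * cmod c)\<^sup>2 * indicator E w" for n
    proof (rule AE_I2)
      fix w
      have "cmod (slice E (X n) w - slice E z w) \<le> 2 * cmod c * indicator E w"
        using norm_triangle_ineq4[of "cnj (K (X n) w)" "cnj (K z w)"] by (auto simp: slice_def indicator_def)
      then have "(cmod (slice E (X n) w - slice E z w))\<^sup>2 \<le> (2 * cmod c * indicator E w)\<^sup>2" by (intro power_mono) auto
      also have "(2 * cmod c * indicator E w)\<^sup>2 = (2 * cmod c)\<^sup>2 * indicator E w"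
        by (simp add: indicator_def)
      finally show "norm ((cmod (slice E (X n) w - slice E z w))\<^sup>2) \<le> (2 * cmod c)\<^sup>2 * indicator E w" by simp
    qed
  qed simp
  then have "(\<lambda>n. sqrt (LINT w|lebesgue. (cmod (slice E (X n) w - slice E z w))\<^sup>2)) \<longlonglongrightarrow> sqrt 0"
    by (intro tendsto_real_sqrt) simp
  then show ?thesis by (simp add: L2_norm_def)
qed

text \<open>
  The images of the unit ball are uniformly bounded and equicontinuous, with the modulus of
  continuity of the slices. As in the theorem of Arzela and Ascoli, a diagonal sequence which
  converges on a countable dense set converges everywhere.
\<close>

lemma pointwise_compact:
  fixes g :: "nat \<Rightarrow> 'a \<Rightarrow> complex"
  assumes E: "E \<in> lmeasurable" and g: "\<And>n. g n \<in> L2" "\<And>n. L2_norm (g n) \<le> 1" "\<And>n w. w \<notin> E \<Longrightarrow> g n w = 0"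
  shows "\<exists>r G. strict_mono r \<and> (\<forall>z. (\<lambda>n. T (g (r n)) z) \<longlonglongrightarrow> G z)"
proof -
  have Ti: "T (g n) z = L2_inner (g n) (slice E z)" for n z
    by (rule T_eq_inner[OF g(1) E]) (use g(3) in auto)
  have bound: "cmod (T (g n) z) \<le> cmod c * sqrt (measure lebesgue E)" for n z
  proof -
    have "cmod (T (g n) z) \<le> L2_norm (g n) * L2_norm (slice E z)"
      unfolding Ti by (rule L2_Cauchy_Schwarz[OF g(1) slice_L2(1)[OF E]])
    also have "\<dots> \<le> 1 * (cmod c * sqrt (measure lebesgue E))"
      by (intro mult_mono g(2) slice_L2(2)[OF E]) auto
    finally show ?thesis by simp
  qed
  have equi: "cmod (T (g n) z - T (g n) z') \<le> L2_norm (\<lambda>w. slice E z w - slice E z' w)" for n z z'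
  proof -
    have d: "(\<lambda>w. slice E z w - slice E z' w) \<in> L2" using slice_L2(1)[OF E] by auto
    have eq: "T (g n) z - T (g n) z' = L2_inner (g n) (\<lambda>w. slice E z w - slice E z' w)"
      unfolding Ti by (rule L2_inner_diff_right[OF slice_L2(1)[OF E] slice_L2(1)[OF E] g(1), symmetric])
    have "cmod (L2_inner (g n) (\<lambda>w. slice E z w - slice E z' w)) \<le> L2_norm (g n) * L2_norm (\<lambda>w. slice E z w - slice E z' w)"
      by (rule L2_Cauchy_Schwarz[OF g(1) d])
    also have "\<dots> \<le> 1 * L2_norm (\<lambda>w. slice E z w - slice E z' w)" by (rule mult_right_mono[OF g(2) L2_norm_nonneg])
    finally show ?thesis unfolding eq by (simp only: mult_1_left)
  qed
  obtain D :: "'a set" where D: "countable D" "\<And>X. open X \<Longrightarrow> X \<noteq> {} \<Longrightarrow> \<exists>d\<in>D. d \<in> X"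
    by (rule countable_dense_setE) blast
  obtain r where r: "strict_mono r" "\<And>d. d \<in> D \<Longrightarrow> \<exists>l. (\<lambda>n. T (g (r n)) d) \<longlonglongrightarrow> l"
    by (rule function_convergent_subsequence[OF D(1), of "\<lambda>n. T (g n)" "cmod c * sqrt (measure lebesgue E)", OF bound]) (rule that)
  have conv: "convergent (\<lambda>n. T (g (r n)) z)" for z
  proof -
    have "\<forall>k. \<exists>d\<in>D. d \<in> ball z (1 / real (Suc k))" by (intro allI D(2)) auto
    then obtain X where X: "\<And>k. X k \<in> D" "\<And>k. X k \<in> ball z (1 / real (Suc k))" by metis
    have "X \<longlonglongrightarrow> z"
    proof (rule LIMSEQ_I)
      fix e :: real assume "e > 0"
      then obtain N where N: "1 / real (Suc N) < e" using nat_approx_posE by metis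
      have "norm (X k - z) < e" if "k \<ge> N" for k
      proof -
        have "norm (X k - z) < 1 / real (Suc k)" using X(2)[of k] by (simp add: dist_norm norm_minus_commute)
        also have "\<dots> \<le> 1 / real (Suc N)" using that by (simp add: frac_le)
        finally show ?thesis using N by simp
      qed
      then show "\<exists>no. \<forall>n\<ge>no. norm (X n - z) < e" by blast
    qed
    from slice_difference_tendsto[OF E this]
    have sd: "(\<lambda>k. L2_norm (\<lambda>w. slice E (X k) w - slice E z w)) \<longlonglongrightarrow> 0" .
    have "Cauchy (\<lambda>n. T (g (r n)) z)"
    proof (rule metric_CauchyI)
      fix e :: real assume e: "e > 0"
      have "eventually (\<lambda>k. L2_norm (\<lambda>w. slice E (X k) w - slice E z w) < e/3) sequentially"
        using e by (intro order_tendstoD(2)[OF sd]) auto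
      then obtain k where k: "L2_norm (\<lambda>w. slice E (X k) w - slice E z w) < e/3" by (auto simp: eventually_sequentially)
      obtain l where "(\<lambda>n. T (g (r n)) (X k)) \<longlonglongrightarrow> l" using r(2)[OF X(1)] by blast
      from metric_CauchyD[OF LIMSEQ_imp_Cauchy[OF this], of "e/3"] e
      obtain M where M: "\<And>m n. m \<ge> M \<Longrightarrow> n \<ge> M \<Longrightarrow> dist (T (g (r m)) (X k)) (T (g (r n)) (X k)) < e/3" by auto
      have "dist (T (g (r m)) z) (T (g (r n)) z) < e" if "m \<ge> M" "n \<ge> M" for m n
      proof -
        have a: "dist (T (g (r j)) (X k)) (T (g (r j)) z) < e/3" for j using equi[of "r j" "X k" z] k by (simp add: dist_norm)
        have "dist (T (g (r m)) z) (T (g (r n)) z) \<le> dist (T (g (r m)) z) (T (g (r m)) (X k)) + dist (T (g (r m)) (X k)) (T (g (r n)) z)"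
          by (rule dist_triangle)
        also have "dist (T (g (r m)) (X k)) (T (g (r n)) z) \<le> dist (T (g (r m)) (X k)) (T (g (r n)) (X k)) + dist (T (g (r n)) (X k)) (T (g (r n)) z)"
          by (rule dist_triangle)
        finally show ?thesis using a[of m] a[of n] M[OF that] by (simp add: dist_commute)
      qed
      then show "\<exists>M. \<forall>m\<ge>M. \<forall>n\<ge>M. dist (T (g (r m)) z) (T (g (r n)) z) < e" by blast
    qed
    then show ?thesis by (rule Cauchy_convergent)
  qed
  then have "\<forall>z. (\<lambda>n. T (g (r n)) z) \<longlonglongrightarrow> lim (\<lambda>n. T (g (r n)) z)" by (simp add: convergent_LIMSEQ_iff)
  with r(1) show ?thesis by (intro exI[of _ r] exI[of _ "\<lambda>z. lim (\<lambda>n. T (g (r n)) z)"] conjI)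
qed

text \<open>
  Suppose that normalised \<open>g n\<close> supported in \<open>E\<close> have images with tails outside \<open>Om\<close> tending to
  zero. Along a subsequence the images converge pointwise; on \<open>Om\<close> they are uniformly bounded,
  so there they converge in norm, and outside they tend to zero. Hence the images converge in
  norm, and by isometry the \<open>g n\<close> do as well. Their limit has norm one, support in \<open>E\<close> and an
  image supported in \<open>Om\<close>, which contradicts \<open>no_concentration\<close>.
\<close>

lemma concentration_bound:
  assumes E: "E \<in> lmeasurable" and O: "Om \<in> lmeasurable"
  shows "\<exists>\<delta>>0. \<forall>g\<in>L2. (\<forall>w. w \<notin> E \<longrightarrow> g w = 0) \<longrightarrow> \<delta> * L2_norm g \<le> L2_norm (\<lambda>z. indicator (- Om) z * T g z)"
proof (rule ccontr)
  assume contra: "\<not> ?thesis"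
  have gi: "integrable lebesgue g" if "g \<in> L2" "\<And>w. w \<notin> E \<Longrightarrow> g w = 0" for g
    by (rule support_integrable[OF that(1) E]) (use that(2) in auto)
  have "\<exists>g. g \<in> L2 \<and> (\<forall>w. w \<notin> E \<longrightarrow> g w = 0) \<and> L2_norm g = 1 \<and> L2_norm (\<lambda>z. indicator (- Om) z * T g z) < 1 / real (Suc n)" for n
  proof -
    have "0 < 1 / real (Suc n)" by simp
    then obtain g where g: "g \<in> L2" "\<And>w. w \<notin> E \<Longrightarrow> g w = 0"
      "L2_norm (\<lambda>z. indicator (- Om) z * T g z) < 1 / real (Suc n) * L2_norm g"
      using contra by (meson not_le)
    have pos: "0 < L2_norm g"
    proof -
      have "L2_norm g \<noteq> 0"
      proof
        assume "L2_norm g = 0"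
        then have "L2_norm (\<lambda>z. indicator (- Om) z * T g z) < 0" using g(3) by simp
        then show False using L2_norm_nonneg[of "\<lambda>z. indicator (- Om) z * T g z"] by linarith
      qed
      then show ?thesis by (simp add: less_le)
    qed
    define a where "a = complex_of_real (1 / L2_norm g)"
    have ca: "cmod a = 1 / L2_norm g" unfolding a_def norm_of_real using pos by simp
    have Ta: "T (\<lambda>w. a * g w) z = a * T g z" for z
      using T_linear[OF gi[OF g(1,2)] gi[OF g(1,2)], of a 0 z] by simp
    have "L2_norm (\<lambda>z. indicator (- Om) z * T (\<lambda>w. a * g w) z) = cmod a * L2_norm (\<lambda>z. indicator (- Om) z * T g z)"
      unfolding Ta L2_norm_scale[symmetric] by (simp add: mult_ac)
    also have "\<dots> < cmod a * (1 / real (Suc n) * L2_norm g)"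
      by (rule mult_strict_left_mono[OF g(3)]) (use ca pos in simp)
    also have "\<dots> = 1 / real (Suc n)" using ca pos by simp
    finally show ?thesis using g(1,2) pos ca by (intro exI[of _ "\<lambda>w. a * g w"]) (auto simp: L2_norm_scale)
  qed
  then have "\<forall>n. \<exists>g. g \<in> L2 \<and> (\<forall>w. w \<notin> E \<longrightarrow> g w = 0) \<and> L2_norm g = 1 \<and> L2_norm (\<lambda>z. indicator (- Om) z * T g z) < 1 / real (Suc n)"
    by (rule allI)
  from choice[OF this] obtain g where g': "\<forall>n. g n \<in> L2 \<and> (\<forall>w. w \<notin> E \<longrightarrow> g n w = 0) \<and> L2_norm (g n) = 1
      \<and> L2_norm (\<lambda>z. indicator (- Om) z * T (g n) z) < 1 / real (Suc n)" ..
  have g: "g n \<in> L2" "w \<notin> E \<Longrightarrow> g n w = 0" "L2_norm (g n) = 1"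
    "L2_norm (\<lambda>z. indicator (- Om) z * T (g n) z) < 1 / real (Suc n)" for n w
    using g'[rule_format, of n] by blast+
  have g1: "L2_norm (g n) \<le> 1" for n using g(3)[of n] by simp
  have gint: "integrable lebesgue (g n)" for n by (rule gi[OF g(1)]) (rule g(2))
  have TL: "T (g n) \<in> L2" for n by (rule T_L2[OF g(1) gint])
  have "\<exists>r G. strict_mono r \<and> (\<forall>z. (\<lambda>n. T (g (r n)) z) \<longlonglongrightarrow> G z)"
    by (rule pointwise_compact[OF E g(1) g1]) (rule g(2))
  then obtain r G where r: "strict_mono r" and G: "\<And>z. (\<lambda>n. T (g (r n)) z) \<longlonglongrightarrow> G z" by blast
  have Os: "Om \<in> sets lebesgue" "- Om \<in> sets lebesgue" using fmeasurableD[OF O] by (auto simp: Compl_eq_Diff_UNIV)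
  define C where "C = cmod c * sqrt (measure lebesgue E)"
  have C0: "0 \<le> C" by (simp add: C_def)
  have bound: "cmod (T (g n) z) \<le> C" for n z
  proof -
    have "T (g n) z = L2_inner (g n) (slice E z)" by (rule T_eq_inner[OF g(1) E]) (use g(2) in auto)
    then have "cmod (T (g n) z) \<le> L2_norm (g n) * L2_norm (slice E z)"
      using L2_Cauchy_Schwarz[OF g(1) slice_L2(1)[OF E]] by simp
    then show ?thesis using slice_L2(2)[OF E, of z] by (simp add: g(3) C_def)
  qed
  have Gm: "G \<in> borel_measurable lebesgue"
    by (rule borel_measurable_LIMSEQ_metric[OF L2_measurable[OF TL]]) (use G in auto)
  have Gb: "cmod (G z) \<le> C" for z by (rule LIMSEQ_le_const2[OF tendsto_norm[OF G]]) (use bound in auto)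
  define H where "H z = indicator Om z * G z" for z
  have HL: "H \<in> L2"
  proof -
    have "(\<lambda>z. G z * indicator Om z) \<in> L2" by (rule L2_bounded_mult(1)[OF indicator_L2(1)[OF O] Gm Gb C0])
    then show ?thesis by (simp add: H_def[abs_def] mult.commute)
  qed
  have inner_part: "(\<lambda>n. L2_norm (\<lambda>z. indicator Om z * T (g (r n)) z - H z)) \<longlonglongrightarrow> 0"
  proof -
    have L: "(\<lambda>z. indicator Om z * T (g (r n)) z - H z) \<in> L2" for n by (intro L2_diff L2_indicator TL HL Os)
    have "(\<lambda>n. LINT z|lebesgue. (cmod (indicator Om z * T (g (r n)) z - H z))\<^sup>2) \<longlonglongrightarrow> (LINT z|(lebesgue :: 'a measure). 0)"
    proof (rule integral_dominated_convergence[where w="\<lambda>z. (2 * C)\<^sup>2 * indicator Om z"])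
      show "(\<lambda>z. (cmod (indicator Om z * T (g (r n)) z - H z))\<^sup>2) \<in> borel_measurable lebesgue" for n
        using L2_integrable_square[OF L[of n]] by auto
      show "integrable lebesgue (\<lambda>z. (2 * C)\<^sup>2 * indicator Om z)"
        by (intro integrable_mult_right integrable_real_indicator Os fmeasurableD2[OF O, unfolded less_top, folded infinity_ennreal_def])
      show "AE z in lebesgue. (\<lambda>n. (cmod (indicator Om z * T (g (r n)) z - H z))\<^sup>2) \<longlonglongrightarrow> 0"
      proof (rule AE_I2)
        fix z
        have "(\<lambda>n. (cmod (indicator Om z * T (g (r n)) z - H z))\<^sup>2) \<longlonglongrightarrow> (cmod (indicator Om z * G z - H z))\<^sup>2"
          by (intro tendsto_intros G)
        then show "(\<lambda>n. (cmod (indicator Om z * T (g (r n)) z - H z))\<^sup>2) \<longlonglongrightarrow> 0" by (simp add: H_def)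
      qed
      show "AE z in lebesgue. norm ((cmod (indicator Om z * T (g (r n)) z - H z))\<^sup>2) \<le> (2 * C)\<^sup>2 * indicator Om z" for n
      proof (rule AE_I2)
        fix z
        have "cmod (T (g (r n)) z - G z) \<le> 2 * C"
          using norm_triangle_ineq4[of "T (g (r n)) z" "G z"] bound[of "r n" z] Gb[of z] by linarith
        then have "(cmod (T (g (r n)) z - G z))\<^sup>2 \<le> (2 * C)\<^sup>2" by (intro power_mono) auto
        then show "norm ((cmod (indicator Om z * T (g (r n)) z - H z))\<^sup>2) \<le> (2 * C)\<^sup>2 * indicator Om z"
          by (simp add: H_def indicator_def)
      qed
    qed simp
    then have "(\<lambda>n. sqrt (LINT z|lebesgue. (cmod (indicator Om z * T (g (r n)) z - H z))\<^sup>2)) \<longlonglongrightarrow> sqrt 0"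
      by (intro tendsto_real_sqrt) simp
    then show ?thesis by (simp add: L2_norm_def)
  qed
  have outer_part: "(\<lambda>n. L2_norm (\<lambda>z. indicator (- Om) z * T (g (r n)) z)) \<longlonglongrightarrow> 0"
  proof (rule Lim_null_comparison[OF always_eventually lim_inverse_n'[THEN LIMSEQ_Suc]], rule allI)
    fix n
    have "L2_norm (\<lambda>z. indicator (- Om) z * T (g (r n)) z) \<le> 1 / real (Suc (r n))" using g(4)[of "r n"] by simp
    also have "\<dots> \<le> 1 / real (Suc n)" using seq_suble[OF r, of n] by (simp add: frac_le)
    finally show "norm (L2_norm (\<lambda>z. indicator (- Om) z * T (g (r n)) z)) \<le> 1 / real (Suc n)" by simp
  qed
  have TH: "L2_tendsto (\<lambda>n. T (g (r n))) H"
    unfolding L2_tendsto_def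
  proof (intro conjI allI TL HL)
    show "(\<lambda>n. L2_norm (\<lambda>z. T (g (r n)) z - H z)) \<longlonglongrightarrow> 0"
    proof (rule Lim_null_comparison[OF always_eventually], rule allI)
      fix n
      have "(\<lambda>z. T (g (r n)) z - H z) = (\<lambda>z. (indicator Om z * T (g (r n)) z - H z) + indicator (- Om) z * T (g (r n)) z)"
        by (auto simp: indicator_def fun_eq_iff)
      then show "norm (L2_norm (\<lambda>z. T (g (r n)) z - H z)) \<le> L2_norm (\<lambda>z. indicator Om z * T (g (r n)) z - H z) + L2_norm (\<lambda>z. indicator (- Om) z * T (g (r n)) z)"
        using L2_norm_triangle[of "\<lambda>z. indicator Om z * T (g (r n)) z - H z" "\<lambda>z. indicator (- Om) z * T (g (r n)) z"]
          L2_diff[OF L2_indicator[OF TL Os(1)] HL] L2_indicator[OF TL Os(2)] by simp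
      show "(\<lambda>n. L2_norm (\<lambda>z. indicator Om z * T (g (r n)) z - H z) + L2_norm (\<lambda>z. indicator (- Om) z * T (g (r n)) z)) \<longlonglongrightarrow> 0"
        using tendsto_add[OF inner_part outer_part] by simp
    qed
  qed
  have iso: "L2_norm (\<lambda>w. T f w - T f' w) = L2_norm (\<lambda>w. f w - f' w)"
    if "f \<in> L2" "integrable lebesgue f" "f' \<in> L2" "integrable lebesgue f'" for f f'
    using T_norm[OF L2_diff[OF that(1,3)] Bochner_Integration.integrable_diff[OF that(2,4)]] unfolding T_diff[OF that(2,4)] .
  have "\<exists>f. L2_tendsto (\<lambda>n. g (r n)) f"
  proof (rule L2_complete[OF g(1)])
    fix e :: real assume e: "e > 0"
    have lim: "(\<lambda>n. L2_norm (\<lambda>z. T (g (r n)) z - H z)) \<longlonglongrightarrow> 0" using TH by (simp add: L2_tendsto_def)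
    have "eventually (\<lambda>n. L2_norm (\<lambda>z. T (g (r n)) z - H z) < e/2) sequentially"
      using e by (intro order_tendstoD(2)[OF lim]) auto
    then obtain N where N: "\<And>n. n \<ge> N \<Longrightarrow> L2_norm (\<lambda>z. T (g (r n)) z - H z) < e/2" by (auto simp: eventually_sequentially)
    have "L2_norm (\<lambda>z. g (r m) z - g (r n) z) \<le> e" if "m \<ge> N" "n \<ge> N" for m n
    proof -
      have "L2_norm (\<lambda>z. g (r m) z - g (r n) z) = L2_norm (\<lambda>z. T (g (r m)) z - T (g (r n)) z)"
        by (rule iso[OF g(1) gint g(1) gint, symmetric])
      also have "\<dots> \<le> L2_norm (\<lambda>z. T (g (r m)) z - H z) + L2_norm (\<lambda>z. H z - T (g (r n)) z)"
        by (rule L2_norm_diff_triangle[OF TL HL TL])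
      finally show ?thesis using N[OF that(1)] N[OF that(2)] by (simp add: L2_norm_minus_commute[of H])
    qed
    then show "\<exists>N. \<forall>m\<ge>N. \<forall>n\<ge>N. L2_norm (\<lambda>z. g (r m) z - g (r n) z) \<le> e" by blast
  qed
  then obtain f where f: "L2_tendsto (\<lambda>n. g (r n)) f" by blast
  have fL: "f \<in> L2" using f by (simp add: L2_tendsto_def)
  \<comment> \<open>The limit vanishes off \<open>E\<close> only almost everywhere; cutting off changes it on a null set.\<close>
  define k where "k w = indicator E w * f w" for w
  have kL: "k \<in> L2" unfolding k_def[abs_def] by (intro L2_indicator fL fmeasurableD[OF E])
  have kE: "k w = 0" if "w \<notin> E" for w using that by (simp add: k_def)
  have ki: "integrable lebesgue k" by (rule gi[OF kL kE])
  have gk: "(\<lambda>n. L2_norm (\<lambda>w. g (r n) w - k w)) \<longlonglongrightarrow> 0"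
  proof (rule Lim_null_comparison[OF always_eventually], rule allI)
    fix n
    have "(\<lambda>w. g (r n) w - k w) = (\<lambda>w. indicator E w * (g (r n) w - f w))"
      using g(2) by (auto simp: k_def indicator_def fun_eq_iff)
    then show "norm (L2_norm (\<lambda>w. g (r n) w - k w)) \<le> L2_norm (\<lambda>w. g (r n) w - f w)"
      using L2_bounded_mult(2)[OF L2_diff[OF g(1) fL], of "indicator E" 1 "r n"] fmeasurableD[OF E] by (simp add: indicator_def)
    show "(\<lambda>n. L2_norm (\<lambda>w. g (r n) w - f w)) \<longlonglongrightarrow> 0" using f by (simp add: L2_tendsto_def)
  qed
  have "L2_tendsto (\<lambda>n. g (r n)) k" using g(1) kL gk by (simp add: L2_tendsto_def)
  from L2_tendsto_norm[OF this] have norm_k: "L2_norm k = 1" using LIMSEQ_unique[OF _ tendsto_const[of 1]] by (simp add: g(3) LIMSEQ_const_iff)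
  have TkL: "T k \<in> L2" by (rule T_L2[OF kL ki])
  have tail: "L2_norm (\<lambda>z. indicator (- Om) z * T k z) \<le> 0"
  proof (rule LIMSEQ_le_const)
    show "(\<lambda>n. L2_norm (\<lambda>z. indicator (- Om) z * T (g (r n)) z) + L2_norm (\<lambda>w. g (r n) w - k w)) \<longlonglongrightarrow> 0"
      using tendsto_add[OF outer_part gk] by simp
    have "L2_norm (\<lambda>z. indicator (- Om) z * T k z) \<le> L2_norm (\<lambda>z. indicator (- Om) z * T (g (r n)) z) + L2_norm (\<lambda>w. g (r n) w - k w)" for n
    proof -
      have d: "(\<lambda>z. T k z - T (g (r n)) z) \<in> L2" by (rule L2_diff[OF TkL TL])
      have "L2_norm (\<lambda>z. indicator (- Om) z * T k z)
          = L2_norm (\<lambda>z. indicator (- Om) z * T (g (r n)) z + indicator (- Om) z * (T k z - T (g (r n)) z))"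
        by (simp add: algebra_simps)
      also have "\<dots> \<le> L2_norm (\<lambda>z. indicator (- Om) z * T (g (r n)) z) + L2_norm (\<lambda>z. indicator (- Om) z * (T k z - T (g (r n)) z))"
        by (rule L2_norm_triangle[OF L2_indicator[OF TL Os(2)] L2_indicator[OF d Os(2)]])
      also have "L2_norm (\<lambda>z. indicator (- Om) z * (T k z - T (g (r n)) z)) \<le> 1 * L2_norm (\<lambda>z. T k z - T (g (r n)) z)"
        by (rule L2_bounded_mult(2)[OF d]) (use Os in \<open>auto simp: indicator_def\<close>)
      also have "1 * L2_norm (\<lambda>z. T k z - T (g (r n)) z) = L2_norm (\<lambda>w. g (r n) w - k w)"
        using iso[OF kL ki g(1) gint] by (simp add: L2_norm_minus_commute[of k])
      finally show ?thesis by simp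
    qed
    then show "\<exists>N. \<forall>n\<ge>N. L2_norm (\<lambda>z. indicator (- Om) z * T k z) \<le> L2_norm (\<lambda>z. indicator (- Om) z * T (g (r n)) z) + L2_norm (\<lambda>w. g (r n) w - k w)"
      by blast
  qed
  then have "L2_norm (\<lambda>z. indicator (- Om) z * T k z) = 0" by (simp add: antisym)
  then have "AE z in lebesgue. indicator (- Om) z * T k z = 0" using L2_norm_zero_iff[OF L2_indicator[OF TkL Os(2)]] by simp
  then have "AE z in lebesgue. z \<notin> Om \<longrightarrow> T k z = 0" by eventually_elim (auto simp: indicator_def)
  then have "L2_norm k = 0" using no_concentration[OF E O kL] kE by auto
  then show False using norm_k by simp
qed

end

section \<open>The observability inequality\<close>

lemma bounded_bilinear_symplectic: "bounded_bilinear (\<lambda>(w :: complex^'d::finite) z. k * symplectic w z)"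
proof -
  have l: "linear (\<lambda>w. symplectic w z)" for z :: "complex^'d" by (rule bounded_linear.linear[OF bounded_linear_symplectic])
  have r: "linear (\<lambda>z. symplectic w z)" for w :: "complex^'d"
    unfolding symplectic_antisym[of w] by (rule linear_compose_neg[OF l])
  have "linear (\<lambda>w. k *\<^sub>R symplectic w z)" "linear (\<lambda>z. k *\<^sub>R symplectic w z)" for w z :: "complex^'d"
    by (intro linear_compose_scale_right l r)+
  then have "bilinear (\<lambda>(w :: complex^'d) z. k * symplectic w z)" by (simp add: bilinear_def)
  then show ?thesis by (simp add: bilinear_conv_bounded_bilinear)
qed

lemma set_integral_square:
  "(LINT z:A|lebesgue. (cmod (f z))\<^sup>2) = (L2_norm (\<lambda>z. indicator A z * f z))\<^sup>2"
  unfolding set_lebesgue_integral_def L2_norm_square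
  by (intro Bochner_Integration.integral_cong) (auto simp: indicator_def)

theorem theorem1p2:
  fixes lam t :: real and E \<Omega> :: "(complex^'d::finite) set"
  assumes "lam \<noteq> 0"
    and "E \<in> sets lebesgue" and "0 < emeasure lebesgue E" and "emeasure lebesgue E < \<infinity>"
    and "\<Omega> \<in> sets lebesgue" and "0 < emeasure lebesgue \<Omega>" and "emeasure lebesgue \<Omega> < \<infinity>"
    and "0 < t" and "\<forall>k::int. lam * t \<noteq> pi * of_int k"
  shows "\<exists>C>0. \<forall>u\<^sub>0 u. u\<^sub>0 \<in> L2 \<longrightarrow> schroedinger_solution lam u\<^sub>0 u \<longrightarrow>
    (LINT z|lebesgue. (cmod (u\<^sub>0 z))\<^sup>2)
      \<le> C * ((LINT z:-E|lebesgue. (cmod (u\<^sub>0 z))\<^sup>2) + (LINT z:-\<Omega>|lebesgue. (cmod (u t z))\<^sup>2))"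
proof (cases "\<exists>P. spectral_resolution P (special_hermite_closure lam :: ((complex^'d \<Rightarrow> complex) \<times> (complex^'d \<Rightarrow> complex)) set)")
  \<comment> \<open>Without a spectral resolution there would be no solutions to estimate.\<close>
  case False
  then show ?thesis by (intro exI[of _ 1]) (auto simp: schroedinger_solution_def)
next
  case True
  then obtain P\<^sub>0 where P0: "spectral_resolution P\<^sub>0 (special_hermite_closure lam :: ((complex^'d \<Rightarrow> complex) \<times> (complex^'d \<Rightarrow> complex)) set)" ..
  have t: "0 \<le> t" using assms(8) by simp
  have sin: "sin (lam * t) \<noteq> 0"
    using assms(9) by (auto simp: sin_zero_iff_int2 mult.commute)
  obtain c where c: "\<And>P u\<^sub>0 u. spectral_resolution P (special_hermite_closure lam) \<Longrightarrow> u\<^sub>0 \<in> L2 \<Longrightarrow> integrable lebesgue u\<^sub>0 \<Longrightarrow>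
      (u\<^sub>0, u) \<in> spectral_integral P (\<lambda>x. exp (- \<i> * complex_of_real (t * x))) \<Longrightarrow>
      AE w in lebesgue. u w = (LINT z|lebesgue. c * cis (mehler_phase lam t w (z :: complex^'d)) * u\<^sub>0 z)"
    using schroedinger_kernel[OF assms(1) sin t, where 'd='d] by blast
  define q where "q x = lam / 4 * (cos (lam * t) / sin (lam * t)) * (x \<bullet> x)" for x :: "complex^'d"
  define om where "om w z = - (lam / 2) * symplectic w z" for w z :: "complex^'d"
  interpret oscillatory_kernel c q om
  proof (rule oscillatory_kernel.intro)
    show "continuous_on UNIV q" unfolding q_def[abs_def] by (intro continuous_intros)
    show "bounded_bilinear om" unfolding om_def[abs_def] by (rule bounded_bilinear_symplectic)
  qed
  have Teq: "AE w in lebesgue. v w = T f w"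
    if "spectral_resolution P (special_hermite_closure lam)" "f \<in> L2" "integrable lebesgue f"
      "(f, v) \<in> spectral_integral P (\<lambda>x. exp (- \<i> * complex_of_real (t * x)))" for P f v
    using c[OF that] unfolding T_def K_def mehler_phase_def q_def om_def .
  \<comment> \<open>Unitarity of the kernel operator is read off from the group \<open>exp (- i t L)\<close>, whichever
      spectral measure defines it; the kernel does not depend on that choice.\<close>
  interpret unitary_kernel c q om
  proof (intro unitary_kernel.intro unitary_kernel_axioms.intro oscillatory_kernel_axioms)
    fix f :: "complex^'d \<Rightarrow> complex" assume f: "f \<in> L2" "integrable lebesgue f"
    interpret P: pvm P\<^sub>0 by unfold_locales (use P0 in \<open>simp add: spectral_resolution_def\<close>)
    obtain v where v: "(f, v) \<in> spectral_integral P\<^sub>0 (\<lambda>x. exp (- \<i> * complex_of_real (t * x)))"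
      using P.unitary_group_ex[OF f(1)] by blast
    have vL: "v \<in> L2" using v by (simp add: spectral_integral_def)
    have eq: "AE w in lebesgue. v w = T f w" by (rule Teq[OF P0 f v])
    have Tm: "T f \<in> borel_measurable lebesgue" by (rule continuous_measurable_lebesgue[OF T_continuous[OF f(2)]])
    show TL: "T f \<in> L2"
      by (rule L2_dominated(1)[OF vL Tm, where C=1]) (use eq in \<open>auto elim!: eventually_mono\<close>)
    have "L2_norm (T f) = L2_norm v"
      by (rule L2_norm_cong[OF TL vL]) (use eq in \<open>auto simp: L2_eq_def elim!: eventually_mono\<close>)
    then show "L2_norm (T f) = L2_norm f" using P.unitary_group_norm[OF f(1) v] by simp
  qed
  have E: "E \<in> lmeasurable" and O: "\<Omega> \<in> lmeasurable" using assms by (auto intro: fmeasurableI)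
  have cE: "- E \<in> sets lebesgue" and cO: "- \<Omega> \<in> sets lebesgue" using assms(2,5) by (auto simp: Compl_eq_Diff_UNIV)
  obtain \<delta> where \<delta>: "\<delta> > 0"
    "\<And>g. g \<in> L2 \<Longrightarrow> (\<And>w. w \<notin> E \<Longrightarrow> g w = 0) \<Longrightarrow> \<delta> * L2_norm g \<le> L2_norm (\<lambda>z. indicator (- \<Omega>) z * T g z)"
    using concentration_bound[OF E O] by blast
  show ?thesis
  \<comment> \<open>The constant is \<open>(1 + 1 / \<delta>)\<^sup>2\<close>, with a factor \<open>2\<close> from \<open>(a + b)\<^sup>2 \<le> 2 (a\<^sup>2 + b\<^sup>2)\<close>.\<close>
  proof (intro exI[of _ "2 * (1 + 1 / \<delta>)\<^sup>2"] conjI allI impI)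
    have c\<delta>: "0 < 1 + 1 / \<delta>" using \<delta>(1) by (intro add_pos_pos) auto
    then show "0 < 2 * (1 + 1 / \<delta>)\<^sup>2" by (intro mult_pos_pos zero_less_power) auto
    fix u\<^sub>0 :: "complex^'d \<Rightarrow> complex" and u :: "real \<Rightarrow> complex^'d \<Rightarrow> complex"
    assume u0: "u\<^sub>0 \<in> L2" and "schroedinger_solution lam u\<^sub>0 u"
    then obtain P where P: "spectral_resolution P (special_hermite_closure lam)"
      and u: "(u\<^sub>0, u t) \<in> spectral_integral P (\<lambda>x. exp (- \<i> * complex_of_real (t * x)))"
      using t unfolding schroedinger_solution_def by blast
    interpret P: pvm P by unfold_locales (use P in \<open>simp add: spectral_resolution_def\<close>)
    define g where "g z = indicator E z * u\<^sub>0 z" for z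
    have gL: "g \<in> L2" unfolding g_def[abs_def] by (rule L2_indicator[OF u0 assms(2)])
    have g0: "g w = 0" if "w \<notin> E" for w using that by (simp add: g_def)
    have gi: "integrable lebesgue g" by (rule support_integrable[OF gL E]) (use g0 in auto)
    obtain v where v: "(g, v) \<in> spectral_integral P (\<lambda>x. exp (- \<i> * complex_of_real (t * x)))"
      using P.unitary_group_ex[OF gL] by blast
    have vL: "v \<in> L2" and uL: "u t \<in> L2" using v u by (simp_all add: spectral_integral_def)
    define a b where "a = L2_norm (\<lambda>z. indicator (- E) z * u\<^sub>0 z)" and "b = L2_norm (\<lambda>z. indicator (- \<Omega>) z * u t z)"
    have ab: "0 \<le> a" "0 \<le> b" by (simp_all add: a_def b_def)
    have diff: "(\<lambda>z. u\<^sub>0 z - g z) = (\<lambda>z. indicator (- E) z * u\<^sub>0 z)" by (auto simp: g_def indicator_def fun_eq_iff)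
    have uv: "L2_norm (\<lambda>z. u t z - v z) = a"
      using P.unitary_group_norm_diff[OF u0 u gL v] unfolding diff a_def .
    have "\<delta> * L2_norm g \<le> L2_norm (\<lambda>z. indicator (- \<Omega>) z * T g z)" by (rule \<delta>(2)[OF gL g0])
    also have "\<dots> = L2_norm (\<lambda>z. indicator (- \<Omega>) z * v z)"
      by (rule L2_norm_cong) (use Teq[OF P gL gi v] L2_indicator[OF T_L2[OF gL gi] cO] L2_indicator[OF vL cO] in \<open>auto simp: L2_eq_def elim!: eventually_mono\<close>)
    also have "\<dots> = L2_norm (\<lambda>z. indicator (- \<Omega>) z * u t z + indicator (- \<Omega>) z * (v z - u t z))" by (simp add: algebra_simps)
    also have "\<dots> \<le> b + L2_norm (\<lambda>z. indicator (- \<Omega>) z * (v z - u t z))"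
      unfolding b_def by (rule L2_norm_triangle[OF L2_indicator[OF uL cO] L2_indicator[OF L2_diff[OF vL uL] cO]])
    also have "L2_norm (\<lambda>z. indicator (- \<Omega>) z * (v z - u t z)) \<le> 1 * L2_norm (\<lambda>z. v z - u t z)"
      by (rule L2_bounded_mult(2)[OF L2_diff[OF vL uL] borel_measurable_indicator[OF cO]]) (auto simp: indicator_def)
    finally have "\<delta> * L2_norm g \<le> b + a" using uv by (simp add: L2_norm_minus_commute[of v])
    then have g_le: "L2_norm g \<le> (a + b) / \<delta>" using \<delta>(1) by (simp add: pos_le_divide_eq mult.commute)
    have "L2_norm u\<^sub>0 \<le> L2_norm g + a"
    proof -
      have "L2_norm (\<lambda>z. g z + (u\<^sub>0 z - g z)) \<le> L2_norm g + L2_norm (\<lambda>z. u\<^sub>0 z - g z)"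
        by (rule L2_norm_triangle[OF gL L2_diff[OF u0 gL]])
      then show ?thesis by (simp add: diff a_def)
    qed
    also have "\<dots> \<le> (a + b) / \<delta> + (a + b)" using g_le ab by linarith
    also have "\<dots> = (1 + 1 / \<delta>) * (a + b)" by (simp add: field_simps)
    finally have "(L2_norm u\<^sub>0)\<^sup>2 \<le> ((1 + 1 / \<delta>) * (a + b))\<^sup>2" by (rule power_mono) simp
    also have "\<dots> = (1 + 1 / \<delta>)\<^sup>2 * (a + b)\<^sup>2" by (rule power_mult_distrib)
    also have "\<dots> \<le> (1 + 1 / \<delta>)\<^sup>2 * (2 * (a\<^sup>2 + b\<^sup>2))"
    proof (rule mult_left_mono[OF _ zero_le_power2])
      show "(a + b)\<^sup>2 \<le> 2 * (a\<^sup>2 + b\<^sup>2)" using sum_squares_bound[of a b] by (simp add: power2_sum)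
    qed
    also have "\<dots> = 2 * (1 + 1 / \<delta>)\<^sup>2 * (a\<^sup>2 + b\<^sup>2)" by (simp only: mult_ac)
    finally show "(LINT z|lebesgue. (cmod (u\<^sub>0 z))\<^sup>2)
        \<le> 2 * (1 + 1 / \<delta>)\<^sup>2 * ((LINT z:-E|lebesgue. (cmod (u\<^sub>0 z))\<^sup>2) + (LINT z:-\<Omega>|lebesgue. (cmod (u t z))\<^sup>2))"
      unfolding set_integral_square a_def[symmetric] b_def[symmetric] L2_norm_square[symmetric] .
  qed
qed

end
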